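(* Let $n\ge1$, $\gamma\in(0,1)$, $T>0$, $\tau>0$, $s>0$, and let $\varphi$ be the function on $\mathbb{R}^n$ with $\widehat\varphi(\xi)=(2\pi)^{-n/2}\exp(-\tau|\xi|^s)$. For $g\in L^2(\mathbb{R}^n)$ and $\alpha>0$ let $M_\alpha g=\varphi_\alpha\star g$, where $\varphi_\alpha(x)=\alpha^{-n}\varphi(x/\alpha)$, and let $u_\alpha$ be the solution of $\partial_t^\gamma u=\Delta u$ on $\mathbb{R}^n\times(0,T)$ with $u(\cdot,T)=M_\alpha g$. Then the family $(u_\alpha)_{\alpha>0}$ defines a regularization method in $L^2(\mathbb{R}^n)$ for the problem of recovering $u(\cdot,0)$ from $g=u(\cdot,T)$, where $\partial_t^\gamma u=\Delta u$ on $\mathbb{R}^n\times(0,T)$.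
   Context: The Fourier transform is $\widehat f(\xi)=(2\pi)^{-n/2}\int_{\mathbb{R}^n}f(x)e^{-ix\cdot\xi}\,dx$. $\partial_t^\gamma$ is the Caputo derivative $\partial_t^\gamma u(t)=\frac{1}{\Gamma(1-\gamma)}\int_0^t\frac{u'(r)}{(t-r)^\gamma}\,dr$. $E_{\gamma,1}(z)=\sum_{k\ge0}\frac{z^k}{\Gamma(\gamma k+1)}$ is the Mittag-Leffler function. A solution of $\partial_t^\gamma u=\Delta u$ is understood through its frequency representation $\widehat u(\xi,t)=\widehat u(\xi,0)\,E_{\gamma,1}(-|\xi|^2t^\gamma)$, $t\in[0,T]$ (transform in $x$). The operator $M_\alpha$ acts in frequency as $\widehat{M_\alpha g}(\xi)=e^{-\tau(\alpha|\xi|)^s}\widehat g(\xi)$, hence $$\widehat{u_\alpha}(\xi,t)=\frac{E_{\gamma,1}(-|\xi|^2t^\gamma)}{E_{\gamma,1}(-|\xi|^2T^\gamma)}\,e^{-\tau(\alpha|\xi|)^s}\,\widehat g(\xi),\qquad t\in[0,T].$$ "Regularization method in $L^2(\mathbb{R}^n)$" means: (a) for every $\alpha>0$ the linear map $g\mapsto u_\alpha(\cdot,0)$ is well defined and bounded from $L^2(\mathbb{R}^n)$ to $L^2(\mathbb{R}^n)$; and (b) for every exact datum $g=u(\cdot,T)$ arising from a solution $u$ with $u(\cdot,0)\in L^2(\mathbb{R}^n)$, one has $u_\alpha(\cdot,0)\to u(\cdot,0)$ in $L^2(\mathbb{R}^n)$ as $\alpha\downarrow0$. *)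

theory Defs
  imports "HOL-Analysis.Analysis"
begin

text \<open>
  Elements of $L^2$ are represented by Borel functions, two of them being identified
  when they agree almost everywhere. Every Lebesgue class has a Borel representative.
\<close>

definition square_integrable :: "('a::euclidean_space \<Rightarrow> complex) \<Rightarrow> bool" where
  "square_integrable f \<longleftrightarrow>
     f \<in> borel_measurable lborel \<and> integrable lborel (\<lambda>x. (norm (f x))\<^sup>2)"

definition L2_norm :: "('a::euclidean_space \<Rightarrow> complex) \<Rightarrow> real" where
  "L2_norm f = sqrt (\<integral>x. (norm (f x))\<^sup>2 \<partial>lborel)"

text \<open>
  Square integrability is part of convergence, since \<^const>\<open>L2_norm\<close> is $0$ on functions
  whose square is not integrable.
\<close>

definition L2_tendsto ::
  "('b \<Rightarrow> 'a::euclidean_space \<Rightarrow> complex) \<Rightarrow> ('a \<Rightarrow> complex) \<Rightarrow> 'b filter \<Rightarrow> bool" where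
  "L2_tendsto X f F \<longleftrightarrow>
     eventually (\<lambda>k. square_integrable (X k)) F \<and> square_integrable f \<and>
     ((\<lambda>k. L2_norm (\<lambda>x. X k x - f x)) \<longlongrightarrow> 0) F"

definition fourier_integral :: "('a::euclidean_space \<Rightarrow> complex) \<Rightarrow> 'a \<Rightarrow> complex" where
  "fourier_integral f \<xi> =
     of_real ((2 * pi) powr (- real DIM('a) / 2)) *
     (\<integral>x. f x * exp (- (\<i> * of_real (x \<bullet> \<xi>))) \<partial>lborel)"

text \<open>
  The Fourier transform on $L^2$ is the continuous extension of the integral from
  $L^1 \cap L^2$. Its graph is the $L^2$-closure of the graph of the integral transform;
  it is a relation on functions because the transform is only determined up to null sets.
\<close>

definition has_fourier_transform ::
  "('a::euclidean_space \<Rightarrow> complex) \<Rightarrow> ('a \<Rightarrow> complex) \<Rightarrow> bool" where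
  "has_fourier_transform f F \<longleftrightarrow>
     (\<exists>h. (\<forall>k::nat. integrable lborel (h k) \<and> square_integrable (h k)) \<and>
          L2_tendsto h f sequentially \<and>
          L2_tendsto (\<lambda>k. fourier_integral (h k)) F sequentially)"

definition convolution ::
  "('a::euclidean_space \<Rightarrow> complex) \<Rightarrow> ('a \<Rightarrow> complex) \<Rightarrow> 'a \<Rightarrow> complex" where
  "convolution f g x = (\<integral>y. f (x - y) * g y \<partial>lborel)"

definition dilate :: "real \<Rightarrow> ('a::euclidean_space \<Rightarrow> complex) \<Rightarrow> 'a \<Rightarrow> complex" where
  "dilate \<alpha> \<phi> x = \<phi> (x /\<^sub>R \<alpha>) / of_real (\<alpha> ^ DIM('a))"

definition mollify ::
  "('a::euclidean_space \<Rightarrow> complex) \<Rightarrow> real \<Rightarrow> ('a \<Rightarrow> complex) \<Rightarrow> 'a \<Rightarrow> complex" where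
  "mollify \<phi> \<alpha> g = convolution (dilate \<alpha> \<phi>) g"

definition mittag_leffler :: "real \<Rightarrow> real \<Rightarrow> real \<Rightarrow> real" where
  "mittag_leffler \<gamma> \<beta> z = (\<Sum>k. z ^ k / Gamma (\<gamma> * real k + \<beta>))"

text \<open>
  Solutions of $\partial_t^\gamma u = \Delta u$ (Caputo derivative in time) on
  $\mathbb{R}^n \times (0,T)$ are understood through their frequency representation;
  \<open>u t\<close> is the function $u(\cdot,t)$.
\<close>

definition frac_heat_solution ::
  "real \<Rightarrow> real \<Rightarrow> (real \<Rightarrow> 'a::euclidean_space \<Rightarrow> complex) \<Rightarrow> bool" where
  "frac_heat_solution \<gamma> T u \<longleftrightarrow>
     (\<exists>U\<^sub>0. has_fourier_transform (u 0) U\<^sub>0 \<and>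
        (\<forall>t\<in>{0..T}. has_fourier_transform (u t)
           (\<lambda>\<xi>. U\<^sub>0 \<xi> * of_real (mittag_leffler \<gamma> 1 (- (norm \<xi>)\<^sup>2 * t powr \<gamma>)))))"

text \<open>
  \<open>recovers \<gamma> T g f\<close>: some solution has final value \<open>g\<close> and initial value \<open>f\<close>.
\<close>

definition recovers ::
  "real \<Rightarrow> real \<Rightarrow> ('a::euclidean_space \<Rightarrow> complex) \<Rightarrow> ('a \<Rightarrow> complex) \<Rightarrow> bool" where
  "recovers \<gamma> T g f \<longleftrightarrow>
     (\<exists>u. frac_heat_solution \<gamma> T u \<and> (AE x in lborel. u T x = g x) \<and> u 0 = f)"

text \<open>
  An operator given by its graph \<open>A g f\<close> (``\<open>f\<close> is a representative of the image of \<open>g\<close>'')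
  is an everywhere defined, single-valued, linear and bounded map from $L^2$ to $L^2$.
\<close>

definition bounded_linear_on_L2 ::
  "(('a::euclidean_space \<Rightarrow> complex) \<Rightarrow> ('a \<Rightarrow> complex) \<Rightarrow> bool) \<Rightarrow> bool" where
  "bounded_linear_on_L2 A \<longleftrightarrow>
     (\<forall>g. square_integrable g \<longrightarrow> (\<exists>f. A g f)) \<and>
     (\<forall>g f. square_integrable g \<and> A g f \<longrightarrow> square_integrable f) \<and>
     (\<forall>g g' f f'. square_integrable g \<and> square_integrable g' \<and>
        (AE x in lborel. g x = g' x) \<and> A g f \<and> A g' f' \<longrightarrow> (AE x in lborel. f x = f' x)) \<and>
     (\<forall>g g' f f' h a b. square_integrable g \<and> square_integrable g' \<and> A g f \<and> A g' f' \<and>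
        A (\<lambda>x. a * g x + b * g' x) h \<longrightarrow> (AE x in lborel. h x = a * f x + b * f' x)) \<and>
     (\<exists>C. \<forall>g f. square_integrable g \<and> A g f \<longrightarrow> L2_norm f \<le> C * L2_norm g)"

text \<open>
  \<open>R \<alpha>\<close> is the graph of the map sending data to the regularized solution, and \<open>P g f\<close> says
  that \<open>g\<close> is the exact datum belonging to the exact solution \<open>f\<close>. The family \<open>w\<close> below is an
  arbitrary choice of representatives of the regularized solutions.
\<close>

definition regularization_method ::
  "(real \<Rightarrow> ('a::euclidean_space \<Rightarrow> complex) \<Rightarrow> ('a \<Rightarrow> complex) \<Rightarrow> bool) \<Rightarrow>
   (('a \<Rightarrow> complex) \<Rightarrow> ('a \<Rightarrow> complex) \<Rightarrow> bool) \<Rightarrow> bool" where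
  "regularization_method R P \<longleftrightarrow>
     (\<forall>\<alpha>>0. bounded_linear_on_L2 (R \<alpha>)) \<and>
     (\<forall>g f w. square_integrable g \<and> square_integrable f \<and> P g f \<and> (\<forall>\<alpha>>0. R \<alpha> g (w \<alpha>)) \<longrightarrow>
        L2_tendsto w f (at_right 0))"

end

(*
The map g |-> u_alpha(.,0) is the Fourier multiplier exp(-tau (alpha |xi|)^s) / E(-|xi|^2 T^gamma).
Multiplication by E(-|xi|^2 t^gamma) is harmless because 0 < E(-x) <= 1, and division by it costs
only a polynomial factor because E(-x) >= 1 / (1 + Gamma(1-gamma) x); the factor
exp(-tau (alpha |xi|)^s) absorbs that loss. For an exact datum the transform of
u_alpha(.,0) - u(.,0) is (exp(-tau (alpha |xi|)^s) - 1) times the transform of u(.,0), so dominated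
convergence and Plancherel give convergence as alpha -> 0.

The bounds on E come from a maximum principle: at a point where t |-> E(-x t^gamma) is extremal on
[0,t], its Caputo derivative, which equals -x E, is compared with t^(-gamma) (E - 1) / Gamma(1-gamma).

Plancherel's theorem is proved on L^1 and L^2 by regularising with Gaussians; surjectivity of the
transform then follows from Parseval's identity and the multiplication formula alone, without an
inversion integral. The mollifier is only known through its L^2 transform, so it need not be
integrable.
*)

theory Submission
  imports Defs "HOL-Probability.Characteristic_Functions"
begin

section \<open>The space of square integrable functions\<close>

text \<open>The transform on L2 is the closure of a graph, so its existence, its independence of the
  approximating sequence and its injectivity modulo null sets all have to be derived. They follow
  from the isometry on L1 and L2; existence also uses completeness of L2. The Caputo derivative is
  never formed, since t |-> E(-x t^gamma) has an unbounded derivative at 0. After scaling to t = 1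
  it is replaced by its Marchaud form, which contains no derivative of u: Gamma(1-gamma) D u(1) =
  u(1) - u(0) + gamma * integral over [0,1] of (u(1) - u(q)) (1-q)^(-gamma-1). With D u(1) = -x u(1)
  and u(0) = 1 the integral equals 1 - (1 + Gamma(1-gamma) x) u(1); this is where the constant in
  the lower bound comes from. Evaluated on powers of q the form is a Beta integral, so only the
  power series of E enters. The convolution is a pointwise integral of a product of two L2
  functions. It is read as a pairing of transforms for each x separately, which gives an identity at
  every point.\<close>

lemma square_integrable_measurable [measurable_dest]:
  "square_integrable f \<Longrightarrow> f \<in> borel_measurable borel"
  by (simp add: square_integrable_def)

lemma square_integrable_norm2: "square_integrable f \<Longrightarrow> integrable lborel (\<lambda>x. (norm (f x))\<^sup>2)"
  by (simp add: square_integrable_def)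

lemma L2_norm_nonneg [simp]: "0 \<le> L2_norm f"
  by (simp add: L2_norm_def)

lemma L2_norm_power2: "(L2_norm f)\<^sup>2 = (\<integral>x. (norm (f x))\<^sup>2 \<partial>lborel)"
  by (simp add: L2_norm_def)

lemma square_integrable_bound:
  assumes "square_integrable f" and [measurable]: "g \<in> borel_measurable borel"
    and le: "\<And>x. norm (g x) \<le> C * norm (f x)"
  shows "square_integrable g" and "0 \<le> C \<Longrightarrow> L2_norm g \<le> C * L2_norm f"
proof -
  note [measurable] = assms(1)
  have *: "(norm (g x))\<^sup>2 \<le> C\<^sup>2 * (norm (f x))\<^sup>2" for x
    using power_mono[OF le[of x], of 2] by (simp add: power_mult_distrib)
  have int: "integrable lborel (\<lambda>x. C\<^sup>2 * (norm (f x))\<^sup>2)"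
    using square_integrable_norm2[OF assms(1)] by simp
  have g: "integrable lborel (\<lambda>x. (norm (g x))\<^sup>2)"
    by (rule Bochner_Integration.integrable_bound[OF int]) (use * in \<open>auto intro!: AE_I2\<close>)
  then show "square_integrable g"
    by (simp add: square_integrable_def)
  assume "0 \<le> C"
  have "(L2_norm g)\<^sup>2 \<le> (C * L2_norm f)\<^sup>2"
    unfolding L2_norm_power2 power_mult_distrib
    using integral_mono[OF g int *] by simp
  then show "L2_norm g \<le> C * L2_norm f"
    by (rule power2_le_imp_le) (use \<open>0 \<le> C\<close> in auto)
qed

lemma square_integrable_cong_AE:
  assumes "square_integrable f" "g \<in> borel_measurable borel" "AE x in lborel. f x = g x"
  shows "square_integrable g"
proof -
  note [measurable] = assms(1,2)
  have "integrable lborel (\<lambda>x. (norm (g x))\<^sup>2) \<longleftrightarrow> integrable lborel (\<lambda>x. (norm (f x))\<^sup>2)"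
    by (rule integrable_cong_AE) (use assms(3) in auto)
  then show ?thesis
    using assms by (simp add: square_integrable_def)
qed

lemma L2_norm_cong_AE:
  assumes [measurable]: "f \<in> borel_measurable borel" "g \<in> borel_measurable borel"
    and "AE x in lborel. f x = g x"
  shows "L2_norm f = L2_norm g"
  unfolding L2_norm_def
  by (rule arg_cong[where f=sqrt], rule integral_cong_AE) (use assms(3) in auto)

lemma L2_norm_eq_0_iff:
  assumes "square_integrable f"
  shows "L2_norm f = 0 \<longleftrightarrow> (AE x in lborel. f x = 0)"
  using integral_nonneg_eq_0_iff_AE[OF square_integrable_norm2[OF assms]]
  by (simp add: L2_norm_def)

lemma square_integrable_scale:
  assumes "square_integrable f"
  shows "square_integrable (\<lambda>x. c * f x)"
proof -
  note [measurable] = assms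
  show ?thesis
    by (rule square_integrable_bound[OF assms, of _ "norm c"]) (auto simp: norm_mult)
qed

lemma L2_norm_scale: "L2_norm (\<lambda>x. c * f x) = norm c * L2_norm f"
  by (simp add: L2_norm_def norm_mult power_mult_distrib real_sqrt_mult)

lemma borel_measurable_cnj [measurable (raw)]:
  "f \<in> borel_measurable M \<Longrightarrow> (\<lambda>x. cnj (f x)) \<in> borel_measurable M"
  using measurable_compose[OF _ borel_measurable_continuous_onI[of cnj]]
  by (auto intro: continuous_intros)

lemma square_integrable_cnj:
  assumes "square_integrable f"
  shows "square_integrable (\<lambda>x. cnj (f x))"
proof -
  note [measurable] = assms
  show ?thesis
    by (rule square_integrable_bound[OF assms, of _ 1]) auto
qed

lemma L2_norm_cnj [simp]: "L2_norm (\<lambda>x. cnj (f x)) = L2_norm f"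
  by (simp add: L2_norm_def)

lemma square_integrable_add:
  assumes "square_integrable f" "square_integrable g"
  shows "square_integrable (\<lambda>x. f x + g x)"
proof -
  note [measurable] = assms
  have int: "integrable lborel (\<lambda>x. 2 * (norm (f x))\<^sup>2 + 2 * (norm (g x))\<^sup>2)"
    using square_integrable_norm2[OF assms(1)] square_integrable_norm2[OF assms(2)] by simp
  have "(norm (f x + g x))\<^sup>2 \<le> 2 * (norm (f x))\<^sup>2 + 2 * (norm (g x))\<^sup>2" for x
  proof -
    have "(norm (f x + g x))\<^sup>2 \<le> (norm (f x) + norm (g x))\<^sup>2"
      by (simp add: norm_triangle_ineq power_mono)
    also have "\<dots> \<le> 2 * (norm (f x))\<^sup>2 + 2 * (norm (g x))\<^sup>2"
      using sum_squares_bound[of "norm (f x)" "norm (g x)"] by (simp add: power2_sum)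
    finally show ?thesis .
  qed
  then have "integrable lborel (\<lambda>x. (norm (f x + g x))\<^sup>2)"
    by (intro Bochner_Integration.integrable_bound[OF int]) (auto intro!: AE_I2)
  then show ?thesis
    by (simp add: square_integrable_def)
qed

lemma square_integrable_diff:
  assumes "square_integrable f" "square_integrable g"
  shows "square_integrable (\<lambda>x. f x - g x)"
  using square_integrable_add[OF assms(1) square_integrable_scale[OF assms(2), of "-1"]] by simp

lemma square_integrable_mult:
  assumes "square_integrable f" "square_integrable g"
  shows "integrable lborel (\<lambda>x. f x * g x)"
proof -
  note [measurable] = assms
  have int: "integrable lborel (\<lambda>x. (norm (f x))\<^sup>2 + (norm (g x))\<^sup>2)"
    using square_integrable_norm2[OF assms(1)] square_integrable_norm2[OF assms(2)] by simp
  have "norm (f x * g x) \<le> norm ((norm (f x))\<^sup>2 + (norm (g x))\<^sup>2)" for x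
  proof -
    have "0 \<le> norm (f x) * norm (g x)" by simp
    then have "norm (f x) * norm (g x) \<le> (norm (f x))\<^sup>2 + (norm (g x))\<^sup>2"
      using sum_squares_bound[of "norm (f x)" "norm (g x)"] by linarith
    then show ?thesis by (simp add: norm_mult)
  qed
  then show ?thesis
    by (intro Bochner_Integration.integrable_bound[OF int]) (auto intro!: AE_I2)
qed

lemma L2_Cauchy_Schwarz_norm:
  assumes "square_integrable f" "square_integrable g"
  shows "(\<integral>x. norm (f x) * norm (g x) \<partial>lborel) \<le> L2_norm f * L2_norm g"
proof -
  define a where "a = L2_norm f"
  define b where "b = L2_norm g"
  define c where "c = (\<integral>x. norm (f x) * norm (g x) \<partial>lborel)"
  have int: "integrable lborel (\<lambda>x. norm (f x) * norm (g x))"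
    using integrable_norm[OF square_integrable_mult[OF assms]] by (simp add: norm_mult)
  have "c \<ge> 0" by (simp add: c_def)
  \<comment> \<open>The square norm of t|f| - |g|, for arbitrary real t. Cauchy-Schwarz is obtained
    by evaluating this nonnegative quadratic at a suitable t.\<close>
  have *: "0 \<le> t\<^sup>2 * a\<^sup>2 - 2 * t * c + b\<^sup>2" for t
  proof -
    have "0 \<le> (\<integral>x. (t * norm (f x) - norm (g x))\<^sup>2 \<partial>lborel)"
      by simp
    also have "\<dots> = (\<integral>x. (t\<^sup>2 * (norm (f x))\<^sup>2 - 2 * t * (norm (f x) * norm (g x))) + (norm (g x))\<^sup>2 \<partial>lborel)"
      by (intro Bochner_Integration.integral_cong) (auto simp: power2_diff power_mult_distrib)
    also have "\<dots> = t\<^sup>2 * a\<^sup>2 - 2 * t * c + b\<^sup>2"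
      using int square_integrable_norm2[OF assms(1)] square_integrable_norm2[OF assms(2)]
      by (simp add: a_def b_def c_def L2_norm_power2)
    finally show ?thesis .
  qed
  have "c\<^sup>2 \<le> (a * b)\<^sup>2"
  proof (cases "a = 0")
    case True
    have "c = 0"
    proof (rule ccontr)
      assume "c \<noteq> 0"
      then show False
        \<comment> \<open>For a = 0 the quadratic is affine in t, and this t gives it the value
          -1.\<close>
        using *[of "(b\<^sup>2 + 1) / (2 * c)"] True by simp
    qed
    then show ?thesis using True by simp
  next
    case False
    \<comment> \<open>The minimiser t = c / a^2 of the quadratic.\<close>
    have "0 \<le> (c / a\<^sup>2)\<^sup>2 * a\<^sup>2 - 2 * (c / a\<^sup>2) * c + b\<^sup>2"
      by (rule *)
    also have "\<dots> = b\<^sup>2 - c\<^sup>2 / a\<^sup>2"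
      using False by (simp add: field_simps power2_eq_square)
    finally have "c\<^sup>2 / a\<^sup>2 \<le> b\<^sup>2"
      by simp
    then show ?thesis
      using False by (simp add: pos_divide_le_eq power_mult_distrib mult.commute)
  qed
  then show ?thesis
    unfolding c_def[symmetric] a_def[symmetric] b_def[symmetric]
    by (rule power2_le_imp_le) (auto simp: a_def b_def)
qed

lemma L2_Cauchy_Schwarz:
  assumes "square_integrable f" "square_integrable g"
  shows "norm (\<integral>x. f x * g x \<partial>lborel) \<le> L2_norm f * L2_norm g"
proof -
  have "norm (\<integral>x. f x * g x \<partial>lborel) \<le> (\<integral>x. norm (f x * g x) \<partial>lborel)"
    by (rule integral_norm_bound)
  then show ?thesis
    using L2_Cauchy_Schwarz_norm[OF assms] by (simp add: norm_mult)
qed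

lemma L2_norm_triangle:
  assumes "square_integrable f" "square_integrable g"
  shows "L2_norm (\<lambda>x. f x + g x) \<le> L2_norm f + L2_norm g"
proof -
  have int: "integrable lborel (\<lambda>x. norm (f x) * norm (g x))"
    using integrable_norm[OF square_integrable_mult[OF assms]] by (simp add: norm_mult)
  have "(L2_norm (\<lambda>x. f x + g x))\<^sup>2 \<le>
      (\<integral>x. ((norm (f x))\<^sup>2 + 2 * (norm (f x) * norm (g x))) + (norm (g x))\<^sup>2 \<partial>lborel)"
    unfolding L2_norm_power2
  proof (rule integral_mono)
    fix x
    have "(norm (f x + g x))\<^sup>2 \<le> (norm (f x) + norm (g x))\<^sup>2"
      by (simp add: norm_triangle_ineq power_mono)
    then show "(norm (f x + g x))\<^sup>2 \<le> ((norm (f x))\<^sup>2 + 2 * (norm (f x) * norm (g x))) + (norm (g x))\<^sup>2"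
      by (simp add: power2_sum)
  qed (use int square_integrable_norm2[OF assms(1)] square_integrable_norm2[OF assms(2)]
      square_integrable_norm2[OF square_integrable_add[OF assms]] in auto)
  also have "\<dots> = (L2_norm f)\<^sup>2 + 2 * (\<integral>x. norm (f x) * norm (g x) \<partial>lborel) + (L2_norm g)\<^sup>2"
    using int square_integrable_norm2[OF assms(1)] square_integrable_norm2[OF assms(2)]
    by (simp add: L2_norm_power2)
  also have "\<dots> \<le> (L2_norm f + L2_norm g)\<^sup>2"
    using L2_Cauchy_Schwarz_norm[OF assms] by (simp add: power2_sum)
  finally show ?thesis
    by (rule power2_le_imp_le) simp
qed

lemma L2_norm_minus_commute: "L2_norm (\<lambda>x. f x - g x) = L2_norm (\<lambda>x. g x - f x)"
  by (simp add: L2_norm_def norm_minus_commute)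

lemma L2_norm_triangle_diff:
  assumes "square_integrable f" "square_integrable g" "square_integrable h"
  shows "L2_norm (\<lambda>x. f x - h x) \<le> L2_norm (\<lambda>x. f x - g x) + L2_norm (\<lambda>x. g x - h x)"
  using L2_norm_triangle[OF square_integrable_diff[OF assms(1,2)] square_integrable_diff[OF assms(2,3)]]
  by simp

section \<open>Convergence in L2 and completeness\<close>

lemma L2_tendsto_norm:
  assumes "L2_tendsto X f F"
  shows "((\<lambda>k. L2_norm (X k)) \<longlongrightarrow> L2_norm f) F"
proof -
  have "((\<lambda>k. L2_norm (X k) - L2_norm f) \<longlongrightarrow> 0) F"
  proof (rule Lim_null_comparison)
    show "((\<lambda>k. L2_norm (\<lambda>x. X k x - f x)) \<longlongrightarrow> 0) F"
      using assms by (simp add: L2_tendsto_def)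
    have sf: "square_integrable f" using assms by (simp add: L2_tendsto_def)
    show "\<forall>\<^sub>F k in F. norm (L2_norm (X k) - L2_norm f) \<le> L2_norm (\<lambda>x. X k x - f x)"
    proof -
      have "\<forall>\<^sub>F k in F. square_integrable (X k)"
        using assms by (simp add: L2_tendsto_def)
      then show ?thesis
      proof eventually_elim
        case (elim k)
        have "L2_norm (X k) \<le> L2_norm (\<lambda>x. X k x - f x) + L2_norm f"
          using L2_norm_triangle[OF square_integrable_diff[OF elim sf] sf] by simp
        moreover have "L2_norm f \<le> L2_norm (\<lambda>x. X k x - f x) + L2_norm (X k)"
          using L2_norm_triangle[OF square_integrable_diff[OF sf elim] elim]
          by (simp add: L2_norm_minus_commute[of f])
        ultimately show ?case by simp
      qed
    qed
  qed
  then show ?thesis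
    by (simp add: LIM_zero_iff)
qed

lemma L2_tendsto_add:
  assumes "L2_tendsto X f F" "L2_tendsto Y g F"
  shows "L2_tendsto (\<lambda>k x. X k x + Y k x) (\<lambda>x. f x + g x) F"
  unfolding L2_tendsto_def
proof (intro conjI)
  have ev: "\<forall>\<^sub>F k in F. square_integrable (X k) \<and> square_integrable (Y k)"
    using assms by (auto simp: L2_tendsto_def eventually_conj_iff)
  have sf: "square_integrable f" and sg: "square_integrable g"
    using assms by (auto simp: L2_tendsto_def)
  show "square_integrable (\<lambda>x. f x + g x)"
    by (rule square_integrable_add[OF sf sg])
  show "\<forall>\<^sub>F k in F. square_integrable (\<lambda>x. X k x + Y k x)"
    using ev by eventually_elim (auto intro: square_integrable_add)
  show "((\<lambda>k. L2_norm (\<lambda>x. X k x + Y k x - (f x + g x))) \<longlongrightarrow> 0) F"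
  proof (rule Lim_null_comparison)
    show "((\<lambda>k. L2_norm (\<lambda>x. X k x - f x) + L2_norm (\<lambda>x. Y k x - g x)) \<longlongrightarrow> 0) F"
      using assms by (intro tendsto_add_zero) (auto simp: L2_tendsto_def)
    show "\<forall>\<^sub>F k in F. norm (L2_norm (\<lambda>x. X k x + Y k x - (f x + g x)))
        \<le> L2_norm (\<lambda>x. X k x - f x) + L2_norm (\<lambda>x. Y k x - g x)"
      using ev
    proof eventually_elim
      case (elim k)
      then show ?case
        using L2_norm_triangle[OF square_integrable_diff[OF _ sf] square_integrable_diff[OF _ sg], of "X k" "Y k"]
        by (simp add: algebra_simps)
    qed
  qed
qed

lemma L2_tendsto_scale:
  assumes "L2_tendsto X f F"
  shows "L2_tendsto (\<lambda>k x. c * X k x) (\<lambda>x. c * f x) F"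
  unfolding L2_tendsto_def
proof (intro conjI)
  show "square_integrable (\<lambda>x. c * f x)"
    using assms by (auto simp: L2_tendsto_def intro: square_integrable_scale)
  show "\<forall>\<^sub>F k in F. square_integrable (\<lambda>x. c * X k x)"
    using assms by (auto simp: L2_tendsto_def intro: square_integrable_scale elim!: eventually_mono)
  have "((\<lambda>k. norm c * L2_norm (\<lambda>x. X k x - f x)) \<longlongrightarrow> 0) F"
    using assms by (intro tendsto_mult_right_zero) (auto simp: L2_tendsto_def)
  then show "((\<lambda>k. L2_norm (\<lambda>x. c * X k x - c * f x)) \<longlongrightarrow> 0) F"
    by (simp add: right_diff_distrib[symmetric] L2_norm_scale)
qed

lemma L2_tendsto_cnj:
  assumes "L2_tendsto X f F"
  shows "L2_tendsto (\<lambda>k x. cnj (X k x)) (\<lambda>x. cnj (f x)) F"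
  using assms
  by (auto simp: L2_tendsto_def intro: square_integrable_cnj elim!: eventually_mono
      simp flip: complex_cnj_diff)

text \<open>Continuity of the bilinear pairing, from the split X Y - f g = X (Y - g) + (X - f) g and
  Cauchy-Schwarz. There is no conjugation because it serves to pass the multiplication formula to L2
  limits.\<close>

lemma L2_tendsto_mult:
  assumes X: "L2_tendsto X f F" and Y: "L2_tendsto Y g F"
  shows "((\<lambda>k. \<integral>x. X k x * Y k x \<partial>lborel) \<longlongrightarrow> (\<integral>x. f x * g x \<partial>lborel)) F"
proof -
  have ev: "\<forall>\<^sub>F k in F. square_integrable (X k) \<and> square_integrable (Y k)"
    using assms by (auto simp: L2_tendsto_def eventually_conj_iff)
  have sf: "square_integrable f" and sg: "square_integrable g"
    using assms by (auto simp: L2_tendsto_def)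
  have "((\<lambda>k. (\<integral>x. X k x * Y k x \<partial>lborel) - (\<integral>x. f x * g x \<partial>lborel)) \<longlongrightarrow> 0) F"
  proof (rule Lim_null_comparison)
    have "((\<lambda>k. L2_norm (X k) * L2_norm (\<lambda>x. Y k x - g x) + L2_norm (\<lambda>x. X k x - f x) * L2_norm g)
        \<longlongrightarrow> L2_norm f * 0 + 0 * L2_norm g) F"
      using assms by (intro tendsto_intros L2_tendsto_norm[OF X]) (auto simp: L2_tendsto_def)
    then show "((\<lambda>k. L2_norm (X k) * L2_norm (\<lambda>x. Y k x - g x) + L2_norm (\<lambda>x. X k x - f x) * L2_norm g)
        \<longlongrightarrow> 0) F" by simp
    show "\<forall>\<^sub>F k in F. norm ((\<integral>x. X k x * Y k x \<partial>lborel) - (\<integral>x. f x * g x \<partial>lborel))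
        \<le> L2_norm (X k) * L2_norm (\<lambda>x. Y k x - g x) + L2_norm (\<lambda>x. X k x - f x) * L2_norm g"
      using ev
    proof eventually_elim
      case (elim k)
      then have sX: "square_integrable (X k)" and sY: "square_integrable (Y k)" by auto
      have "(\<integral>x. X k x * Y k x \<partial>lborel) - (\<integral>x. f x * g x \<partial>lborel) =
          (\<integral>x. X k x * Y k x - f x * g x \<partial>lborel)"
        using square_integrable_mult[OF sX sY] square_integrable_mult[OF sf sg] by simp
      also have "\<dots> = (\<integral>x. X k x * (Y k x - g x) + (X k x - f x) * g x \<partial>lborel)"
        by (simp add: algebra_simps)
      also have "\<dots> = (\<integral>x. X k x * (Y k x - g x) \<partial>lborel) + (\<integral>x. (X k x - f x) * g x \<partial>lborel)"
        by (intro Bochner_Integration.integral_add square_integrable_mult square_integrable_diff sX sY sf sg)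
      finally show ?case
        using L2_Cauchy_Schwarz[OF sX square_integrable_diff[OF sY sg]]
          L2_Cauchy_Schwarz[OF square_integrable_diff[OF sX sf] sg]
        by (simp add: norm_triangle_le)
    qed
  qed
  then show ?thesis
    by (simp add: LIM_zero_iff)
qed

lemma L2_tendsto_cong_AE:
  assumes "L2_tendsto X f F" "g \<in> borel_measurable borel" "AE x in lborel. f x = g x"
  shows "L2_tendsto X g F"
proof -
  have sg: "square_integrable g"
    using assms square_integrable_cong_AE by (auto simp: L2_tendsto_def)
  have [measurable]: "f \<in> borel_measurable borel" "g \<in> borel_measurable borel"
    using assms by (auto simp: L2_tendsto_def square_integrable_def)
  have "\<forall>\<^sub>F k in F. square_integrable (X k)"
    using assms(1) by (simp add: L2_tendsto_def)
  then have "\<forall>\<^sub>F k in F. L2_norm (\<lambda>x. X k x - f x) = L2_norm (\<lambda>x. X k x - g x)"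
  proof eventually_elim
    case (elim k)
    have [measurable]: "X k \<in> borel_measurable borel"
      using elim by (rule square_integrable_measurable)
    show ?case
      by (rule L2_norm_cong_AE) (use assms(3) in auto)
  qed
  then have "((\<lambda>k. L2_norm (\<lambda>x. X k x - g x)) \<longlongrightarrow> 0) F"
    by (rule iffD1[OF tendsto_cong]) (use assms(1) in \<open>simp add: L2_tendsto_def\<close>)
  then show ?thesis
    using assms(1) sg by (simp add: L2_tendsto_def)
qed

text \<open>Riesz--Fischer: a rapidly convergent subsequence converges almost everywhere, and
  Fatou's lemma identifies its pointwise limit as the limit in $L^2$.\<close>

lemma L2_complete:
  fixes h :: "nat \<Rightarrow> 'a::euclidean_space \<Rightarrow> complex"
  assumes sq: "\<And>k. square_integrable (h k)"
    and cau: "\<And>e. 0 < e \<Longrightarrow> \<exists>N. \<forall>m\<ge>N. \<forall>n\<ge>N. L2_norm (\<lambda>x. h m x - h n x) < e"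
  obtains f where "L2_tendsto h f sequentially"
proof -
  note [measurable] = square_integrable_measurable[OF sq]
  have "\<exists>N. \<forall>m\<ge>N. \<forall>n\<ge>N. L2_norm (\<lambda>x. h m x - h n x) < (1/2)^k" for k
    by (rule cau) simp
  then obtain N where N': "\<And>k. \<forall>m\<ge>N k. \<forall>n\<ge>N k. L2_norm (\<lambda>x. h m x - h n x) < (1/2)^k"
    by metis
  have N: "L2_norm (\<lambda>x. h m x - h n x) < (1/2)^k" if "m \<ge> N k" "n \<ge> N k" for k m n
    using N'[rule_format, OF that] .
  \<comment> \<open>Partial sums of the thresholds give a nondecreasing index sequence that stays
    beyond \<open>N k\<close> from position k on.\<close>
  define r where "r k = (\<Sum>i\<le>k. N i)" for k
  have rN: "N k \<le> r k" for k
    unfolding r_def by (rule member_le_sum) auto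
  have rmono: "r k \<le> r l" if "k \<le> l" for k l
    unfolding r_def by (rule sum_mono2) (use that in auto)
  have rN': "N k \<le> r l" if "k \<le> l" for k l
    using rN[of k] rmono[OF that] by simp
  define d where "d k x = h (r (Suc k)) x - h (r k) x" for k x
  have sd: "square_integrable (d k)" for k
    unfolding d_def by (intro square_integrable_diff sq)
  note [measurable] = square_integrable_measurable[OF sd]
  \<comment> \<open>The squared norm of \<open>d k\<close> is at most 4^(-k). The weight 2^k keeps
    the integrals summable, while a finite weighted sum at x forces |d k x| <= sqrt B * 2^(-k/2), so
    the telescoping series converges at x.\<close>
  have dnorm: "(\<integral>x. 2^k * (norm (d k x))\<^sup>2 \<partial>lborel) \<le> (1/2)^k" for k
  proof -
    have "(L2_norm (d k))\<^sup>2 \<le> ((1/2)^k)\<^sup>2"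
      unfolding d_def using N[OF rN'[of k "Suc k"] rN[of k]] by (intro power_mono) auto
    then have "2^k * (L2_norm (d k))\<^sup>2 \<le> 2^k * ((1/2)^k)\<^sup>2"
      by simp
    also have "\<dots> = (1/2::real)^k"
      by (simp add: power2_eq_square power_one_over field_simps)
    finally show ?thesis
      by (simp add: L2_norm_power2)
  qed
  have "(\<integral>\<^sup>+x. (\<Sum>k. ennreal (2^k * (norm (d k x))\<^sup>2)) \<partial>lborel) =
      (\<Sum>k. \<integral>\<^sup>+x. ennreal (2^k * (norm (d k x))\<^sup>2) \<partial>lborel)"
    by (rule nn_integral_suminf) measurable
  also have "\<dots> \<le> (\<Sum>k. ennreal ((1/2)^k))"
  proof (rule suminf_le)
    fix k
    have "(\<integral>\<^sup>+x. ennreal (2^k * (norm (d k x))\<^sup>2) \<partial>lborel) = ennreal (\<integral>x. 2^k * (norm (d k x))\<^sup>2 \<partial>lborel)"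
      by (rule nn_integral_eq_integral) (use square_integrable_norm2[OF sd] in auto)
    then show "(\<integral>\<^sup>+x. ennreal (2^k * (norm (d k x))\<^sup>2) \<partial>lborel) \<le> ennreal ((1/2)^k)"
      using dnorm by (simp add: ennreal_leI)
  qed auto
  also have "\<dots> = ennreal (\<Sum>k. (1/2)^k)"
    by (rule suminf_ennreal2) (auto simp: summable_geometric)
  also have "\<dots> < \<infinity>"
    by simp
  finally have fin: "(\<integral>\<^sup>+x. (\<Sum>k. ennreal (2^k * (norm (d k x))\<^sup>2)) \<partial>lborel) \<noteq> \<infinity>"
    by simp
  have "AE x in lborel. (\<Sum>k. ennreal (2^k * (norm (d k x))\<^sup>2)) \<noteq> \<infinity>"
    by (rule nn_integral_PInf_AE[OF _ fin]) measurable
  then have conv: "AE x in lborel. convergent (\<lambda>k. h (r k) x)"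
  proof eventually_elim
    case (elim x)
    then have "summable (\<lambda>k. 2^k * (norm (d k x))\<^sup>2)"
      by (intro summable_suminf_not_top) auto
    then obtain B where B: "\<And>k. norm (2^k * (norm (d k x))\<^sup>2) \<le> B"
      using summable_imp_Bseq Bseq_def by (metis (no_types, lifting))
    have "summable (\<lambda>k. d k x)"
    proof (rule summable_comparison_test)
      show "summable (\<lambda>k. sqrt B * (sqrt (1/2))^k)"
        by (intro summable_mult summable_geometric) (simp add: real_sqrt_lt_1_iff)
      show "\<exists>N. \<forall>n\<ge>N. norm (d n x) \<le> sqrt B * sqrt (1/2) ^ n"
      proof (intro exI allI impI)
        fix n
        have "(norm (d n x))\<^sup>2 \<le> B * (1/2)^n"
          using B[of n] by (simp add: power_one_over field_simps)
        then have "norm (d n x) \<le> sqrt (B * (1/2)^n)"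
          by (simp add: real_le_rsqrt)
        then show "norm (d n x) \<le> sqrt B * sqrt (1/2) ^ n"
          by (simp add: real_sqrt_mult real_sqrt_power)
      qed
    qed
    then have "convergent (\<lambda>n. \<Sum>k<n. d k x)"
      by (simp add: summable_iff_convergent)
    moreover have "(\<Sum>k<n. d k x) = h (r n) x - h (r 0) x" for n
      unfolding d_def by (rule sum_lessThan_telescope)
    ultimately have "convergent (\<lambda>n. (h (r n) x - h (r 0) x) + h (r 0) x)"
      by (intro convergent_add) (auto simp: convergent_const)
    then show ?case by simp
  qed
  define f where "f x = lim (\<lambda>k. h (r k) x)" for x
  have fm [measurable]: "f \<in> borel_measurable borel"
    unfolding f_def by measurable
  have lim: "AE x in lborel. (\<lambda>k. h (r k) x) \<longlonglongrightarrow> f x"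
    using conv by eventually_elim (simp add: f_def convergent_LIMSEQ_iff)
  have key: "square_integrable (\<lambda>x. h m x - f x) \<and> L2_norm (\<lambda>x. h m x - f x) \<le> (1/2)^k" if m: "m \<ge> N k" for m k
  proof -
    have "(\<integral>\<^sup>+x. ennreal ((norm (h m x - f x))\<^sup>2) \<partial>lborel) \<le>
        (\<integral>\<^sup>+x. liminf (\<lambda>j. ennreal ((norm (h m x - h (r j) x))\<^sup>2)) \<partial>lborel)"
    proof (rule nn_integral_mono_AE)
      show "AE x in lborel. ennreal ((norm (h m x - f x))\<^sup>2) \<le> liminf (\<lambda>j. ennreal ((norm (h m x - h (r j) x))\<^sup>2))"
        using lim
      proof eventually_elim
        case (elim x)
        then have "(\<lambda>j. ennreal ((norm (h m x - h (r j) x))\<^sup>2)) \<longlonglongrightarrow> ennreal ((norm (h m x - f x))\<^sup>2)"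
          by (intro tendsto_ennrealI tendsto_power tendsto_norm tendsto_diff tendsto_const)
        from lim_imp_Liminf[OF sequentially_bot this] show ?case
          by (simp only: order_refl)
      qed
    qed
    also have "\<dots> \<le> liminf (\<lambda>j. \<integral>\<^sup>+x. ennreal ((norm (h m x - h (r j) x))\<^sup>2) \<partial>lborel)"
      by (rule nn_integral_liminf) measurable
    also have "\<dots> \<le> liminf (\<lambda>j. ennreal (((1/2)^k)\<^sup>2))"
    proof (rule Liminf_mono, rule eventually_sequentiallyI)
      fix j assume "k \<le> j"
      have "(\<integral>\<^sup>+x. ennreal ((norm (h m x - h (r j) x))\<^sup>2) \<partial>lborel) = ennreal (\<integral>x. (norm (h m x - h (r j) x))\<^sup>2 \<partial>lborel)"
        by (rule nn_integral_eq_integral) (auto intro!: square_integrable_norm2 square_integrable_diff sq)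
      also have "(\<integral>x. (norm (h m x - h (r j) x))\<^sup>2 \<partial>lborel) \<le> ((1/2)^k)\<^sup>2"
        unfolding L2_norm_power2[symmetric]
        using N[OF m rN'[OF \<open>k \<le> j\<close>]] by (intro power_mono) auto
      finally show "(\<integral>\<^sup>+x. ennreal ((norm (h m x - h (r j) x))\<^sup>2) \<partial>lborel) \<le> ennreal (((1/2)^k)\<^sup>2)"
        by (simp add: ennreal_leI)
    qed
    also have "\<dots> = ennreal (((1/2)^k)\<^sup>2)"
      by (simp add: Liminf_const)
    finally have le: "(\<integral>\<^sup>+x. ennreal ((norm (h m x - f x))\<^sup>2) \<partial>lborel) \<le> ennreal (((1/2)^k)\<^sup>2)" .
    then have "integrable lborel (\<lambda>x. (norm (h m x - f x))\<^sup>2)"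
      by (intro integrableI_bounded) (auto intro: le_less_trans)
    then have s: "square_integrable (\<lambda>x. h m x - f x)"
      by (simp add: square_integrable_def)
    have "ennreal ((L2_norm (\<lambda>x. h m x - f x))\<^sup>2) = (\<integral>\<^sup>+x. ennreal ((norm (h m x - f x))\<^sup>2) \<partial>lborel)"
      unfolding L2_norm_power2
      by (rule nn_integral_eq_integral[symmetric]) (auto intro!: square_integrable_norm2 s)
    with le have "ennreal ((L2_norm (\<lambda>x. h m x - f x))\<^sup>2) \<le> ennreal (((1/2)^k)\<^sup>2)"
      by (rule ord_eq_le_trans[rotated])
    then have "(L2_norm (\<lambda>x. h m x - f x))\<^sup>2 \<le> ((1/2)^k)\<^sup>2"
      by (subst (asm) ennreal_le_iff) simp_all
    then have "L2_norm (\<lambda>x. h m x - f x) \<le> (1/2)^k"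
      by (rule power2_le_imp_le) simp
    with s show ?thesis ..
  qed
  have "square_integrable (\<lambda>x. h (N 0) x - f x)"
    using key[of 0 "N 0"] by blast
  from square_integrable_diff[OF sq[of "N 0"] this] have sf: "square_integrable f"
    by simp
  have "(\<lambda>m. L2_norm (\<lambda>x. h m x - f x)) \<longlonglongrightarrow> 0"
  proof (rule LIMSEQ_I)
    fix e :: real assume "e > 0"
    then obtain k where k: "(1/2)^k < e"
      using real_arch_pow_inv[OF \<open>e > 0\<close>, of "1/2"] by fastforce
    have "norm (L2_norm (\<lambda>x. h n x - f x) - 0) < e" if "n \<ge> N k" for n
      using conjunct2[OF key[OF that]] k by (simp only: diff_zero real_norm_def abs_of_nonneg L2_norm_nonneg)
    then show "\<exists>no. \<forall>n\<ge>no. norm (L2_norm (\<lambda>x. h n x - f x) - 0) < e"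
      by (intro exI[of _ "N k"] allI impI)
  qed
  then have "L2_tendsto h f sequentially"
    unfolding L2_tendsto_def by (intro conjI always_eventually allI sq sf)
  then show ?thesis by (rule that)
qed

section \<open>Change of variables, translations and Gaussians\<close>

lemma lborel_integrable_affine:
  fixes f :: "'a::euclidean_space \<Rightarrow> 'b::{banach, second_countable_topology}"
  assumes f: "integrable lborel f" and c: "c \<noteq> 0"
  shows "integrable lborel (\<lambda>x. f (t + c *\<^sub>R x))"
proof -
  have [measurable]: "f \<in> borel_measurable borel"
    using f by auto
  have "integrable (density (distr lborel borel (\<lambda>x. t + c *\<^sub>R x)) (\<lambda>_. ennreal (\<bar>c\<bar> ^ DIM('a)))) f"
    using f lborel_affine[OF c, of t] by simp
  then have "integrable lborel (\<lambda>x. \<bar>c\<bar> ^ DIM('a) *\<^sub>R f (t + c *\<^sub>R x))"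
    by (subst (asm) integrable_density) (auto simp: integrable_distr_eq)
  then have "integrable lborel (\<lambda>x. (1 / \<bar>c\<bar> ^ DIM('a)) *\<^sub>R \<bar>c\<bar> ^ DIM('a) *\<^sub>R f (t + c *\<^sub>R x))"
    by (rule integrable_scaleR_right)
  then show ?thesis using c by simp
qed

lemma lborel_integral_affine:
  fixes f :: "'a::euclidean_space \<Rightarrow> 'b::{banach, second_countable_topology}"
  assumes [measurable]: "f \<in> borel_measurable borel" and c: "c \<noteq> 0"
  shows "(\<integral>x. f (t + c *\<^sub>R x) \<partial>lborel) = (1 / \<bar>c\<bar> ^ DIM('a)) *\<^sub>R (\<integral>x. f x \<partial>lborel)"
proof -
  have "(\<integral>x. f x \<partial>lborel) =
      (\<integral>x. f x \<partial>density (distr lborel borel (\<lambda>x. t + c *\<^sub>R x)) (\<lambda>_. ennreal (\<bar>c\<bar> ^ DIM('a))))"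
    using lborel_affine[OF c, of t] by simp
  also have "\<dots> = \<bar>c\<bar> ^ DIM('a) *\<^sub>R (\<integral>x. f (t + c *\<^sub>R x) \<partial>lborel)"
    by (subst integral_density) (auto simp: integral_distr)
  finally show ?thesis using c by simp
qed

lemma square_integrable_affine:
  assumes f: "square_integrable f" and c: "c \<noteq> 0"
  shows "square_integrable (\<lambda>x. f (t + c *\<^sub>R x))"
proof -
  note [measurable] = square_integrable_measurable[OF f]
  show ?thesis
    unfolding square_integrable_def
    using lborel_integrable_affine[OF square_integrable_norm2[OF f] c, of t] by simp
qed

lemma L2_norm_affine:
  fixes f :: "'a::euclidean_space \<Rightarrow> complex"
  assumes [measurable]: "f \<in> borel_measurable borel" and c: "c \<noteq> 0"
  shows "L2_norm (\<lambda>x. f (t + c *\<^sub>R x)) = sqrt (1 / \<bar>c\<bar> ^ DIM('a)) * L2_norm f"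
  unfolding L2_norm_def real_sqrt_mult[symmetric]
  using lborel_integral_affine[of "\<lambda>x. (norm (f x))\<^sup>2", OF _ c, of t] by simp

lemma L2_tendsto_affine:
  fixes f :: "'a::euclidean_space \<Rightarrow> complex"
  assumes X: "L2_tendsto X f F" and c: "c \<noteq> 0"
  shows "L2_tendsto (\<lambda>k x. X k (t + c *\<^sub>R x)) (\<lambda>x. f (t + c *\<^sub>R x)) F"
proof -
  have ev: "\<forall>\<^sub>F k in F. square_integrable (X k)" and f: "square_integrable f"
    and lim: "((\<lambda>k. L2_norm (\<lambda>x. X k x - f x)) \<longlongrightarrow> 0) F"
    using X by (auto simp: L2_tendsto_def)
  have "\<forall>\<^sub>F k in F. sqrt (1 / \<bar>c\<bar> ^ DIM('a)) * L2_norm (\<lambda>x. X k x - f x) =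
      L2_norm (\<lambda>x. X k (t + c *\<^sub>R x) - f (t + c *\<^sub>R x))"
    using ev
  proof eventually_elim
    case (elim k)
    note [measurable] = elim f
    show ?case
      using L2_norm_affine[of "\<lambda>x. X k x - f x", OF _ c, of t] by simp
  qed
  then have "((\<lambda>k. L2_norm (\<lambda>x. X k (t + c *\<^sub>R x) - f (t + c *\<^sub>R x))) \<longlongrightarrow> 0) F"
    by (rule iffD1[OF tendsto_cong]) (rule tendsto_mult_right_zero[OF lim])
  moreover have "\<forall>\<^sub>F k in F. square_integrable (\<lambda>x. X k (t + c *\<^sub>R x))"
    using ev by eventually_elim (rule square_integrable_affine[OF _ c])
  ultimately show ?thesis
    using square_integrable_affine[OF f c] by (simp add: L2_tendsto_def)
qed

section \<open>Continuity of translation in L1\<close>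

text \<open>The absolute difference of two indicators is their sum minus twice their product, and
  translation preserves the integral, so only the product has to converge. Openness does this
  pointwise: a point of U stays in U under small shifts, and off U the product is 0, so the boundary
  of U may have positive measure.\<close>

lemma L1_translation_open:
  fixes U :: "'a::euclidean_space set"
  assumes U: "open U" "emeasure lborel U < \<infinity>" and w: "w \<longlonglongrightarrow> 0"
  shows "(\<lambda>m. \<integral>x. \<bar>indicator U (w m + x) - indicator U x\<bar> \<partial>lborel) \<longlonglongrightarrow> (0::real)"
proof -
  have [measurable]: "U \<in> sets borel" using U by auto
  have int: "integrable lborel (indicator U :: 'a \<Rightarrow> real)"
    using U by (intro integrable_real_indicator) auto
  have intw: "integrable lborel (\<lambda>x. indicator U (a + x) :: real)" for a
    using lborel_integrable_affine[OF int, of 1 a] by simp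
  have intp: "integrable lborel (\<lambda>x. indicator U x * indicator U (a + x) :: real)" for a
    by (rule Bochner_Integration.integrable_bound[OF int]) (auto intro!: AE_I2 split: split_indicator)
  have eq: "(\<integral>x. \<bar>indicator U (a + x) - indicator U x\<bar> \<partial>lborel) =
      2 * (\<integral>x. indicator U x \<partial>lborel) - 2 * (\<integral>x. indicator U x * indicator U (a + x) \<partial>lborel :: real)" for a
  proof -
    have "(\<integral>x. \<bar>indicator U (a + x) - indicator U x\<bar> \<partial>lborel) =
       (\<integral>x. (indicator U (a + x) + indicator U x) - 2 * (indicator U x * indicator U (a + x)) \<partial>lborel :: real)"
      by (intro Bochner_Integration.integral_cong) (auto split: split_indicator)
    also have "\<dots> = (\<integral>x. indicator U (a + x) \<partial>lborel) + (\<integral>x. indicator U x \<partial>lborel)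
        - 2 * (\<integral>x. indicator U x * indicator U (a + x) \<partial>lborel :: real)"
      using int intw[of a] intp[of a] by simp
    also have "(\<integral>x. indicator U (a + x) \<partial>lborel) = (\<integral>x. indicator U x \<partial>lborel :: real)"
      using lborel_integral_affine[of "indicator U :: 'a \<Rightarrow> real" 1 a] by simp
    finally show ?thesis by simp
  qed
  have "(\<lambda>m. \<integral>x. indicator U x * indicator U (w m + x) \<partial>lborel) \<longlonglongrightarrow> (\<integral>x. indicator U x \<partial>lborel :: real)"
  proof (rule integral_dominated_convergence)
    show "AE x in lborel. (\<lambda>m. indicator U x * indicator U (w m + x)) \<longlonglongrightarrow> (indicator U x :: real)"
    proof (rule AE_I2)
      fix x
      show "(\<lambda>m. indicator U x * indicator U (w m + x)) \<longlonglongrightarrow> (indicator U x :: real)"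
      proof (cases "x \<in> U")
        case True
        have "(\<lambda>m. w m + x) \<longlonglongrightarrow> 0 + x"
          by (intro tendsto_add w tendsto_const)
        then have "\<forall>\<^sub>F m in sequentially. w m + x \<in> U"
          using True U(1) by (simp add: topological_tendstoD)
        then have "\<forall>\<^sub>F m in sequentially. (indicator U x * indicator U (w m + x) :: real) = indicator U x"
          by eventually_elim (simp add: True)
        then show ?thesis by (rule tendsto_eventually)
      qed simp
    qed
    show "integrable lborel (indicator U :: 'a \<Rightarrow> real)" by (rule int)
  qed (auto intro!: AE_I2 split: split_indicator)
  then have "(\<lambda>m. 2 * (\<integral>x. indicator U x \<partial>lborel) - 2 * (\<integral>x. indicator U x * indicator U (w m + x) \<partial>lborel))
     \<longlonglongrightarrow> 2 * (\<integral>x. indicator U x \<partial>lborel) - 2 * (\<integral>x. indicator U x \<partial>lborel :: real)"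
    by (intro tendsto_diff tendsto_mult tendsto_const)
  then show ?thesis
    unfolding eq by simp
qed

text \<open>Translation preserves the L1 distance, so replacing f by g costs the same error at x and
  at a + x; hence the factor 2, uniformly in the shift.\<close>

lemma L1_translation_close:
  fixes f g :: "'a::euclidean_space \<Rightarrow> 'b::{banach, second_countable_topology}"
  assumes f: "integrable lborel f" and g: "integrable lborel g"
  shows "(\<integral>x. norm (f (a + x) - f x) \<partial>lborel) \<le>
    (\<integral>x. norm (g (a + x) - g x) \<partial>lborel) + 2 * (\<integral>x. norm (f x - g x) \<partial>lborel)"
proof -
  have [measurable]: "f \<in> borel_measurable borel" "g \<in> borel_measurable borel"
    using f g by auto
  have sh: "integrable lborel (\<lambda>x. f (a + x))" "integrable lborel (\<lambda>x. g (a + x))"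
    using lborel_integrable_affine[OF f, of 1 a] lborel_integrable_affine[OF g, of 1 a] by simp_all
  have "(\<integral>x. norm (f (a + x) - f x) \<partial>lborel) \<le>
      (\<integral>x. norm (g (a + x) - g x) + (norm (f (a + x) - g (a + x)) + norm (f x - g x)) \<partial>lborel)"
  proof (rule integral_mono)
    fix x
    have "f (a + x) - f x = (g (a + x) - g x) + ((f (a + x) - g (a + x)) - (f x - g x))"
      by simp
    then show "norm (f (a + x) - f x) \<le> norm (g (a + x) - g x) + (norm (f (a + x) - g (a + x)) + norm (f x - g x))"
      by (simp only:) (intro norm_triangle_mono order_refl norm_triangle_ineq4)
  qed (use f g sh in auto)
  also have "\<dots> = (\<integral>x. norm (g (a + x) - g x) \<partial>lborel) +
      ((\<integral>x. norm (f (a + x) - g (a + x)) \<partial>lborel) + (\<integral>x. norm (f x - g x) \<partial>lborel))"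
    using f g sh by simp
  also have "(\<integral>x. norm (f (a + x) - g (a + x)) \<partial>lborel) = (\<integral>x. norm (f x - g x) \<partial>lborel)"
    using lborel_integral_affine[of "\<lambda>x. norm (f x - g x)" 1 a] by simp
  finally show ?thesis by simp
qed

text \<open>Translation continuity is closed under L1 approximation. This carries both the indicator
  case and the limit case of the induction below.\<close>

lemma L1_translation_approx:
  fixes f :: "'a::euclidean_space \<Rightarrow> 'b::{banach, second_countable_topology}"
  assumes f: "integrable lborel f"
    and approx: "\<And>e. 0 < e \<Longrightarrow> \<exists>g. integrable lborel g \<and> (\<integral>x. norm (f x - g x) \<partial>lborel) < e \<and>
      (\<lambda>m. \<integral>x. norm (g (w m + x) - g x) \<partial>lborel) \<longlonglongrightarrow> 0"
  shows "(\<lambda>m. \<integral>x. norm (f (w m + x) - f x) \<partial>lborel) \<longlonglongrightarrow> 0"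
proof (rule LIMSEQ_I)
  fix e :: real assume "e > 0"
  \<comment> \<open>A quarter of e, because the approximation error enters twice.\<close>
  then obtain g where g: "integrable lborel g" "(\<integral>x. norm (f x - g x) \<partial>lborel) < e / 4"
    and lim: "(\<lambda>m. \<integral>x. norm (g (w m + x) - g x) \<partial>lborel) \<longlonglongrightarrow> 0"
    using approx[of "e / 4"] by auto
  obtain N where N: "\<And>m. m \<ge> N \<Longrightarrow> norm ((\<integral>x. norm (g (w m + x) - g x) \<partial>lborel) - 0) < e / 2"
    using LIMSEQ_D[OF lim, of "e / 2"] \<open>e > 0\<close> by auto
  have "norm ((\<integral>x. norm (f (w m + x) - f x) \<partial>lborel) - 0) < e" if "m \<ge> N" for m
    using N[OF that] L1_translation_close[OF f g(1), of "w m"] g(2) by simp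
  then show "\<exists>no. \<forall>m\<ge>no. norm ((\<integral>x. norm (f (w m + x) - f x) \<partial>lborel) - 0) < e"
    by (intro exI[of _ N] allI impI)
qed

text \<open>Induction over integrable functions. Outer regularity replaces a Borel set of finite
  measure by an open superset with small excess, which reduces the indicator case to open
  sets.\<close>

lemma L1_translation:
  fixes f :: "'a::euclidean_space \<Rightarrow> 'b::{banach, second_countable_topology}"
  assumes "integrable lborel f" and w: "w \<longlonglongrightarrow> 0"
  shows "(\<lambda>m. \<integral>x. norm (f (w m + x) - f x) \<partial>lborel) \<longlonglongrightarrow> 0"
  using assms(1)
proof (induction rule: integrable_induct)
  case (base A c)
  then have [measurable]: "A \<in> sets borel" by simp
  show ?case
  proof (rule L1_translation_approx)
    show "integrable lborel (\<lambda>x. indicator A x *\<^sub>R c)"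
      using base by (intro integrable_scaleR_left integrable_real_indicator) auto
    fix e :: real assume "e > 0"
    \<comment> \<open>The added 1 allows c = 0 and makes e' * |c| strictly smaller than e.\<close>
    define e' where "e' = e / (norm c + 1)"
    have "e' > 0" using \<open>e > 0\<close> by (simp add: e'_def add_nonneg_pos)
    then obtain U where U: "open U" "A \<subseteq> U" "emeasure lborel (U - A) < e'"
      using outer_regular_lborel[of A e'] by auto
    have [measurable]: "U \<in> sets borel" using U by auto
    have "emeasure lborel U = emeasure lborel A + emeasure lborel (U - A)"
      using U(2) by (subst plus_emeasure) (auto intro: arg_cong[where f="emeasure lborel"])
    also have "\<dots> < \<infinity>"
      using base(2) U(3) by (auto intro: less_trans[of _ "ennreal e'"] simp: ennreal_add_less_top)
    finally have Ufin: "emeasure lborel U < \<infinity>" .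
    have fin: "emeasure lborel (U - A) < \<infinity>"
      using U(3) by (rule less_trans) simp
    have "integrable lborel (\<lambda>x. indicator U x *\<^sub>R c)"
      using Ufin by (intro integrable_scaleR_left integrable_real_indicator) auto
    moreover have "(\<integral>x. norm (indicator A x *\<^sub>R c - indicator U x *\<^sub>R c) \<partial>lborel) < e"
    proof -
      have "(\<integral>x. norm (indicator A x *\<^sub>R c - indicator U x *\<^sub>R c) \<partial>lborel) =
          (\<integral>x. indicator (U - A) x * norm c \<partial>lborel)"
        using U(2) by (intro Bochner_Integration.integral_cong) (auto split: split_indicator)
      also have "\<dots> = measure lborel (U - A) * norm c"
        by simp
      also have "\<dots> \<le> e' * norm c"
      proof (rule mult_right_mono)
        have "ennreal (measure lborel (U - A)) < ennreal e'"
          using U(3) fin by (simp add: emeasure_eq_ennreal_measure)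
        then show "measure lborel (U - A) \<le> e'"
          by (simp add: ennreal_less_iff)
      qed simp
      also have "\<dots> < e"
        using \<open>e > 0\<close> by (simp add: e'_def pos_divide_less_eq add_nonneg_pos)
      finally show ?thesis .
    qed
    moreover have "(\<lambda>m. \<integral>x. norm (indicator U (w m + x) *\<^sub>R c - indicator U x *\<^sub>R c) \<partial>lborel) \<longlonglongrightarrow> 0"
      using tendsto_mult_left_zero[OF L1_translation_open[OF U(1) Ufin w], of "norm c"]
      by (simp flip: scaleR_left_diff_distrib)
    ultimately show "\<exists>g. integrable lborel g \<and> (\<integral>x. norm (indicator A x *\<^sub>R c - g x) \<partial>lborel) < e \<and>
        (\<lambda>m. \<integral>x. norm (g (w m + x) - g x) \<partial>lborel) \<longlonglongrightarrow> 0"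
      by (intro exI[of _ "\<lambda>x. indicator U x *\<^sub>R c"] conjI)
  qed
next
  case (add f g)
  note [measurable] = borel_measurable_integrable[OF add(1)] borel_measurable_integrable[OF add(2)]
  have sh: "integrable lborel (\<lambda>x. f (a + x))" "integrable lborel (\<lambda>x. g (a + x))" for a
    using lborel_integrable_affine[OF add(1), of 1 a] lborel_integrable_affine[OF add(2), of 1 a] by simp_all
  show ?case
  proof (rule Lim_null_comparison)
    show "(\<lambda>m. (\<integral>x. norm (f (w m + x) - f x) \<partial>lborel) + (\<integral>x. norm (g (w m + x) - g x) \<partial>lborel)) \<longlonglongrightarrow> 0"
      using add by (intro tendsto_add_zero)
    have "(\<integral>x. norm (f (w m + x) + g (w m + x) - (f x + g x)) \<partial>lborel) \<le>
        (\<integral>x. norm (f (w m + x) - f x) + norm (g (w m + x) - g x) \<partial>lborel)" for m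
      by (rule integral_mono) (use add(1,2) sh in \<open>auto simp: norm_diff_triangle_ineq\<close>)
    also have "(\<integral>x. norm (f (w m + x) - f x) + norm (g (w m + x) - g x) \<partial>lborel) =
        (\<integral>x. norm (f (w m + x) - f x) \<partial>lborel) + (\<integral>x. norm (g (w m + x) - g x) \<partial>lborel)" for m
      using add(1,2) sh by simp
    finally show "\<forall>\<^sub>F m in sequentially. norm (\<integral>x. norm (f (w m + x) + g (w m + x) - (f x + g x)) \<partial>lborel) \<le>
        (\<integral>x. norm (f (w m + x) - f x) \<partial>lborel) + (\<integral>x. norm (g (w m + x) - g x) \<partial>lborel)"
      by simp
  qed
next
  case (lim f s)
  note [measurable] = borel_measurable_integrable[OF lim(1)] borel_measurable_integrable[OF lim(4)]
  have "(\<lambda>i. \<integral>x. norm (f x - s i x) \<partial>lborel) \<longlonglongrightarrow> (\<integral>x. 0 \<partial>(lborel :: 'a measure))"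
  proof (rule integral_dominated_convergence)
    \<comment> \<open>The simple functions of the induction satisfy |s i x| <= 2 |f x|, whence the
      factor 3.\<close>
    show "integrable lborel (\<lambda>x. 3 * norm (f x))" using lim(4) by simp
    show "AE x in lborel. (\<lambda>i. norm (f x - s i x)) \<longlonglongrightarrow> 0"
    proof (rule AE_I2)
      fix x
      have "(\<lambda>i. norm (f x - s i x)) \<longlonglongrightarrow> norm (f x - f x)"
        by (intro tendsto_norm tendsto_diff tendsto_const lim(2)) simp
      then show "(\<lambda>i. norm (f x - s i x)) \<longlonglongrightarrow> 0" by simp
    qed
    show "AE x in lborel. norm (norm (f x - s i x)) \<le> 3 * norm (f x)" for i
    proof (rule AE_I2)
      fix x
      show "norm (norm (f x - s i x)) \<le> 3 * norm (f x)"
        using lim(3)[of x i] norm_triangle_ineq4[of "f x" "s i x"] by simp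
    qed
  qed simp_all
  then have lim0: "(\<lambda>i. \<integral>x. norm (f x - s i x) \<partial>lborel) \<longlonglongrightarrow> 0" by simp
  show ?case
  proof (rule L1_translation_approx)
    fix e :: real assume "e > 0"
    then obtain i where "(\<integral>x. norm (f x - s i x) \<partial>lborel) < e"
      using LIMSEQ_D[OF lim0, of e] by auto
    then show "\<exists>g. integrable lborel g \<and> (\<integral>x. norm (f x - g x) \<partial>lborel) < e \<and>
        (\<lambda>m. \<integral>x. norm (g (w m + x) - g x) \<partial>lborel) \<longlonglongrightarrow> 0"
      using lim(1)[of i] lim(5)[of i] by (intro exI[of _ "s i"] conjI)
  qed (rule lim(4))
qed

section \<open>Product integrals and the Gaussian\<close>

text \<open>\<open>lborel\<close> on a Euclidean space is the image of the product of
  one-dimensional Lebesgue measures under the map from coordinates to vectors, so Fubini for finite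
  products applies.\<close>

lemma
  fixes g :: "'a::euclidean_space \<Rightarrow> real \<Rightarrow> complex"
  assumes g: "\<And>b. b \<in> Basis \<Longrightarrow> integrable lborel (g b)"
  shows lborel_integrable_prod: "integrable lborel (\<lambda>x. \<Prod>b\<in>Basis. g b (x \<bullet> b))"
    and lborel_integral_prod:
      "(\<integral>x. (\<Prod>b\<in>Basis. g b (x \<bullet> b)) \<partial>lborel) = (\<Prod>b\<in>Basis. \<integral>t. g b t \<partial>lborel)"
proof -
  interpret product_sigma_finite "\<lambda>_::'a. lborel :: real measure" ..
  have [measurable]: "\<And>b. b \<in> Basis \<Longrightarrow> g b \<in> borel_measurable borel"
    using borel_measurable_integrable[OF g] by simp
  have eq: "(\<Prod>b\<in>Basis. g b ((\<Sum>b\<in>Basis. f b *\<^sub>R b) \<bullet> b)) = (\<Prod>b\<in>Basis. g b (f b))" for f :: "'a \<Rightarrow> real"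
    by (intro prod.cong) simp_all
  show "integrable lborel (\<lambda>x. \<Prod>b\<in>Basis. g b (x \<bullet> b))"
    using product_integrable_prod[of Basis g, OF _ g]
    by (subst lborel_eq, subst integrable_distr_eq) (simp_all only: eq, measurable)
  show "(\<integral>x. (\<Prod>b\<in>Basis. g b (x \<bullet> b)) \<partial>lborel) = (\<Prod>b\<in>Basis. \<integral>t. g b t \<partial>lborel)"
    using product_integral_prod[of Basis g, OF _ g]
    by (subst lborel_eq, subst integral_distr) (simp_all only: eq, measurable)
qed

lemma norm_power2_Basis:
  fixes x :: "'a::euclidean_space"
  shows "(norm x)\<^sup>2 = (\<Sum>b\<in>Basis. (x \<bullet> b)\<^sup>2)"
  unfolding power2_norm_eq_inner by (subst euclidean_inner) (simp add: power2_eq_square)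

text \<open>This normalization makes the Gaussian a fixed point of \<open>fourier_integral\<close>,
  so no further constants appear in the regularization.\<close>

definition gaussian :: "'a::euclidean_space \<Rightarrow> real" where
  "gaussian x = exp (- (norm x)\<^sup>2 / 2)"

lemma gaussian_bounds [simp]: "0 \<le> gaussian x" "gaussian x \<le> 1" "0 < gaussian x"
  by (simp_all add: gaussian_def)

lemma borel_measurable_gaussian [measurable]: "gaussian \<in> borel_measurable borel"
  unfolding gaussian_def by measurable

text \<open>The characteristic function of the standard normal distribution, evaluated at -t because
  \<open>char\<close> uses the opposite sign in the exponent; sqrt (2 pi) undoes the normalization
  of the density.\<close>

lemma gaussian_integral_1D:
  fixes t :: real
  shows "integrable lborel (\<lambda>x::real. of_real (exp (- x\<^sup>2 / 2)) * exp (- (\<i> * of_real (x * t))))"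
    and "(\<integral>x. of_real (exp (- x\<^sup>2 / 2)) * exp (- (\<i> * of_real (x * t))) \<partial>lborel) =
      of_real (sqrt (2 * pi) * exp (- t\<^sup>2 / 2))"
proof -
  have eq: "of_real (exp (- x\<^sup>2 / 2)) * exp (- (\<i> * of_real (x * t))) =
      of_real (sqrt (2 * pi)) * (std_normal_density x *\<^sub>R iexp (- t * x))" for x
    by (simp add: std_normal_density_def scaleR_conv_of_real mult.commute)
  have int: "integrable lborel (\<lambda>x. std_normal_density x *\<^sub>R iexp (- t * x))"
    by (rule Bochner_Integration.integrable_bound[where f="std_normal_density"])
      (auto intro!: AE_I2 integrable_normal_density)
  show "integrable lborel (\<lambda>x::real. of_real (exp (- x\<^sup>2 / 2)) * exp (- (\<i> * of_real (x * t))))"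
    unfolding eq by (rule integrable_mult_right) (rule int)
  have "of_real (exp (- t\<^sup>2 / 2)) = char std_normal_distribution (- t)"
    by (simp add: char_std_normal_distribution)
  also have "\<dots> = (\<integral>x. std_normal_density x *\<^sub>R iexp (- t * x) \<partial>lborel)"
    unfolding char_def by (subst integral_density) auto
  finally show "(\<integral>x. of_real (exp (- x\<^sup>2 / 2)) * exp (- (\<i> * of_real (x * t))) \<partial>lborel) =
      of_real (sqrt (2 * pi) * exp (- t\<^sup>2 / 2))"
    unfolding eq integral_mult_right_zero by (simp only: of_real_mult)
qed

lemma gaussian_character:
  fixes x \<xi> :: "'a::euclidean_space"
  shows "of_real (gaussian x) * exp (- (\<i> * of_real (x \<bullet> \<xi>))) =
    (\<Prod>b\<in>Basis. of_real (exp (- (x \<bullet> b)\<^sup>2 / 2)) * exp (- (\<i> * of_real ((x \<bullet> b) * (\<xi> \<bullet> b)))))"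
proof -
  have "gaussian x = (\<Prod>b\<in>Basis. exp (- (x \<bullet> b)\<^sup>2 / 2))"
    by (simp add: gaussian_def norm_power2_Basis sum_divide_distrib sum_negf flip: exp_sum)
  moreover have "exp (- (\<i> * of_real (x \<bullet> \<xi>))) = (\<Prod>b\<in>Basis. exp (- (\<i> * of_real ((x \<bullet> b) * (\<xi> \<bullet> b)))))"
    by (simp add: euclidean_inner[of x \<xi>] sum_distrib_left sum_negf flip: exp_sum)
  ultimately show ?thesis
    by (simp only: prod.distrib of_real_prod)
qed

lemma integrable_gaussian [simp]: "integrable lborel (\<lambda>x::'a::euclidean_space. of_real (gaussian x) :: complex)"
  \<comment> \<open>Frequency 0, where the character is identically 1.\<close>
  using lborel_integrable_prod[of "\<lambda>b t. of_real (exp (- t\<^sup>2 / 2)) * exp (- (\<i> * of_real (t * (0 \<bullet> b))))", OF gaussian_integral_1D(1)]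
  by (simp only: gaussian_character[symmetric]) simp

lemma two_pi_powr_mult: "(2 * pi) powr (- real n / 2) * sqrt (2 * pi) ^ n = 1"
proof -
  have "sqrt (2 * pi) ^ n = (2 * pi) powr (real n / 2)"
    by (simp add: powr_half_sqrt[symmetric] powr_powr flip: powr_realpow)
  then show ?thesis
    by (simp add: powr_add[symmetric])
qed

lemma fourier_gaussian:
  fixes \<xi> :: "'a::euclidean_space"
  shows "fourier_integral (\<lambda>x. of_real (gaussian x)) \<xi> = of_real (gaussian \<xi>)"
proof -
  have "(\<integral>x. of_real (gaussian x) * exp (- (\<i> * of_real (x \<bullet> \<xi>))) \<partial>lborel) =
      (\<Prod>b\<in>Basis. of_real (sqrt (2 * pi) * exp (- (\<xi> \<bullet> b)\<^sup>2 / 2)) :: complex)"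
    unfolding gaussian_character
    by (subst lborel_integral_prod[OF gaussian_integral_1D(1)]) (simp only: gaussian_integral_1D(2))
  also have "\<dots> = of_real (sqrt (2 * pi) ^ DIM('a) * (\<Prod>b\<in>Basis. exp (- (\<xi> \<bullet> b)\<^sup>2 / 2)))"
    by (simp add: prod.distrib)
  also have "(\<Prod>b\<in>Basis. exp (- (\<xi> \<bullet> b)\<^sup>2 / 2)) = gaussian \<xi>"
    by (simp add: gaussian_def norm_power2_Basis sum_divide_distrib sum_negf flip: exp_sum)
  finally have eq: "(\<integral>x. of_real (gaussian x) * exp (- (\<i> * of_real (x \<bullet> \<xi>))) \<partial>lborel) =
      (of_real (sqrt (2 * pi) ^ DIM('a) * gaussian \<xi>) :: complex)" .
  have "(2 * pi) powr (- real DIM('a) / 2) * (sqrt (2 * pi) ^ DIM('a) * gaussian \<xi>) = gaussian \<xi>"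
    unfolding mult.assoc[symmetric] two_pi_powr_mult by simp
  then show ?thesis
    unfolding fourier_integral_def eq of_real_mult[symmetric] by (simp only:)
qed

section \<open>The Fourier transform of integrable functions\<close>

lemma integrable_fourier_integrand:
  fixes f :: "'a::euclidean_space \<Rightarrow> complex"
  assumes "integrable lborel f"
  shows "integrable lborel (\<lambda>x. f x * exp (- (\<i> * of_real (x \<bullet> \<xi>))))"
proof -
  have [measurable]: "f \<in> borel_measurable borel" using assms by auto
  show ?thesis
    by (rule Bochner_Integration.integrable_bound[OF assms]) (auto simp: norm_mult)
qed

lemma borel_measurable_fourier_integral:
  fixes f :: "'a::euclidean_space \<Rightarrow> complex"
  assumes [measurable]: "f \<in> borel_measurable borel"
  shows "fourier_integral f \<in> borel_measurable borel"
  unfolding fourier_integral_def[abs_def] by measurable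

lemma norm_fourier_integral_le:
  fixes f :: "'a::euclidean_space \<Rightarrow> complex"
  shows "norm (fourier_integral f \<xi>) \<le> (2 * pi) powr (- real DIM('a) / 2) * (\<integral>x. norm (f x) \<partial>lborel)"
proof -
  have "norm (\<integral>x. f x * exp (- (\<i> * of_real (x \<bullet> \<xi>))) \<partial>lborel) \<le>
      (\<integral>x. norm (f x * exp (- (\<i> * of_real (x \<bullet> \<xi>)))) \<partial>lborel)"
    by (rule integral_norm_bound)
  then show ?thesis
    unfolding fourier_integral_def by (simp add: norm_mult)
qed

lemma fourier_integral_add:
  assumes "integrable lborel f" "integrable lborel g"
  shows "fourier_integral (\<lambda>x. f x + g x) \<xi> = fourier_integral f \<xi> + fourier_integral g \<xi>"
  using integrable_fourier_integrand[OF assms(1), of \<xi>] integrable_fourier_integrand[OF assms(2), of \<xi>]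
  by (simp add: fourier_integral_def ring_distribs)

lemma fourier_integral_scale: "fourier_integral (\<lambda>x. c * f x) \<xi> = c * fourier_integral f \<xi>"
  by (simp add: fourier_integral_def mult.assoc)

lemma fourier_integral_cnj: "fourier_integral (\<lambda>x. cnj (f x)) \<xi> = cnj (fourier_integral f (- \<xi>))"
proof -
  have "(\<integral>x. cnj (f x) * exp (- (\<i> * of_real (x \<bullet> \<xi>))) \<partial>lborel) =
      (\<integral>x. cnj (f x * exp (- (\<i> * of_real (x \<bullet> - \<xi>)))) \<partial>lborel)"
    by (simp add: exp_cnj)
  also have "\<dots> = cnj (\<integral>x. f x * exp (- (\<i> * of_real (x \<bullet> - \<xi>))) \<partial>lborel)"
    by (rule Bochner_Integration.integral_cnj)
  finally show ?thesis
    by (simp add: fourier_integral_def)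
qed

text \<open>One formula for translations (c = 1), dilations (t = 0) and reflections (c = -1). The
  reflected, translated and rescaled mollifier kernel needs all three at once.\<close>

lemma fourier_integral_affine:
  fixes f :: "'a::euclidean_space \<Rightarrow> complex"
  assumes [measurable]: "f \<in> borel_measurable borel" and c: "c \<noteq> 0"
  shows "fourier_integral (\<lambda>x. f (t + c *\<^sub>R x)) \<xi> =
    of_real (1 / \<bar>c\<bar> ^ DIM('a)) * exp (\<i> * of_real (t \<bullet> \<xi> / c)) * fourier_integral f (\<xi> /\<^sub>R c)"
proof -
  \<comment> \<open>The integrand in the new variable y = t + c x, so that x . xi = y . (xi / c) -
    (t . xi) / c.\<close>
  define F where "F y = exp (\<i> * of_real (t \<bullet> \<xi> / c)) * (f y * exp (- (\<i> * of_real (y \<bullet> (\<xi> /\<^sub>R c)))))" for y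
  have [measurable]: "F \<in> borel_measurable borel" unfolding F_def by measurable
  have "f (t + c *\<^sub>R x) * exp (- (\<i> * of_real (x \<bullet> \<xi>))) = F (t + c *\<^sub>R x)" for x
  proof -
    have "- (\<i> * of_real (x \<bullet> \<xi>)) = \<i> * of_real (t \<bullet> \<xi> / c) + - (\<i> * of_real ((t + c *\<^sub>R x) \<bullet> (\<xi> /\<^sub>R c)))"
      using c by (simp add: inner_add_left field_simps)
    then have "exp (- (\<i> * of_real (x \<bullet> \<xi>))) =
        exp (\<i> * of_real (t \<bullet> \<xi> / c)) * exp (- (\<i> * of_real ((t + c *\<^sub>R x) \<bullet> (\<xi> /\<^sub>R c))))"
      by (simp only: exp_add)
    then show ?thesis
      unfolding F_def by (simp only: mult.commute mult.left_commute)
  qed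
  then have "(\<integral>x. f (t + c *\<^sub>R x) * exp (- (\<i> * of_real (x \<bullet> \<xi>))) \<partial>lborel) =
      (1 / \<bar>c\<bar> ^ DIM('a)) *\<^sub>R (\<integral>y. F y \<partial>lborel)"
    using lborel_integral_affine[of F c t] c by simp
  also have "(\<integral>y. F y \<partial>lborel) = exp (\<i> * of_real (t \<bullet> \<xi> / c)) *
      (\<integral>y. f y * exp (- (\<i> * of_real (y \<bullet> (\<xi> /\<^sub>R c)))) \<partial>lborel)"
    unfolding F_def by (rule integral_mult_right_zero)
  finally show ?thesis
    unfolding fourier_integral_def by (simp add: scaleR_conv_of_real)
qed

text \<open>The kernel exp(-i x . xi) is symmetric in x and xi, and |f(x)| |g(xi)| is integrable on
  the product, so Fubini lets the transform move from one factor to the other.\<close>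

lemma fourier_integral_multiplication:
  fixes f g :: "'a::euclidean_space \<Rightarrow> complex"
  assumes f: "integrable lborel f" and g: "integrable lborel g"
  shows "(\<integral>\<xi>. fourier_integral f \<xi> * g \<xi> \<partial>lborel) = (\<integral>x. f x * fourier_integral g x \<partial>lborel)"
proof -
  have [measurable]: "f \<in> borel_measurable borel" "g \<in> borel_measurable borel"
    using f g by auto
  define K where "K x \<xi> = f x * g \<xi> * exp (- (\<i> * of_real (x \<bullet> \<xi>)))" for x \<xi>
  have [measurable]: "(\<lambda>(x, \<xi>). K x \<xi>) \<in> borel_measurable (lborel \<Otimes>\<^sub>M lborel)"
    unfolding K_def by measurable
  have K: "integrable (lborel \<Otimes>\<^sub>M lborel) (\<lambda>(x, \<xi>). K x \<xi>)"
  proof (rule lborel_pair.Fubini_integrable)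
    have "norm (K x \<xi>) = norm (f x) * norm (g \<xi>)" for x \<xi>
      by (simp add: K_def norm_mult)
    then show "integrable lborel (\<lambda>x. \<integral>\<xi>. norm (case (x, \<xi>) of (x, \<xi>) \<Rightarrow> K x \<xi>) \<partial>lborel)"
      using f by simp
    have "K x = (\<lambda>\<xi>. f x * (g \<xi> * exp (- (\<i> * of_real (\<xi> \<bullet> x)))))" for x
      by (rule ext) (simp add: K_def inner_commute)
    then show "AE x in lborel. integrable lborel (\<lambda>\<xi>. case (x, \<xi>) of (x, \<xi>) \<Rightarrow> K x \<xi>)"
      using integrable_fourier_integrand[OF g] by simp
  qed measurable
  define c where "c = (of_real ((2 * pi) powr (- real DIM('a) / 2)) :: complex)"
  have "(\<integral>\<xi>. fourier_integral f \<xi> * g \<xi> \<partial>lborel) = (\<integral>\<xi>. c * (\<integral>x. K x \<xi> \<partial>lborel) \<partial>lborel)"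
  proof (rule Bochner_Integration.integral_cong[OF refl])
    fix \<xi>
    have "(\<integral>x. K x \<xi> \<partial>lborel) = (\<integral>x. (f x * exp (- (\<i> * of_real (x \<bullet> \<xi>)))) * g \<xi> \<partial>lborel)"
      unfolding K_def by (intro Bochner_Integration.integral_cong) auto
    then show "fourier_integral f \<xi> * g \<xi> = c * (\<integral>x. K x \<xi> \<partial>lborel)"
      by (simp add: fourier_integral_def c_def)
  qed
  also have "\<dots> = c * (\<integral>\<xi>. (\<integral>x. K x \<xi> \<partial>lborel) \<partial>lborel)"
    by simp
  also have "\<dots> = c * (\<integral>x. (\<integral>\<xi>. K x \<xi> \<partial>lborel) \<partial>lborel)"
    by (subst lborel_pair.Fubini_integral[OF K]) (rule refl)
  also have "\<dots> = (\<integral>x. c * (\<integral>\<xi>. K x \<xi> \<partial>lborel) \<partial>lborel)"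
    by simp
  also have "\<dots> = (\<integral>x. f x * fourier_integral g x \<partial>lborel)"
  proof (rule Bochner_Integration.integral_cong[OF refl])
    fix x
    have "(\<integral>\<xi>. K x \<xi> \<partial>lborel) = (\<integral>\<xi>. f x * (g \<xi> * exp (- (\<i> * of_real (\<xi> \<bullet> x)))) \<partial>lborel)"
      unfolding K_def by (intro Bochner_Integration.integral_cong) (auto simp: inner_commute)
    then show "c * (\<integral>\<xi>. K x \<xi> \<partial>lborel) = f x * fourier_integral g x"
      by (simp add: fourier_integral_def c_def)
  qed
  finally show ?thesis .
qed

section \<open>Plancherel's theorem\<close>

text \<open>Cauchy-Schwarz and translation invariance. Uniformity in a provides the majorants for
  Fubini and for the limit of vanishing Gaussian width.\<close>

lemma autocorrelation_bound:
  fixes h :: "'a::euclidean_space \<Rightarrow> complex"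
  assumes h: "square_integrable h"
  shows "(\<integral>x. norm (h x) * norm (h (a + x)) \<partial>lborel) \<le> (L2_norm h)\<^sup>2"
proof -
  note [measurable] = square_integrable_measurable[OF h]
  have "L2_norm (\<lambda>x. h (a + x)) = L2_norm h"
    using L2_norm_affine[of h 1 a] by simp
  then show ?thesis
    using L2_Cauchy_Schwarz_norm[OF h, of "\<lambda>x. h (a + x)"] square_integrable_affine[OF h, of 1 a]
    by (simp add: power2_eq_square)
qed

text \<open>Translation is known to be continuous in L1 only. So one factor h is split: its
  truncation at height k is bounded and is paired with the L1-small difference of translates, while
  the remainder is small in L2 and is paired with the same difference, whose L2 norm is at most
  twice that of h.\<close>

lemma autocorrelation_tendsto:
  fixes h :: "'a::euclidean_space \<Rightarrow> complex"
  assumes h1: "integrable lborel h" and h2: "square_integrable h" and w: "w \<longlonglongrightarrow> 0"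
  shows "(\<lambda>m. \<integral>x. h x * cnj (h (w m + x)) \<partial>lborel) \<longlonglongrightarrow> of_real ((L2_norm h)\<^sup>2)"
proof -
  note [measurable] = square_integrable_measurable[OF h2]
  have sh: "square_integrable (\<lambda>x. h (a + x))" "integrable lborel (\<lambda>x. h (a + x))"
      "L2_norm (\<lambda>x. h (a + x)) = L2_norm h" for a
    using square_integrable_affine[OF h2, of 1 a] lborel_integrable_affine[OF h1, of 1 a]
      L2_norm_affine[of h 1 a] by simp_all
  define tr where "tr k x = (if norm (h x) \<le> real k then h x else 0)" for k :: nat and x
  have [measurable]: "tr k \<in> borel_measurable borel" for k
    unfolding tr_def by measurable
  have str: "square_integrable (tr k)" for k
    by (rule square_integrable_bound[OF h2, of _ 1]) (auto simp: tr_def)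
  have trlim: "(\<lambda>k. L2_norm (\<lambda>x. h x - tr k x)) \<longlonglongrightarrow> 0"
  proof -
    have "(\<lambda>k. \<integral>x. (norm (h x - tr k x))\<^sup>2 \<partial>lborel) \<longlonglongrightarrow> (\<integral>x. 0 \<partial>(lborel :: 'a measure))"
    proof (rule integral_dominated_convergence)
      show "integrable lborel (\<lambda>x. (norm (h x))\<^sup>2)"
        by (rule square_integrable_norm2[OF h2])
      show "AE x in lborel. (\<lambda>k. (norm (h x - tr k x))\<^sup>2) \<longlonglongrightarrow> 0"
      proof (rule AE_I2)
        fix x
        obtain N where "norm (h x) \<le> real N"
          using real_arch_simple by blast
        then have "\<forall>\<^sub>F k in sequentially. (norm (h x - tr k x))\<^sup>2 = 0"
          by (intro eventually_sequentiallyI[of N]) (auto simp: tr_def)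
        then show "(\<lambda>k. (norm (h x - tr k x))\<^sup>2) \<longlonglongrightarrow> 0"
          by (rule tendsto_eventually)
      qed
    qed (auto simp: tr_def)
    from tendsto_real_sqrt[OF this] show ?thesis
      unfolding L2_norm_def by simp
  qed
  have "(\<lambda>m. (\<integral>x. h x * cnj (h (w m + x)) \<partial>lborel) - of_real ((L2_norm h)\<^sup>2)) \<longlonglongrightarrow> 0"
  proof (rule LIMSEQ_I)
    fix e :: real assume "e > 0"
    \<comment> \<open>Twice the norm of h bounds the L2 norm of the difference \<open>d\<close>
      below; the 1 keeps B positive as a divisor.\<close>
    define B where "B = 2 * L2_norm h + 1"
    have "B > 0" by (simp add: B_def add_nonneg_pos)
    obtain k where k: "L2_norm (\<lambda>x. h x - tr k x) < e / (2 * B)"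
      using LIMSEQ_D[OF trlim, of "e / (2 * B)"] \<open>e > 0\<close> \<open>B > 0\<close> by auto
    obtain N where N: "\<And>m. m \<ge> N \<Longrightarrow> norm ((\<integral>x. norm (h (w m + x) - h x) \<partial>lborel) - 0) < e / (2 * (real k + 1))"
      using LIMSEQ_D[OF L1_translation[OF h1 w], of "e / (2 * (real k + 1))"] \<open>e > 0\<close> by auto
    have "norm ((\<integral>x. h x * cnj (h (w m + x)) \<partial>lborel) - of_real ((L2_norm h)\<^sup>2) - 0) < e" if "m \<ge> N" for m
    proof -
      define d where "d x = h (w m + x) - h x" for x
      have sd: "square_integrable d" and id: "integrable lborel d"
        unfolding d_def
        by (intro square_integrable_diff Bochner_Integration.integrable_diff sh(1,2) h1 h2)+
      have Ld: "L2_norm d \<le> 2 * L2_norm h"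
        unfolding d_def
        using L2_norm_triangle[OF sh(1)[of "w m"] square_integrable_scale[OF h2, of "-1"]]
          L2_norm_scale[of "-1" h] sh(3)[of "w m"] by simp
      note [measurable] = square_integrable_measurable[OF sd]
      have int1: "integrable lborel (\<lambda>x. tr k x * cnj (d x))" "integrable lborel (\<lambda>x. (h x - tr k x) * cnj (d x))"
        by (intro square_integrable_mult square_integrable_cnj square_integrable_diff str sd h2)+
      have "of_real ((L2_norm h)\<^sup>2) = (\<integral>x. h x * cnj (h x) \<partial>lborel)"
        by (simp only: L2_norm_power2 complex_norm_square[symmetric] integral_complex_of_real)
      then have "(\<integral>x. h x * cnj (h (w m + x)) \<partial>lborel) - of_real ((L2_norm h)\<^sup>2) =
          (\<integral>x. h x * cnj (h (w m + x)) - h x * cnj (h x) \<partial>lborel)"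
        using square_integrable_mult[OF h2 square_integrable_cnj[OF sh(1)[of "w m"]]]
          square_integrable_mult[OF h2 square_integrable_cnj[OF h2]] by simp
      also have "\<dots> = (\<integral>x. tr k x * cnj (d x) + (h x - tr k x) * cnj (d x) \<partial>lborel)"
        by (intro Bochner_Integration.integral_cong) (auto simp: d_def algebra_simps)
      also have "\<dots> = (\<integral>x. tr k x * cnj (d x) \<partial>lborel) + (\<integral>x. (h x - tr k x) * cnj (d x) \<partial>lborel)"
        using int1 by (rule Bochner_Integration.integral_add)
      finally have eq: "(\<integral>x. h x * cnj (h (w m + x)) \<partial>lborel) - of_real ((L2_norm h)\<^sup>2) = \<dots>" .
      have "norm (\<integral>x. tr k x * cnj (d x) \<partial>lborel) \<le> (\<integral>x. norm (tr k x * cnj (d x)) \<partial>lborel)"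
        by (rule integral_norm_bound)
      also have "\<dots> \<le> (\<integral>x. real k * norm (d x) \<partial>lborel)"
        by (rule integral_mono)
          (use integrable_norm[OF int1(1)] integrable_norm[OF id] in \<open>auto simp: tr_def norm_mult intro!: mult_right_mono\<close>)
      also have "\<dots> = real k * (\<integral>x. norm (d x) \<partial>lborel)"
        by simp
      also have "\<dots> \<le> real k * (e / (2 * (real k + 1)))"
        using N[OF that] by (intro mult_left_mono) (auto simp: d_def)
      also have "\<dots> \<le> e / 2"
        using \<open>e > 0\<close> by (simp add: field_simps)
      finally have 1: "norm (\<integral>x. tr k x * cnj (d x) \<partial>lborel) \<le> e / 2" .
      have "norm (\<integral>x. (h x - tr k x) * cnj (d x) \<partial>lborel) \<le> L2_norm (\<lambda>x. h x - tr k x) * L2_norm d"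
        using L2_Cauchy_Schwarz[OF square_integrable_diff[OF h2 str] square_integrable_cnj[OF sd]] by simp
      also have "\<dots> \<le> L2_norm (\<lambda>x. h x - tr k x) * B"
        using Ld by (intro mult_left_mono) (auto simp: B_def)
      also have "\<dots> < e / (2 * B) * B"
        using k \<open>B > 0\<close> by (rule mult_strict_right_mono)
      also have "\<dots> = e / 2"
        using \<open>B > 0\<close> by simp
      finally have 2: "norm (\<integral>x. (h x - tr k x) * cnj (d x) \<partial>lborel) < e / 2" .
      show ?thesis
        unfolding eq diff_0_right using norm_triangle_ineq[of "\<integral>x. tr k x * cnj (d x) \<partial>lborel" "\<integral>x. (h x - tr k x) * cnj (d x) \<partial>lborel"] 1 2
        by linarith
    qed
    then show "\<exists>no. \<forall>m\<ge>no. norm ((\<integral>x. h x * cnj (h (w m + x)) \<partial>lborel) - of_real ((L2_norm h)\<^sup>2) - 0) < e"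
      by (intro exI[of _ N] allI impI)
  qed
  then show ?thesis by (rule LIM_zero_cancel)
qed

lemma fourier_integral_scaled_gaussian:
  fixes \<xi> :: "'a::euclidean_space"
  assumes "\<delta> > 0"
  shows "fourier_integral (\<lambda>x. of_real (gaussian (\<delta> *\<^sub>R x))) \<xi> =
    of_real (gaussian (\<xi> /\<^sub>R \<delta>) / \<delta> ^ DIM('a))"
  using fourier_integral_affine[of "\<lambda>x::'a. of_real (gaussian x)" \<delta> 0 \<xi>] assms
  by (simp add: fourier_gaussian)

lemma integrable_scaled_gaussian:
  assumes "\<delta> > 0"
  shows "integrable lborel (\<lambda>x::'a::euclidean_space. of_real (gaussian (\<delta> *\<^sub>R x)) :: complex)"
  using lborel_integrable_affine[OF integrable_gaussian, of \<delta> 0] assms by simp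

text \<open>The left-hand side is a Gaussian regularisation of $\|\widehat h\|^2$; the right-hand side
  averages the autocorrelation of $h$ over a Gaussian concentrating at the origin as
  $\delta \to 0$.\<close>

lemma gaussian_plancherel:
  fixes h :: "'a::euclidean_space \<Rightarrow> complex"
  assumes h1: "integrable lborel h" and h2: "square_integrable h" and \<delta>: "\<delta> > 0"
  shows "(\<integral>\<xi>. of_real ((norm (fourier_integral h \<xi>))\<^sup>2 * gaussian (\<delta> *\<^sub>R \<xi>)) \<partial>lborel) =
    of_real ((2 * pi) powr (- real DIM('a) / 2)) *
      (\<integral>z. of_real (gaussian z) * (\<integral>x. h x * cnj (h (\<delta> *\<^sub>R z + x)) \<partial>lborel) \<partial>lborel)"
proof -
  define c where "c = (of_real ((2 * pi) powr (- real DIM('a) / 2)) :: complex)"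
  have cc: "cnj c = c" by (simp add: c_def)
  define \<psi> :: "'a \<Rightarrow> complex" where "\<psi> x = of_real (gaussian (\<delta> *\<^sub>R x))" for x
  have \<psi>: "integrable lborel \<psi>" and cnj\<psi>: "cnj (\<psi> x) = \<psi> x" for x
    unfolding \<psi>_def using integrable_scaled_gaussian[OF \<delta>] by auto
  note [measurable] = square_integrable_measurable[OF h2] borel_measurable_fourier_integral
  have [measurable]: "\<psi> \<in> borel_measurable borel" unfolding \<psi>_def by measurable
  \<comment> \<open>Chosen so that the transform of h times k is the regularised square modulus. The
    transform of h is bounded and \<open>\<psi>\<close> is integrable, so k is in L1 and the
    multiplication formula applies although the square modulus is not yet known to be
    integrable.\<close>
  define k where "k \<xi> = cnj (fourier_integral h \<xi>) * \<psi> \<xi>" for \<xi>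
  have k: "integrable lborel k"
    unfolding k_def
  proof (rule Bochner_Integration.integrable_bound)
    show "integrable lborel (\<lambda>\<xi>. ((2 * pi) powr (- real DIM('a) / 2) * (\<integral>x. norm (h x) \<partial>lborel)) *\<^sub>R \<psi> \<xi>)"
      using \<psi> by simp
    show "AE \<xi> in lborel. norm (cnj (fourier_integral h \<xi>) * \<psi> \<xi>) \<le>
        norm (((2 * pi) powr (- real DIM('a) / 2) * (\<integral>x. norm (h x) \<partial>lborel)) *\<^sub>R \<psi> \<xi>)"
      using norm_fourier_integral_le[of h] by (auto intro!: AE_I2 mult_right_mono simp: norm_mult)
  qed measurable
  have kF: "cnj (fourier_integral k x) = c * (\<integral>z. h (\<delta> *\<^sub>R z + x) * of_real (gaussian z) \<partial>lborel)" for x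
  proof -
    \<comment> \<open>A second use of the multiplication formula, with a modulated Gaussian: the
      modulation by x turns into a translation of its transform, a Gaussian of width delta centred
      at x.\<close>
    define e where "e \<xi> = \<psi> \<xi> * exp (\<i> * of_real (\<xi> \<bullet> x))" for \<xi>
    have e: "integrable lborel e"
      unfolding e_def using integrable_fourier_integrand[OF \<psi>, of "-x"] by simp
    have "cnj (fourier_integral k x) = c * cnj (\<integral>\<xi>. k \<xi> * exp (- (\<i> * of_real (\<xi> \<bullet> x))) \<partial>lborel)"
      by (simp add: fourier_integral_def c_def)
    also have "\<dots> = c * (\<integral>\<xi>. cnj (k \<xi> * exp (- (\<i> * of_real (\<xi> \<bullet> x)))) \<partial>lborel)"
      by (simp only: Bochner_Integration.integral_cnj)
    also have "\<dots> = c * (\<integral>\<xi>. fourier_integral h \<xi> * e \<xi> \<partial>lborel)"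
      by (simp add: k_def e_def cnj\<psi> exp_cnj mult.assoc)
    also have "(\<integral>\<xi>. fourier_integral h \<xi> * e \<xi> \<partial>lborel) = (\<integral>y. h y * fourier_integral e y \<partial>lborel)"
      by (rule fourier_integral_multiplication[OF h1 e])
    also have "\<dots> = (\<integral>y. h y * of_real (gaussian ((y - x) /\<^sub>R \<delta>) / \<delta> ^ DIM('a)) \<partial>lborel)"
    proof (intro Bochner_Integration.integral_cong refl)
      fix y
      have "e \<xi> * exp (- (\<i> * of_real (\<xi> \<bullet> y))) = \<psi> \<xi> * exp (- (\<i> * of_real (\<xi> \<bullet> (y - x))))" for \<xi>
        unfolding e_def mult.assoc exp_add[symmetric] by (simp add: inner_diff_right algebra_simps)
      then have "fourier_integral e y = fourier_integral \<psi> (y - x)"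
        by (simp add: fourier_integral_def)
      then show "h y * fourier_integral e y = h y * of_real (gaussian ((y - x) /\<^sub>R \<delta>) / \<delta> ^ DIM('a))"
        using fourier_integral_scaled_gaussian[OF \<delta>, of "y - x"] by (simp add: \<psi>_def[abs_def])
    qed
    \<comment> \<open>The substitution y = x + delta z; its Jacobian cancels the factor delta^(-n)
      of the transformed Gaussian.\<close>
    also have "\<dots> = (\<integral>z. h (x + \<delta> *\<^sub>R z) * of_real (gaussian z) \<partial>lborel)"
    proof -
      define G where "G y = h y * of_real (gaussian ((y - x) /\<^sub>R \<delta>) / \<delta> ^ DIM('a))" for y
      have [measurable]: "G \<in> borel_measurable borel" unfolding G_def by measurable
      have "(\<integral>z. G (x + \<delta> *\<^sub>R z) \<partial>lborel) = (1 / \<delta> ^ DIM('a)) *\<^sub>R (\<integral>y. G y \<partial>lborel)"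
        using lborel_integral_affine[of G \<delta> x] \<delta> by simp
      moreover have "G (x + \<delta> *\<^sub>R z) = (1 / \<delta> ^ DIM('a)) *\<^sub>R (h (x + \<delta> *\<^sub>R z) * of_real (gaussian z))" for z
        using \<delta> by (simp add: G_def scaleR_conv_of_real)
      ultimately show ?thesis
        using \<delta> unfolding G_def[symmetric] by simp
    qed
    finally show ?thesis by (simp add: add.commute)
  qed
  have "(\<integral>\<xi>. of_real ((norm (fourier_integral h \<xi>))\<^sup>2 * gaussian (\<delta> *\<^sub>R \<xi>)) \<partial>lborel) =
      (\<integral>\<xi>. fourier_integral h \<xi> * k \<xi> \<partial>lborel)"
    by (simp add: k_def \<psi>_def complex_norm_square mult.assoc del: of_real_power)
  also have "\<dots> = (\<integral>x. h x * fourier_integral k x \<partial>lborel)"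
    by (rule fourier_integral_multiplication[OF h1 k])
  also have "\<dots> = (\<integral>x. c * (\<integral>z. h x * cnj (h (\<delta> *\<^sub>R z + x)) * of_real (gaussian z) \<partial>lborel) \<partial>lborel)"
  proof (intro Bochner_Integration.integral_cong refl)
    fix x
    have "fourier_integral k x = cnj (cnj (fourier_integral k x))" by simp
    also have "\<dots> = c * (\<integral>z. cnj (h (\<delta> *\<^sub>R z + x) * of_real (gaussian z)) \<partial>lborel)"
      unfolding kF by (simp only: complex_cnj_mult cc Bochner_Integration.integral_cnj[symmetric])
    finally have "h x * fourier_integral k x = c * (h x * (\<integral>z. cnj (h (\<delta> *\<^sub>R z + x)) * of_real (gaussian z) \<partial>lborel))"
      by simp
    also have "h x * (\<integral>z. cnj (h (\<delta> *\<^sub>R z + x)) * of_real (gaussian z) \<partial>lborel) =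
        (\<integral>z. h x * (cnj (h (\<delta> *\<^sub>R z + x)) * of_real (gaussian z)) \<partial>lborel)"
      by (rule integral_mult_right_zero[symmetric])
    finally show "h x * fourier_integral k x =
        c * (\<integral>z. h x * cnj (h (\<delta> *\<^sub>R z + x)) * of_real (gaussian z) \<partial>lborel)"
      by (simp only: mult.assoc)
  qed
  also have "\<dots> = c * (\<integral>x. (\<integral>z. h x * cnj (h (\<delta> *\<^sub>R z + x)) * of_real (gaussian z) \<partial>lborel) \<partial>lborel)"
    by (rule integral_mult_right_zero)
  also have "(\<integral>x. (\<integral>z. h x * cnj (h (\<delta> *\<^sub>R z + x)) * of_real (gaussian z) \<partial>lborel) \<partial>lborel) =
      (\<integral>z. (\<integral>x. h x * cnj (h (\<delta> *\<^sub>R z + x)) * of_real (gaussian z) \<partial>lborel) \<partial>lborel)"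
  proof (rule lborel_pair.Fubini_integral)
    define K where "K z x = h x * cnj (h (\<delta> *\<^sub>R z + x)) * of_real (gaussian z)" for z x
    have [measurable]: "(\<lambda>(z, x). K z x) \<in> borel_measurable (lborel \<Otimes>\<^sub>M lborel)"
      unfolding K_def by measurable
    have sh: "square_integrable (\<lambda>x. h (a + x))" for a
      using square_integrable_affine[OF h2, of 1 a] by simp
    show "integrable (lborel \<Otimes>\<^sub>M lborel) (\<lambda>(z, x). h x * cnj (h (\<delta> *\<^sub>R z + x)) * of_real (gaussian z))"
      unfolding K_def[symmetric]
    proof (rule lborel_pair.Fubini_integrable)
      \<comment> \<open>Integrating in x first leaves the autocorrelation of |h|, bounded by the
        squared norm of h, against an integrable Gaussian.\<close>
      show "integrable lborel (\<lambda>z. \<integral>x. norm (case (z, x) of (z, x) \<Rightarrow> K z x) \<partial>lborel)"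
      proof (rule Bochner_Integration.integrable_bound)
        show "integrable lborel (\<lambda>z::'a. (L2_norm h)\<^sup>2 *\<^sub>R (of_real (gaussian z) :: complex))"
          by simp
        show "AE z in lborel. norm (\<integral>x. norm (case (z, x) of (z, x) \<Rightarrow> K z x) \<partial>lborel) \<le>
            norm ((L2_norm h)\<^sup>2 *\<^sub>R (of_real (gaussian z) :: complex))"
          using autocorrelation_bound[OF h2]
          by (auto intro!: AE_I2 mult_right_mono simp: K_def norm_mult)
      qed measurable
      show "AE z in lborel. integrable lborel (\<lambda>x. case (z, x) of (z, x) \<Rightarrow> K z x)"
        unfolding K_def using square_integrable_mult[OF h2 square_integrable_cnj[OF sh]]
        by (auto intro!: AE_I2)
    qed measurable
  qed
  also have "\<dots> = (\<integral>z. of_real (gaussian z) * (\<integral>x. h x * cnj (h (\<delta> *\<^sub>R z + x)) \<partial>lborel) \<partial>lborel)"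
    by (simp add: mult.commute)
  finally show ?thesis unfolding c_def .
qed

text \<open>In \<open>gaussian_plancherel\<close> with delta = 1/(m+1), the right-hand side
  converges by dominated convergence to the squared norm of h. The left-hand integrands increase to
  the square modulus of the transform, so monotone convergence yields its integrability together
  with the value of the integral.\<close>

theorem plancherel_L1_L2:
  fixes h :: "'a::euclidean_space \<Rightarrow> complex"
  assumes h1: "integrable lborel h" and h2: "square_integrable h"
  shows "square_integrable (fourier_integral h)" and "L2_norm (fourier_integral h) = L2_norm h"
proof -
  define c where "c = (of_real ((2 * pi) powr (- real DIM('a) / 2)) :: complex)"
  note [measurable] = square_integrable_measurable[OF h2] borel_measurable_fourier_integral
  define A where "A a = (\<integral>x. h x * cnj (h (a + x)) \<partial>lborel)" for a
  have [measurable]: "A \<in> borel_measurable borel"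
    unfolding A_def by measurable
  define f where "f m \<xi> = (norm (fourier_integral h \<xi>))\<^sup>2 * gaussian ((1 / real (Suc m)) *\<^sub>R \<xi>)" for m \<xi>
  have A: "norm (A a) \<le> (L2_norm h)\<^sup>2" for a
  proof -
    have "norm (A a) \<le> (\<integral>x. norm (h x * cnj (h (a + x))) \<partial>lborel)"
      unfolding A_def by (rule integral_norm_bound)
    then show ?thesis
      using autocorrelation_bound[OF h2, of a] by (simp add: norm_mult)
  qed
  have z0: "(\<lambda>m. (1 / real (Suc m)) *\<^sub>R z) \<longlonglongrightarrow> 0" for z :: 'a
    using tendsto_scaleR[OF LIMSEQ_Suc[OF lim_1_over_n] tendsto_const[of z]] by simp
  have "(\<lambda>m. \<integral>z. of_real (gaussian z) * A ((1 / real (Suc m)) *\<^sub>R z) \<partial>lborel)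
      \<longlonglongrightarrow> (\<integral>z. of_real (gaussian z) * of_real ((L2_norm h)\<^sup>2) \<partial>(lborel :: 'a measure))"
  proof (rule integral_dominated_convergence)
    show "integrable lborel (\<lambda>z::'a. norm (of_real (gaussian z) :: complex) * (L2_norm h)\<^sup>2)"
      using integrable_norm[OF integrable_gaussian[where 'a='a]] by simp
    show "AE z in lborel. (\<lambda>m. of_real (gaussian z) * A ((1 / real (Suc m)) *\<^sub>R z))
        \<longlonglongrightarrow> of_real (gaussian z) * of_real ((L2_norm h)\<^sup>2)"
      unfolding A_def by (intro AE_I2 tendsto_mult tendsto_const autocorrelation_tendsto h1 h2 z0)
    show "AE z in lborel. norm (of_real (gaussian z) * A ((1 / real (Suc m)) *\<^sub>R z)) \<le>
        norm (of_real (gaussian z) :: complex) * (L2_norm h)\<^sup>2" for m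
      using A by (intro AE_I2) (simp add: norm_mult mult_left_mono)
  qed measurable
  then have "(\<lambda>m. c * (\<integral>z. of_real (gaussian z) * A ((1 / real (Suc m)) *\<^sub>R z) \<partial>lborel))
      \<longlonglongrightarrow> c * (\<integral>z. of_real (gaussian z) * of_real ((L2_norm h)\<^sup>2) \<partial>(lborel :: 'a measure))"
    by (intro tendsto_mult tendsto_const)
  moreover have "c * (\<integral>z. of_real (gaussian z) * A ((1 / real (Suc m)) *\<^sub>R z) \<partial>lborel) =
      of_real (\<integral>\<xi>. f m \<xi> \<partial>lborel)" for m
    using gaussian_plancherel[OF h1 h2, of "1 / real (Suc m)"]
    by (simp only: f_def integral_complex_of_real[symmetric] A_def c_def) simp
  moreover have "c * (\<integral>z. of_real (gaussian z) * of_real ((L2_norm h)\<^sup>2) \<partial>(lborel :: 'a measure)) =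
      of_real ((L2_norm h)\<^sup>2)"
  proof -
    \<comment> \<open>The transform of the Gaussian at frequency 0.\<close>
    have "c * (\<integral>z. of_real (gaussian z) \<partial>(lborel :: 'a measure)) = 1"
      using fourier_gaussian[of "0::'a"] by (simp add: fourier_integral_def c_def gaussian_def)
    then show ?thesis by simp
  qed
  ultimately have "(\<lambda>m. of_real (\<integral>\<xi>. f m \<xi> \<partial>lborel) :: complex) \<longlonglongrightarrow> of_real ((L2_norm h)\<^sup>2)"
    by (simp only:)
  then have flim: "(\<lambda>m. \<integral>\<xi>. f m \<xi> \<partial>lborel) \<longlonglongrightarrow> (L2_norm h)\<^sup>2"
    by (simp only: tendsto_of_real_iff)
  have fint: "integrable lborel (f m)" for m
  proof (rule Bochner_Integration.integrable_bound)
    let ?B = "((2 * pi) powr (- real DIM('a) / 2) * (\<integral>x. norm (h x) \<partial>lborel))\<^sup>2"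
    show "integrable lborel (\<lambda>\<xi>::'a. ?B *\<^sub>R (of_real (gaussian ((1 / real (Suc m)) *\<^sub>R \<xi>)) :: complex))"
      by (intro integrable_scaleR_right integrable_scaled_gaussian) simp
    show "AE \<xi> in lborel. norm (f m \<xi>) \<le> norm (?B *\<^sub>R (of_real (gaussian ((1 / real (Suc m)) *\<^sub>R \<xi>)) :: complex))"
      unfolding f_def using norm_fourier_integral_le[of h]
      by (intro AE_I2) (auto simp: abs_mult intro!: mult_right_mono power_mono)
    show "f m \<in> borel_measurable lborel"
      unfolding f_def by measurable
  qed
  have "mono (\<lambda>m. f m \<xi>)" for \<xi>
  proof (rule monoI)
    fix m n :: nat assume "m \<le> n"
    then have "(1 / real (Suc n)) * norm \<xi> \<le> (1 / real (Suc m)) * norm \<xi>"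
      by (intro mult_right_mono) (auto simp: field_simps)
    then have "((1 / real (Suc n)) * norm \<xi>)\<^sup>2 \<le> ((1 / real (Suc m)) * norm \<xi>)\<^sup>2"
      by (rule power_mono) simp
    then have "gaussian ((1 / real (Suc m)) *\<^sub>R \<xi>) \<le> gaussian ((1 / real (Suc n)) *\<^sub>R \<xi>)"
      by (simp add: gaussian_def)
    then show "f m \<xi> \<le> f n \<xi>"
      unfolding f_def by (intro mult_left_mono) auto
  qed
  moreover have "(\<lambda>m. f m \<xi>) \<longlonglongrightarrow> (norm (fourier_integral h \<xi>))\<^sup>2" for \<xi>
  proof -
    have "(\<lambda>m. exp (- (norm ((1 / real (Suc m)) *\<^sub>R \<xi>))\<^sup>2 / 2)) \<longlonglongrightarrow> exp (- (norm (0::'a))\<^sup>2 / 2)"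
      by (intro tendsto_intros z0) auto
    then have "(\<lambda>m. gaussian ((1 / real (Suc m)) *\<^sub>R \<xi>)) \<longlonglongrightarrow> 1"
      by (simp add: gaussian_def)
    from tendsto_mult[OF tendsto_const this] show ?thesis
      unfolding f_def by simp
  qed
  ultimately have "integrable lborel (\<lambda>\<xi>. (norm (fourier_integral h \<xi>))\<^sup>2)"
    and eq: "(\<integral>\<xi>. (norm (fourier_integral h \<xi>))\<^sup>2 \<partial>lborel) = (L2_norm h)\<^sup>2"
    by (auto intro!: integrable_monotone_convergence[OF fint _ _ flim]
        integral_monotone_convergence[OF fint _ _ flim])
  then show "square_integrable (fourier_integral h)"
    by (simp add: square_integrable_def)
  show "L2_norm (fourier_integral h) = L2_norm h"
    unfolding L2_norm_def[of "fourier_integral h"] eq by simp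
qed

section \<open>The Fourier transform on square integrable functions\<close>

lemma has_fourier_transform_square_integrable:
  assumes "has_fourier_transform f F"
  shows "square_integrable f" "square_integrable F"
  using assms by (auto simp: has_fourier_transform_def L2_tendsto_def)

lemma has_fourier_transform_L1_L2:
  assumes "integrable lborel h" "square_integrable h"
  shows "has_fourier_transform h (fourier_integral h)"
  unfolding has_fourier_transform_def L2_tendsto_def
  using assms plancherel_L1_L2(1)[OF assms]
  by (intro exI[of _ "\<lambda>_. h"]) (simp add: L2_norm_def)

text \<open>Plancherel's identity passes to the limit along any approximating sequence. Applied to
  differences, it carries all uniqueness and norm estimates from space to frequency.\<close>

lemma has_fourier_transform_norm:
  assumes "has_fourier_transform f F"
  shows "L2_norm F = L2_norm f"
proof -
  obtain h where h: "\<And>k::nat. integrable lborel (h k)" "\<And>k. square_integrable (h k)"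
    and lim: "L2_tendsto h f sequentially" "L2_tendsto (\<lambda>k. fourier_integral (h k)) F sequentially"
    using assms unfolding has_fourier_transform_def by blast
  have "(\<lambda>k. L2_norm (h k)) \<longlonglongrightarrow> L2_norm F"
    using L2_tendsto_norm[OF lim(2)] plancherel_L1_L2(2)[OF h] by simp
  then show ?thesis
    using L2_tendsto_norm[OF lim(1)] by (rule LIMSEQ_unique)
qed

lemma has_fourier_transform_add:
  assumes "has_fourier_transform f F" "has_fourier_transform g G"
  shows "has_fourier_transform (\<lambda>x. f x + g x) (\<lambda>\<xi>. F \<xi> + G \<xi>)"
proof -
  obtain h where h: "\<And>k::nat. integrable lborel (h k)" "\<And>k. square_integrable (h k)"
    and hl: "L2_tendsto h f sequentially" "L2_tendsto (\<lambda>k. fourier_integral (h k)) F sequentially"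
    using assms(1) unfolding has_fourier_transform_def by blast
  obtain j where j: "\<And>k::nat. integrable lborel (j k)" "\<And>k. square_integrable (j k)"
    and jl: "L2_tendsto j g sequentially" "L2_tendsto (\<lambda>k. fourier_integral (j k)) G sequentially"
    using assms(2) unfolding has_fourier_transform_def by blast
  have eq: "(\<lambda>k. fourier_integral (\<lambda>x. h k x + j k x)) = (\<lambda>k \<xi>. fourier_integral (h k) \<xi> + fourier_integral (j k) \<xi>)"
    by (intro ext fourier_integral_add h(1) j(1))
  show ?thesis
    unfolding has_fourier_transform_def
  proof (intro exI conjI allI)
    show "integrable lborel (\<lambda>x. h k x + j k x)" for k
      by (intro Bochner_Integration.integrable_add h j)
    show "square_integrable (\<lambda>x. h k x + j k x)" for k
      by (intro square_integrable_add h j)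
    show "L2_tendsto (\<lambda>k x. h k x + j k x) (\<lambda>x. f x + g x) sequentially"
      by (rule L2_tendsto_add[OF hl(1) jl(1)])
    show "L2_tendsto (\<lambda>k. fourier_integral (\<lambda>x. h k x + j k x)) (\<lambda>\<xi>. F \<xi> + G \<xi>) sequentially"
      unfolding eq by (rule L2_tendsto_add[OF hl(2) jl(2)])
  qed
qed

lemma has_fourier_transform_scale:
  assumes "has_fourier_transform f F"
  shows "has_fourier_transform (\<lambda>x. c * f x) (\<lambda>\<xi>. c * F \<xi>)"
proof -
  obtain h where h: "\<And>k::nat. integrable lborel (h k)" "\<And>k. square_integrable (h k)"
    and hl: "L2_tendsto h f sequentially" "L2_tendsto (\<lambda>k. fourier_integral (h k)) F sequentially"
    using assms unfolding has_fourier_transform_def by blast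
  have eq: "(\<lambda>k. fourier_integral (\<lambda>x. c * h k x)) = (\<lambda>k \<xi>. c * fourier_integral (h k) \<xi>)"
    by (intro ext fourier_integral_scale)
  show ?thesis
    unfolding has_fourier_transform_def
  proof (intro exI conjI allI)
    show "integrable lborel (\<lambda>x. c * h k x)" for k
      by (intro integrable_mult_right h)
    show "square_integrable (\<lambda>x. c * h k x)" for k
      by (intro square_integrable_scale h)
    show "L2_tendsto (\<lambda>k x. c * h k x) (\<lambda>x. c * f x) sequentially"
      by (rule L2_tendsto_scale[OF hl(1)])
    show "L2_tendsto (\<lambda>k. fourier_integral (\<lambda>x. c * h k x)) (\<lambda>\<xi>. c * F \<xi>) sequentially"
      unfolding eq by (rule L2_tendsto_scale[OF hl(2)])
  qed
qed

lemma has_fourier_transform_diff: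
  assumes "has_fourier_transform f F" "has_fourier_transform g G"
  shows "has_fourier_transform (\<lambda>x. f x - g x) (\<lambda>\<xi>. F \<xi> - G \<xi>)"
  using has_fourier_transform_add[OF assms(1) has_fourier_transform_scale[OF assms(2), of "-1"]] by simp

lemma has_fourier_transform_affine:
  fixes f :: "'a::euclidean_space \<Rightarrow> complex"
  assumes "has_fourier_transform f F" and c: "c \<noteq> 0"
  shows "has_fourier_transform (\<lambda>x. f (t + c *\<^sub>R x))
    (\<lambda>\<xi>. of_real (1 / \<bar>c\<bar> ^ DIM('a)) * exp (\<i> * of_real (t \<bullet> \<xi> / c)) * F (\<xi> /\<^sub>R c))"
proof -
  obtain h where h: "\<And>k::nat. integrable lborel (h k)" "\<And>k. square_integrable (h k)"
    and hl: "L2_tendsto h f sequentially" "L2_tendsto (\<lambda>k. fourier_integral (h k)) F sequentially"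
    using assms(1) unfolding has_fourier_transform_def by blast
  define e where "e \<xi> = exp (\<i> * of_real (t \<bullet> \<xi> / c))" for \<xi>
  have [measurable]: "e \<in> borel_measurable borel"
    unfolding e_def by measurable
  have e: "norm (e \<xi>) = 1" for \<xi>
    by (simp add: e_def)
  have "L2_tendsto (\<lambda>k \<xi>. e \<xi> * fourier_integral (h k) (\<xi> /\<^sub>R c)) (\<lambda>\<xi>. e \<xi> * F (\<xi> /\<^sub>R c)) sequentially"
  proof -
    have aff: "L2_tendsto (\<lambda>k \<xi>. fourier_integral (h k) (\<xi> /\<^sub>R c)) (\<lambda>\<xi>. F (\<xi> /\<^sub>R c)) sequentially"
      using L2_tendsto_affine[OF hl(2), of "inverse c" 0] c by simp
    have unit: "square_integrable (\<lambda>\<xi>. e \<xi> * G \<xi>)" if G: "square_integrable G" for G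
    proof -
      note [measurable] = square_integrable_measurable[OF G]
      show ?thesis
        by (rule square_integrable_bound[OF G, of _ 1]) (auto simp: norm_mult e)
    qed
    have "L2_norm (\<lambda>\<xi>. e \<xi> * G \<xi> - e \<xi> * G' \<xi>) = L2_norm (\<lambda>\<xi>. G \<xi> - G' \<xi>)" for G G'
      by (simp add: L2_norm_def norm_mult e flip: right_diff_distrib)
    then show ?thesis
      using aff unit by (auto simp: L2_tendsto_def elim!: eventually_mono)
  qed
  from L2_tendsto_scale[OF this, of "of_real (1 / \<bar>c\<bar> ^ DIM('a))"]
  have lim2: "L2_tendsto (\<lambda>k \<xi>. of_real (1 / \<bar>c\<bar> ^ DIM('a)) * e \<xi> * fourier_integral (h k) (\<xi> /\<^sub>R c))
      (\<lambda>\<xi>. of_real (1 / \<bar>c\<bar> ^ DIM('a)) * e \<xi> * F (\<xi> /\<^sub>R c)) sequentially"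
    by (simp only: mult.assoc)
  have eq: "(\<lambda>k. fourier_integral (\<lambda>x. h k (t + c *\<^sub>R x))) =
      (\<lambda>k \<xi>. of_real (1 / \<bar>c\<bar> ^ DIM('a)) * e \<xi> * fourier_integral (h k) (\<xi> /\<^sub>R c))"
    unfolding e_def
    by (intro ext fourier_integral_affine square_integrable_measurable h c)
  show ?thesis
    unfolding has_fourier_transform_def
  proof (intro exI conjI allI)
    show "integrable lborel (\<lambda>x. h k (t + c *\<^sub>R x))" for k
      by (intro lborel_integrable_affine h c)
    show "square_integrable (\<lambda>x. h k (t + c *\<^sub>R x))" for k
      by (intro square_integrable_affine h c)
    show "L2_tendsto (\<lambda>k x. h k (t + c *\<^sub>R x)) (\<lambda>x. f (t + c *\<^sub>R x)) sequentially"
      by (rule L2_tendsto_affine[OF hl(1) c])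
    show "L2_tendsto (\<lambda>k. fourier_integral (\<lambda>x. h k (t + c *\<^sub>R x)))
        (\<lambda>\<xi>. of_real (1 / \<bar>c\<bar> ^ DIM('a)) * exp (\<i> * of_real (t \<bullet> \<xi> / c)) * F (\<xi> /\<^sub>R c)) sequentially"
      unfolding eq e_def[symmetric] by (rule lim2)
  qed
qed

lemma has_fourier_transform_reflect:
  assumes "has_fourier_transform f F"
  shows "has_fourier_transform (\<lambda>x. f (- x)) (\<lambda>\<xi>. F (- \<xi>))"
  using has_fourier_transform_affine[OF assms, of "-1" 0] by simp

lemma has_fourier_transform_cnj:
  assumes "has_fourier_transform f F"
  shows "has_fourier_transform (\<lambda>x. cnj (f x)) (\<lambda>\<xi>. cnj (F (- \<xi>)))"
proof -
  obtain h where h: "\<And>k::nat. integrable lborel (h k)" "\<And>k. square_integrable (h k)"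
    and hl: "L2_tendsto h f sequentially" "L2_tendsto (\<lambda>k. fourier_integral (h k)) F sequentially"
    using assms unfolding has_fourier_transform_def by blast
  have eq: "(\<lambda>k. fourier_integral (\<lambda>x. cnj (h k x))) = (\<lambda>k \<xi>. cnj (fourier_integral (h k) (- \<xi>)))"
    by (intro ext fourier_integral_cnj)
  show ?thesis
    unfolding has_fourier_transform_def
  proof (intro exI conjI allI)
    show "integrable lborel (\<lambda>x. cnj (h k x))" for k
      using h by simp
    show "square_integrable (\<lambda>x. cnj (h k x))" for k
      by (intro square_integrable_cnj h)
    show "L2_tendsto (\<lambda>k x. cnj (h k x)) (\<lambda>x. cnj (f x)) sequentially"
      by (rule L2_tendsto_cnj[OF hl(1)])
    show "L2_tendsto (\<lambda>k. fourier_integral (\<lambda>x. cnj (h k x))) (\<lambda>\<xi>. cnj (F (- \<xi>))) sequentially"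
      unfolding eq using L2_tendsto_cnj[OF L2_tendsto_affine[OF hl(2), of "-1" 0]] by simp
  qed
qed

lemma has_fourier_transform_cong_AE:
  assumes "has_fourier_transform f F"
    and "g \<in> borel_measurable borel" "AE x in lborel. f x = g x"
    and "G \<in> borel_measurable borel" "AE \<xi> in lborel. F \<xi> = G \<xi>"
  shows "has_fourier_transform g G"
proof -
  obtain h where h: "\<forall>k::nat. integrable lborel (h k) \<and> square_integrable (h k)"
    and hl: "L2_tendsto h f sequentially" "L2_tendsto (\<lambda>k. fourier_integral (h k)) F sequentially"
    using assms(1) unfolding has_fourier_transform_def by blast
  show ?thesis
    unfolding has_fourier_transform_def
    by (intro exI[of _ h] conjI h L2_tendsto_cong_AE[OF hl(1) assms(2,3)] L2_tendsto_cong_AE[OF hl(2) assms(4,5)])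
qed

text \<open>The isometry for the difference: one side has norm 0 exactly when the other has. Read
  from left to right the transform is single-valued, from right to left it is injective.\<close>

lemma has_fourier_transform_AE_eq_iff:
  assumes "has_fourier_transform f F" "has_fourier_transform g G"
  shows "(AE x in lborel. f x = g x) \<longleftrightarrow> (AE \<xi> in lborel. F \<xi> = G \<xi>)"
  using has_fourier_transform_norm[OF has_fourier_transform_diff[OF assms]]
    L2_norm_eq_0_iff[OF has_fourier_transform_square_integrable(1)[OF has_fourier_transform_diff[OF assms]]]
    L2_norm_eq_0_iff[OF has_fourier_transform_square_integrable(2)[OF has_fourier_transform_diff[OF assms]]]
  by simp

text \<open>Truncation to balls: the indicator of a ball is in L2, so its product with f is in L1 as
  well as in L2. The truncations converge to f, by the isometry their transforms form a Cauchy
  sequence, and completeness supplies the limit.\<close>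

lemma ex_fourier_transform:
  fixes f :: "'a::euclidean_space \<Rightarrow> complex"
  assumes f: "square_integrable f"
  obtains F where "has_fourier_transform f F"
proof -
  note [measurable] = square_integrable_measurable[OF f]
  define h where "h k x = indicator (cball 0 (real k)) x * f x" for k :: nat and x
  have ind: "square_integrable (indicator (cball 0 (real k)) :: 'a \<Rightarrow> complex)" for k
  proof -
    have "(\<lambda>x::'a. (norm (indicator (cball 0 (real k)) x :: complex))\<^sup>2) = indicator (cball 0 (real k))"
      by (auto split: split_indicator)
    moreover have "integrable lborel (indicator (cball (0::'a) (real k)) :: 'a \<Rightarrow> real)"
      by (intro integrable_real_indicator emeasure_bounded_finite) auto
    moreover have "(indicator (cball 0 (real k)) :: 'a \<Rightarrow> complex) \<in> borel_measurable borel"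
      by (intro borel_measurable_indicator) auto
    ultimately show ?thesis
      by (simp add: square_integrable_def)
  qed
  have h1: "integrable lborel (h k)" for k
    unfolding h_def by (rule square_integrable_mult[OF ind f])
  have h2: "square_integrable (h k)" for k
  proof (rule square_integrable_bound[OF f])
    show "h k \<in> borel_measurable borel"
      using borel_measurable_integrable[OF h1] by simp
    show "norm (h k x) \<le> 1 * norm (f x)" for x
      by (auto simp: h_def split: split_indicator)
  qed
  note [measurable] = square_integrable_measurable[OF h2]
  have hl: "L2_tendsto h f sequentially"
    unfolding L2_tendsto_def
  proof (intro conjI always_eventually allI h2 f)
    have "(\<lambda>k. \<integral>x. (norm (h k x - f x))\<^sup>2 \<partial>lborel) \<longlonglongrightarrow> (\<integral>x. 0 \<partial>(lborel :: 'a measure))"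
    proof (rule integral_dominated_convergence)
      show "integrable lborel (\<lambda>x. (norm (f x))\<^sup>2)"
        by (rule square_integrable_norm2[OF f])
      show "AE x in lborel. (\<lambda>k. (norm (h k x - f x))\<^sup>2) \<longlonglongrightarrow> 0"
      proof (rule AE_I2)
        fix x :: 'a
        obtain N where "norm x \<le> real N"
          using real_arch_simple by blast
        then have "\<forall>\<^sub>F k in sequentially. (norm (h k x - f x))\<^sup>2 = 0"
          by (intro eventually_sequentiallyI[of N]) (auto simp: h_def)
        then show "(\<lambda>k. (norm (h k x - f x))\<^sup>2) \<longlonglongrightarrow> 0"
          by (rule tendsto_eventually)
      qed
      show "(\<lambda>x. (norm (h k x - f x))\<^sup>2) \<in> borel_measurable lborel" for k
        by measurable
      show "AE x in lborel. norm ((norm (h k x - f x))\<^sup>2) \<le> (norm (f x))\<^sup>2" for k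
        by (rule AE_I2) (auto simp: h_def split: split_indicator)
    qed simp
    from tendsto_real_sqrt[OF this] show "(\<lambda>k. L2_norm (\<lambda>x. h k x - f x)) \<longlonglongrightarrow> 0"
      unfolding L2_norm_def by simp
  qed
  have iso: "L2_norm (\<lambda>\<xi>. fourier_integral (h m) \<xi> - fourier_integral (h n) \<xi>) = L2_norm (\<lambda>x. h m x - h n x)" for m n
    by (intro has_fourier_transform_norm has_fourier_transform_diff has_fourier_transform_L1_L2 h1 h2)
  obtain F where "L2_tendsto (\<lambda>k. fourier_integral (h k)) F sequentially"
  proof (rule L2_complete)
    show "square_integrable (fourier_integral (h k))" for k
      by (rule plancherel_L1_L2(1)[OF h1 h2])
    fix e :: real assume "e > 0"
    have "(\<lambda>k. L2_norm (\<lambda>x. h k x - f x)) \<longlonglongrightarrow> 0"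
      using hl by (simp add: L2_tendsto_def)
    from LIMSEQ_D[OF this, of "e / 2"] \<open>e > 0\<close>
    obtain N where N: "\<And>k. k \<ge> N \<Longrightarrow> L2_norm (\<lambda>x. h k x - f x) < e / 2"
      by auto
    have "L2_norm (\<lambda>\<xi>. fourier_integral (h m) \<xi> - fourier_integral (h n) \<xi>) < e" if "m \<ge> N" "n \<ge> N" for m n
      unfolding iso
      using L2_norm_triangle_diff[OF h2[of m] f h2[of n]] N[OF that(1)] N[OF that(2)]
        L2_norm_minus_commute[of f "h n"] by linarith
    then show "\<exists>N. \<forall>m\<ge>N. \<forall>n\<ge>N. L2_norm (\<lambda>\<xi>. fourier_integral (h m) \<xi> - fourier_integral (h n) \<xi>) < e"
      by (intro exI[of _ N] allI impI)
  qed
  then have "has_fourier_transform f F"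
    unfolding has_fourier_transform_def using h1 h2 hl by (intro exI[of _ h]) simp
  then show ?thesis by (rule that)
qed

section \<open>Multiplication formula, Parseval's identity and inversion\<close>

lemma has_fourier_transform_multiplication:
  assumes "has_fourier_transform f F" "has_fourier_transform g G"
  shows "(\<integral>x. F x * g x \<partial>lborel) = (\<integral>x. f x * G x \<partial>lborel)"
proof -
  obtain h where h: "\<And>k::nat. integrable lborel (h k)"
    and hl: "L2_tendsto h f sequentially" "L2_tendsto (\<lambda>k. fourier_integral (h k)) F sequentially"
    using assms(1) unfolding has_fourier_transform_def by blast
  obtain j where j: "\<And>k::nat. integrable lborel (j k)"
    and jl: "L2_tendsto j g sequentially" "L2_tendsto (\<lambda>k. fourier_integral (j k)) G sequentially"
    using assms(2) unfolding has_fourier_transform_def by blast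
  have "(\<lambda>k. \<integral>x. h k x * fourier_integral (j k) x \<partial>lborel) \<longlonglongrightarrow> (\<integral>x. F x * g x \<partial>lborel)"
    using L2_tendsto_mult[OF hl(2) jl(1)] by (simp only: fourier_integral_multiplication[OF h j])
  then show ?thesis
    using L2_tendsto_mult[OF hl(1) jl(2)] by (rule LIMSEQ_unique)
qed

text \<open>Polarisation, by which a linear isometry also preserves real parts of inner
  products.\<close>

lemma Re_L2_inner:
  assumes f: "square_integrable f" and g: "square_integrable g"
  shows "2 * Re (\<integral>x. f x * cnj (g x) \<partial>lborel) =
    (L2_norm (\<lambda>x. f x + g x))\<^sup>2 - (L2_norm f)\<^sup>2 - (L2_norm g)\<^sup>2"
proof -
  have int: "integrable lborel (\<lambda>x. f x * cnj (g x))"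
    by (rule square_integrable_mult[OF f square_integrable_cnj[OF g]])
  have "(norm (f x + g x))\<^sup>2 = ((norm (f x))\<^sup>2 + 2 * Re (f x * cnj (g x))) + (norm (g x))\<^sup>2" for x
    unfolding cmod_power2 by (simp add: power2_eq_square algebra_simps)
  then have "(L2_norm (\<lambda>x. f x + g x))\<^sup>2 =
      (\<integral>x. ((norm (f x))\<^sup>2 + 2 * Re (f x * cnj (g x))) + (norm (g x))\<^sup>2 \<partial>lborel)"
    by (simp only: L2_norm_power2)
  also have "\<dots> = (L2_norm f)\<^sup>2 + 2 * (\<integral>x. Re (f x * cnj (g x)) \<partial>lborel) + (L2_norm g)\<^sup>2"
    unfolding L2_norm_power2
    by (subst Bochner_Integration.integral_add Bochner_Integration.integral_mult_right |
        intro Bochner_Integration.integrable_add integrable_mult_right integrable_Re int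
          square_integrable_norm2 f g refl)+
  also have "(\<integral>x. Re (f x * cnj (g x)) \<partial>lborel) = Re (\<integral>x. f x * cnj (g x) \<partial>lborel)"
    by (rule integral_Re[OF int])
  finally show ?thesis by simp
qed

lemma has_fourier_transform_parseval:
  assumes "has_fourier_transform f F" "has_fourier_transform g G"
  shows "(\<integral>x. F x * cnj (G x) \<partial>lborel) = (\<integral>x. f x * cnj (g x) \<partial>lborel)"
proof -
  have Re: "Re (\<integral>x. F x * cnj (G x) \<partial>lborel) = Re (\<integral>x. f x * cnj (g x) \<partial>lborel)"
    if "has_fourier_transform f F" "has_fourier_transform g G" for f F g G
    using Re_L2_inner[of f g] Re_L2_inner[of F G]
      has_fourier_transform_square_integrable[OF that(1)] has_fourier_transform_square_integrable[OF that(2)]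
      has_fourier_transform_norm[OF that(1)] has_fourier_transform_norm[OF that(2)]
      has_fourier_transform_norm[OF has_fourier_transform_add[OF that]]
    by simp
  have mi: "(\<integral>x. f x * cnj (\<i> * g x) \<partial>lborel) = - \<i> * (\<integral>x. f x * cnj (g x) \<partial>lborel)"
    for f g :: "'a \<Rightarrow> complex"
  proof -
    have "(\<integral>x. f x * cnj (\<i> * g x) \<partial>lborel) = (\<integral>x. - \<i> * (f x * cnj (g x)) \<partial>lborel)"
      by (intro Bochner_Integration.integral_cong) simp_all
    then show ?thesis by (simp only: integral_mult_right_zero)
  qed
  \<comment> \<open>Replacing g by i g turns the imaginary part into a real part; this is why
    \<open>Re\<close> is stated for arbitrary pairs.\<close>
  have "Re (- \<i> * (\<integral>x. F x * cnj (G x) \<partial>lborel)) = Re (- \<i> * (\<integral>x. f x * cnj (g x) \<partial>lborel))"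
    using Re[OF assms(1) has_fourier_transform_scale[OF assms(2), of \<i>]] by (simp only: mi)
  then show ?thesis
    using Re[OF assms] by (simp add: complex_eq_iff)
qed

text \<open>The multiplication formula says that the transform is symmetric for the bilinear
  pairing, Parseval that it preserves the Hermitian one; comparing the two shows that
  conjugation turns the transform into its inverse.\<close>

lemma has_fourier_transform_inverse_cnj:
  assumes fF: "has_fourier_transform f F"
  shows "has_fourier_transform (\<lambda>x. cnj (F x)) (\<lambda>x. cnj (f x))"
proof -
  have f: "square_integrable f" and F: "square_integrable F"
    using has_fourier_transform_square_integrable[OF fF] .
  obtain H where H: "has_fourier_transform (\<lambda>x. cnj (F x)) H"
    using ex_fourier_transform[OF square_integrable_cnj[OF F]] .
  have sH: "square_integrable H"
    using has_fourier_transform_square_integrable(2)[OF H] .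
  \<comment> \<open>The defect between the actual transform of \<open>cnj F\<close> and the expected
    one. It is tested against its own conjugate, so that the pairing becomes its squared
    norm.\<close>
  define d where "d x = H x - cnj (f x)" for x
  have d: "square_integrable d"
    unfolding d_def by (intro square_integrable_diff sH square_integrable_cnj f)
  have sg: "square_integrable (\<lambda>x. cnj (d x))"
    by (rule square_integrable_cnj[OF d])
  obtain G where G: "has_fourier_transform (\<lambda>x. cnj (d x)) G"
    using ex_fourier_transform[OF sg] .
  \<comment> \<open>Both sides equal the integral of G times \<open>cnj F\<close>: the left one by
    the multiplication formula, the right one by Parseval.\<close>
  have "(\<integral>x. cnj (d x) * H x \<partial>lborel) = (\<integral>x. cnj (d x) * cnj (f x) \<partial>lborel)"
    using has_fourier_transform_multiplication[OF G H] has_fourier_transform_parseval[OF G fF] by simp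
  then have "(\<integral>x. cnj (d x) * H x - cnj (d x) * cnj (f x) \<partial>lborel) = 0"
    using square_integrable_mult[OF sg sH] square_integrable_mult[OF sg square_integrable_cnj[OF f]]
    by simp
  moreover have "cnj (d x) * H x - cnj (d x) * cnj (f x) = of_real ((norm (d x))\<^sup>2)" for x
    unfolding complex_norm_square by (simp add: d_def algebra_simps)
  ultimately have "(\<integral>x. (norm (d x))\<^sup>2 \<partial>lborel) = 0"
    by (simp only: integral_complex_of_real of_real_eq_0_iff)
  then have "AE x in lborel. d x = 0"
    using L2_norm_eq_0_iff[OF d] by (simp add: L2_norm_def)
  then have "AE x in lborel. H x = cnj (f x)"
    by eventually_elim (simp add: d_def)
  then show ?thesis
    using square_integrable_measurable[OF square_integrable_cnj[OF f]]
      square_integrable_measurable[OF square_integrable_cnj[OF F]]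
    by (intro has_fourier_transform_cong_AE[OF H]) auto
qed

text \<open>Conjugating the pair of the previous result; conjugation reflects the frequency
  variable, which is the source of the minus sign.\<close>

theorem has_fourier_transform_inversion:
  assumes "has_fourier_transform f F"
  shows "has_fourier_transform F (\<lambda>x. f (- x))"
  using has_fourier_transform_cnj[OF has_fourier_transform_inverse_cnj[OF assms]] by simp

text \<open>If F has transform G, then G transforms to the reflection of F, so the reflection of G
  is a preimage of F.\<close>

lemma ex_inverse_fourier_transform:
  assumes "square_integrable F"
  obtains f where "has_fourier_transform f F"
proof -
  obtain G where "has_fourier_transform F G"
    using ex_fourier_transform[OF assms] .
  from has_fourier_transform_reflect[OF has_fourier_transform_inversion[OF this]] show ?thesis
    by (intro that) simp
qed

section \<open>Bounds for the Mittag-Leffler function\<close>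

lemma Gamma_plus1_pos: "0 < s \<Longrightarrow> Gamma (s + 1) = s * Gamma (s :: real)"
  by (intro Gamma_plus1) (auto dest: nonpos_Ints_nonpos)

text \<open>Log-convexity of Gamma between s + gamma and s + gamma + 1, whose convex combination
  with weights gamma and 1 - gamma is s + 1. The recursion reduces the outer values to Gamma(s) and
  Gamma(s + gamma).\<close>

lemma Gamma_quotient_le:
  fixes s \<gamma> :: real
  assumes s: "0 < s" and \<gamma>: "0 < \<gamma>" "\<gamma> < 1"
  shows "Gamma s / Gamma (s + \<gamma>) \<le> (s + \<gamma>) powr (1 - \<gamma>) / s"
proof -
  have G: "Gamma (s + \<gamma>) > 0" "Gamma s > 0" using s \<gamma> by auto
  have "(ln \<circ> Gamma) ((1 - (1 - \<gamma>)) *\<^sub>R (s + \<gamma>) + (1 - \<gamma>) *\<^sub>R (s + \<gamma> + 1)) \<le>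
      (1 - (1 - \<gamma>)) * (ln \<circ> Gamma) (s + \<gamma>) + (1 - \<gamma>) * (ln \<circ> Gamma) (s + \<gamma> + 1)"
    by (rule convex_onD[OF log_convex_Gamma_real]) (use s \<gamma> in auto)
  also have "(1 - (1 - \<gamma>)) *\<^sub>R (s + \<gamma>) + (1 - \<gamma>) *\<^sub>R (s + \<gamma> + 1) = s + 1"
    by (simp add: algebra_simps)
  finally have "ln (Gamma (s + 1)) \<le> \<gamma> * ln (Gamma (s + \<gamma>)) + (1 - \<gamma>) * ln (Gamma (s + \<gamma> + 1))"
    by simp
  moreover have "ln (Gamma (s + 1)) = ln s + ln (Gamma s)"
    "ln (Gamma (s + \<gamma> + 1)) = ln (s + \<gamma>) + ln (Gamma (s + \<gamma>))"
    using s \<gamma> G by (simp_all add: Gamma_plus1_pos ln_mult_pos)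
  ultimately have "ln s + ln (Gamma s) \<le>
      \<gamma> * ln (Gamma (s + \<gamma>)) + (1 - \<gamma>) * (ln (s + \<gamma>) + ln (Gamma (s + \<gamma>)))"
    by (simp only:)
  then have "ln s + ln (Gamma s) \<le> (1 - \<gamma>) * ln (s + \<gamma>) + ln (Gamma (s + \<gamma>))"
    by (simp add: algebra_simps)
  then have "exp (ln s + ln (Gamma s)) \<le> exp ((1 - \<gamma>) * ln (s + \<gamma>) + ln (Gamma (s + \<gamma>)))"
    by simp
  then have "s * Gamma s \<le> (s + \<gamma>) powr (1 - \<gamma>) * Gamma (s + \<gamma>)"
    using s \<gamma> G by (simp add: exp_add powr_def)
  then show ?thesis
    using s G by (simp add: field_simps)
qed

lemma Gamma_quotient_tendsto_0:
  assumes \<gamma>: "0 < \<gamma>" "\<gamma> < (1::real)"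
  shows "(\<lambda>k. Gamma (\<gamma> * real k + 1) / Gamma (\<gamma> * real (Suc k) + 1)) \<longlonglongrightarrow> 0"
proof (rule Lim_null_comparison)
  have lim: "filterlim (\<lambda>k. \<gamma> * real k + 1) at_top sequentially"
    unfolding add.commute[of _ 1]
    using \<gamma> by (intro filterlim_tendsto_add_at_top[OF tendsto_const]
        filterlim_tendsto_pos_mult_at_top[OF tendsto_const] filterlim_real_sequentially)
  have "(\<lambda>k. 2 * (\<gamma> * real k + 1) powr (- \<gamma>)) \<longlonglongrightarrow> 2 * 0"
    using \<gamma> lim by (intro tendsto_mult tendsto_const tendsto_neg_powr) auto
  then show "(\<lambda>k. 2 * (\<gamma> * real k + 1) powr (- \<gamma>)) \<longlonglongrightarrow> 0"
    by simp
  show "\<forall>\<^sub>F k in sequentially. norm (Gamma (\<gamma> * real k + 1) / Gamma (\<gamma> * real (Suc k) + 1)) \<le>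
      2 * (\<gamma> * real k + 1) powr (- \<gamma>)"
  proof (rule always_eventually, rule allI)
    fix k
    define s where "s = \<gamma> * real k + 1"
    have s: "s \<ge> 1" using \<gamma> by (simp add: s_def)
    have e: "\<gamma> * real (Suc k) + 1 = s + \<gamma>" by (simp add: s_def algebra_simps)
    have "Gamma s / Gamma (s + \<gamma>) \<le> (s + \<gamma>) powr (1 - \<gamma>) / s"
      using s \<gamma> by (intro Gamma_quotient_le) auto
    \<comment> \<open>Here s >= 1 and gamma < 1, so s + gamma <= 2 s.\<close>
    also have "\<dots> \<le> (2 * s) powr (1 - \<gamma>) / s"
      using s \<gamma> by (intro divide_right_mono powr_mono2) auto
    also have "\<dots> = 2 powr (1 - \<gamma>) * s powr (- \<gamma>)"
      using s by (simp add: powr_mult powr_diff powr_minus field_simps)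
    also have "\<dots> \<le> 2 powr 1 * s powr (- \<gamma>)"
      using \<gamma> by (intro mult_right_mono powr_mono) auto
    finally have "Gamma s / Gamma (s + \<gamma>) \<le> 2 * s powr (- \<gamma>)"
      by simp
    then show "norm (Gamma (\<gamma> * real k + 1) / Gamma (\<gamma> * real (Suc k) + 1)) \<le> 2 * (\<gamma> * real k + 1) powr (- \<gamma>)"
      unfolding e s_def[symmetric] using s \<gamma> by (simp add: less_imp_le)
  qed
qed

text \<open>Ratio test, the quotient of consecutive Gamma values tending to 0. The weight k is there
  because 1 - y^k <= k (1 - y) is the tail estimate in the extremum argument.\<close>

lemma mittag_leffler_summable_deriv:
  assumes \<gamma>: "0 < \<gamma>" "\<gamma> < (1::real)"
  shows "summable (\<lambda>k. norm (real k * (z ^ k / Gamma (\<gamma> * real k + 1))))"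
proof -
  define q where "q k = Gamma (\<gamma> * real k + 1) / Gamma (\<gamma> * real (Suc k) + 1)" for k
  \<comment> \<open>The factor 2 absorbs the growth of the weight, Suc k <= 2 k for k >= 1.\<close>
  have "(\<lambda>k. 2 * \<bar>z\<bar> * q k) \<longlonglongrightarrow> 2 * \<bar>z\<bar> * 0"
    unfolding q_def by (intro tendsto_mult tendsto_const Gamma_quotient_tendsto_0 \<gamma>)
  then have "\<forall>\<^sub>F k in sequentially. 2 * \<bar>z\<bar> * q k < 1/2"
    by (rule order_tendstoD) simp
  then obtain N where N: "\<And>k. k \<ge> N \<Longrightarrow> 2 * \<bar>z\<bar> * q k < 1/2"
    by (auto simp: eventually_sequentially)
  show ?thesis
  proof (rule summable_ratio_test)
    show "1 / 2 < (1::real)" by simp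
    fix k assume k: "max N 1 \<le> k"
    have pos: "Gamma (\<gamma> * real k + 1) > 0" "Gamma (\<gamma> * real (Suc k) + 1) > 0"
      using \<gamma> by (auto intro!: Gamma_real_pos add_nonneg_pos)
    then have q: "q k \<ge> 0" by (simp add: q_def)
    have "norm (norm (real (Suc k) * (z ^ Suc k / Gamma (\<gamma> * real (Suc k) + 1)))) =
        real (Suc k) * \<bar>z\<bar> * q k * (\<bar>z\<bar> ^ k / Gamma (\<gamma> * real k + 1))"
      using pos by (simp add: q_def abs_mult power_abs)
    also have "\<dots> \<le> (2 * real k) * \<bar>z\<bar> * q k * (\<bar>z\<bar> ^ k / Gamma (\<gamma> * real k + 1))"
      using k q pos by (intro mult_right_mono) auto
    also have "\<dots> = (2 * \<bar>z\<bar> * q k) * (real k * (\<bar>z\<bar> ^ k / Gamma (\<gamma> * real k + 1)))"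
      by (simp only: mult_ac)
    also have "\<dots> \<le> (1/2) * (real k * (\<bar>z\<bar> ^ k / Gamma (\<gamma> * real k + 1)))"
      using N[of k] k pos by (intro mult_right_mono) auto
    finally show "norm (norm (real (Suc k) * (z ^ Suc k / Gamma (\<gamma> * real (Suc k) + 1)))) \<le>
        1 / 2 * norm (norm (real k * (z ^ k / Gamma (\<gamma> * real k + 1))))"
      using pos by (simp add: abs_mult power_abs)
  qed
qed

lemma mittag_leffler_summable:
  assumes \<gamma>: "0 < \<gamma>" "\<gamma> < (1::real)"
  shows "summable (\<lambda>k. z ^ k / Gamma (\<gamma> * real k + 1))"
proof (rule summable_comparison_test[OF _ mittag_leffler_summable_deriv[OF \<gamma>, of z]])
  have "norm a \<le> norm (real k * a)" if "1 \<le> k" for k and a :: real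
    using mult_right_mono[of 1 "real k" "norm a"] that by (simp add: abs_mult)
  then show "\<exists>N. \<forall>k\<ge>N. norm (z ^ k / Gamma (\<gamma> * real k + 1)) \<le>
      norm (real k * (z ^ k / Gamma (\<gamma> * real k + 1)))"
    by (intro exI[of _ 1] allI impI)
qed

lemma mittag_leffler_sums:
  assumes \<gamma>: "0 < \<gamma>" "\<gamma> < (1::real)"
  shows "(\<lambda>k. z ^ k / Gamma (\<gamma> * real k + 1)) sums mittag_leffler \<gamma> 1 z"
  unfolding mittag_leffler_def by (rule summable_sums[OF mittag_leffler_summable[OF \<gamma>]])

lemma isCont_mittag_leffler:
  assumes \<gamma>: "0 < \<gamma>" "\<gamma> < (1::real)"
  shows "isCont (mittag_leffler \<gamma> 1) z"
proof -
  have "isCont (\<lambda>z. \<Sum>k. (1 / Gamma (\<gamma> * real k + 1)) * z ^ k) z"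
    using mittag_leffler_summable[OF \<gamma>] by (intro isCont_powser_converges_everywhere) simp
  then show ?thesis
    by (simp add: mittag_leffler_def[abs_def])
qed

lemma mittag_leffler_0 [simp]: "mittag_leffler \<gamma> 1 0 = 1"
  unfolding mittag_leffler_def
  by (subst suminf_finite[of "{0}"]) (auto simp: power_0_left)

text \<open>Integration by parts turns the Marchaud-type kernel $\gamma (1-q)^{-\gamma-1}$ applied to
  $1 - q^a$ into a Beta integral; the boundary term at $q = 1$ vanishes because $\gamma < 1$.\<close>

lemma marchaud_monomial:
  fixes a \<gamma> :: real
  assumes a: "0 < a" and \<gamma>: "0 < \<gamma>" "\<gamma> < 1"
  shows "((\<lambda>q. \<gamma> * (1 - q) powr (- \<gamma> - 1) * (1 - q powr a)) has_integral a * Beta a (1 - \<gamma>) - 1) {0..1}"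
proof -
  \<comment> \<open>The boundary term of the integration by parts. Its derivative \<open>G'\<close>
    is the wanted integrand minus a times the Beta integrand; G falls from 1 at q = 0 to 0 at q = 1,
    which gives the -1 in the value.\<close>
  define G where "G q = (1 - q) powr (- \<gamma>) * (1 - q powr a)" for q
  define G' where "G' q = \<gamma> * (1 - q) powr (- \<gamma> - 1) * (1 - q powr a) -
      a * (q powr (a - 1) * (1 - q) powr ((1 - \<gamma>) - 1))" for q
  have der: "(G has_real_derivative G' q) (at q)" if "q \<in> {0<..<1}" for q
    unfolding G_def G'_def using that
    by (auto intro!: derivative_eq_intros simp: algebra_simps powr_diff powr_minus divide_simps)
  \<comment> \<open>Near 1, G is (1-q)^(1-gamma) times the difference quotient of q^a at 1. The
    quotient tends to a and the power tends to 0.\<close>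
  have lim1: "(G \<longlongrightarrow> 0) (at_left 1)"
  proof -
    have "((\<lambda>q. q powr a) has_real_derivative a) (at 1)"
      by (auto intro!: derivative_eq_intros)
    then have "((\<lambda>q. (q powr a - 1 powr a) / (q - 1)) \<longlongrightarrow> a) (at 1)"
      by (simp add: has_field_derivative_iff)
    then have d: "((\<lambda>q. (q powr a - 1) / (q - 1)) \<longlongrightarrow> a) (at_left 1)"
      by (simp add: filterlim_at_split)
    have "((\<lambda>q::real. 1 - q) \<longlongrightarrow> 1 - 1) (at_left 1)"
      by (intro tendsto_intros)
    moreover have "\<forall>\<^sub>F q::real in at_left 1. 0 < 1 - q"
      by (auto simp: eventually_at_filter)
    ultimately have "((\<lambda>q::real. (1 - q) powr (1 - \<gamma>)) \<longlongrightarrow> 0 powr (1 - \<gamma>)) (at_left 1)"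
      using \<gamma> by (intro tendsto_powr2) (auto elim: eventually_mono)
    from tendsto_mult[OF this d]
    have "((\<lambda>q. (1 - q) powr (1 - \<gamma>) * ((q powr a - 1) / (q - 1))) \<longlongrightarrow> 0) (at_left 1)"
      using \<gamma> by simp
    moreover have "\<forall>\<^sub>F q in at_left 1. (1 - q) powr (1 - \<gamma>) * ((q powr a - 1) / (q - 1)) = G q"
      unfolding G_def eventually_at_filter
      by (auto intro!: always_eventually simp: powr_diff powr_minus divide_simps) (simp add: algebra_simps)
    ultimately show ?thesis
      by (rule Lim_transform_eventually)
  qed
  have "continuous_on {0..1} G"
    unfolding continuous_on_eq_continuous_within
  proof
    fix q :: real assume q: "q \<in> {0..1}"
    show "continuous (at q within {0..1}) G"
    proof (cases "q = 1")
      case True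
      then show ?thesis
        using lim1 by (simp add: continuous_within G_def at_within_Icc_at_left)
    next
      case False
      have "((\<lambda>q. (1 - q) powr (- \<gamma>) * (1 - q powr a)) \<longlongrightarrow> (1 - q) powr (- \<gamma>) * (1 - q powr a)) (at q within {0..1})"
      proof (intro tendsto_mult tendsto_diff tendsto_const)
        show "((\<lambda>q. (1 - q) powr (- \<gamma>)) \<longlongrightarrow> (1 - q) powr (- \<gamma>)) (at q within {0..1})"
          using False by (intro tendsto_powr tendsto_intros) auto
        show "((\<lambda>q. q powr a) \<longlongrightarrow> q powr a) (at q within {0..1})"
          using a by (intro tendsto_powr2 tendsto_intros) (auto simp: eventually_at_filter)
      qed
      then show ?thesis
        unfolding continuous_within G_def .
    qed
  qed
  \<comment> \<open>This form of the fundamental theorem asks for continuity on the closed interval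
    and for the derivative only inside, so \<open>G'\<close> may be unbounded near the
    endpoints.\<close>
  then have "(G' has_integral (G 1 - G 0)) {0..1}"
    using der by (intro fundamental_theorem_of_calculus_interior)
      (auto simp: has_real_derivative_iff_has_vector_derivative)
  then have "(G' has_integral - 1) {0..1}"
    using a by (simp add: G_def)
  from has_integral_add[OF this has_integral_mult_right[OF has_integral_Beta_real[OF a, of "1 - \<gamma>"], of a]]
  show ?thesis
    using \<gamma> by (simp add: G'_def)
qed

text \<open>With $u(q) = E_\gamma(-x q^\gamma)$ the kernel integral of $u(1) - u(q)$ is evaluated term by
  term and equals $1 - (1 + \Gamma(1-\gamma) x) u(1)$. At an extremum of $u$ over $[0,1]$ attained
  at $q = 1$ the integrand has a sign.\<close>

lemma mittag_leffler_extremum: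
  fixes \<gamma> x \<sigma> :: real
  assumes \<gamma>: "0 < \<gamma>" "\<gamma> < 1" and x: "0 \<le> x"
    and ext: "\<And>y. 0 \<le> y \<Longrightarrow> y \<le> x \<Longrightarrow> \<sigma> * mittag_leffler \<gamma> 1 (- x) \<le> \<sigma> * mittag_leffler \<gamma> 1 (- y)"
  shows "\<sigma> \<le> \<sigma> * ((1 + Gamma (1 - \<gamma>) * x) * mittag_leffler \<gamma> 1 (- x))"
proof -
  define u where "u = mittag_leffler \<gamma> 1 (- x)"
  define c where "c k = (- x) ^ k / Gamma (\<gamma> * real k + 1)" for k
  \<comment> \<open>For k = 0 the integrand is identically 0, whereas the Beta formula applies only
    to a positive exponent.\<close>
  define J where "J k = (if k = 0 then 0 else \<gamma> * real k * Beta (\<gamma> * real k) (1 - \<gamma>) - 1)" for k :: nat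
  define \<kappa> where "\<kappa> k q = \<gamma> * (1 - q) powr (- \<gamma> - 1) * (1 - (q powr \<gamma>) ^ k)" for k :: nat and q
  have csum: "c sums u"
    using mittag_leffler_sums[OF \<gamma>, of "-x"] by (simp add: c_def[abs_def] u_def)
  have J: "(\<kappa> k has_integral J k) {0..1}" for k
  proof (cases "k = 0")
    case True
    then show ?thesis by (simp add: \<kappa>_def[abs_def] J_def)
  next
    case False
    have "((\<lambda>q. \<gamma> * (1 - q) powr (- \<gamma> - 1) * (1 - q powr (\<gamma> * real k))) has_integral J k) {0..1}"
      using marchaud_monomial[of "\<gamma> * real k" \<gamma>] False \<gamma> by (simp add: J_def)
    moreover have "q powr (\<gamma> * real k) = (q powr \<gamma>) ^ k" for q
      using False by (cases "q = 0") (simp_all add: powr_powr[symmetric] powr_realpow)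
    ultimately show ?thesis
      by (simp add: \<kappa>_def[abs_def])
  qed
  \<comment> \<open>With a = gamma (k+1), Gamma(a+1) = a Gamma(a) cancels the denominator of the
    coefficient, and a + (1 - gamma) = gamma k + 1 produces that of the previous one. This index
    shift is the termwise form of D u = -x u.\<close>
  have cJ: "c (Suc k) * J (Suc k) = - (Gamma (1 - \<gamma>) * x) * c k - c (Suc k)" for k
  proof -
    define a where "a = \<gamma> * real (Suc k)"
    have a: "a > 0" "a + (1 - \<gamma>) = \<gamma> * real k + 1"
      using \<gamma> by (simp_all add: a_def algebra_simps add_pos_nonneg)
    have nz: "Gamma a \<noteq> 0"
      using Gamma_real_pos[OF a(1)] by linarith
    have "c (Suc k) * (a * Beta a (1 - \<gamma>)) = - (Gamma (1 - \<gamma>) * x) * c k"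
      using a(1) nz unfolding c_def a_def[symmetric] Beta_def a(2) Gamma_plus1_pos[OF a(1)] by simp
    then show ?thesis
      by (simp add: J_def a_def right_diff_distrib)
  qed
  have "(\<lambda>k. - (Gamma (1 - \<gamma>) * x) * c k - c (Suc k)) sums (- (Gamma (1 - \<gamma>) * x) * u - (u - c 0))"
    using csum by (intro sums_diff sums_mult) (simp_all add: sums_Suc_iff)
  then have "(\<lambda>k. c (Suc k) * J (Suc k)) sums (- (Gamma (1 - \<gamma>) * x) * u - (u - 1))"
    by (simp only: cJ) (simp add: c_def)
  then have DJ: "(\<lambda>k. c k * J k) sums (1 - (1 + Gamma (1 - \<gamma>) * x) * u)"
    by (subst (asm) sums_Suc_iff) (simp add: J_def algebra_simps)
  \<comment> \<open>Tails of the weighted coefficient series; they control the truncation error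
    uniformly in q.\<close>
  define R where "R N = (\<Sum>k. real (k + N) * \<bar>c (k + N)\<bar>)" for N
  have absum: "summable (\<lambda>k. real k * \<bar>c k\<bar>)"
    using mittag_leffler_summable_deriv[OF \<gamma>, of "-x"] by (simp add: c_def abs_mult)
  \<comment> \<open>The integrand has its sign only for the full series, so only partial sums are
    integrated. Each differs from the full sum by at most \<open>R N\<close> (1 - y), and the kernel
    times 1 - y is the integrable function \<open>\<kappa> 1\<close>, so the error integrates to at
    most \<open>R N * J 1\<close>.\<close>
  have part: "(\<Sum>k<N. c k * J k) * \<sigma> \<le> R N * J 1 * \<bar>\<sigma>\<bar>" for N
  proof (rule has_integral_le)
    show "((\<lambda>q. (\<Sum>k<N. c k * \<kappa> k q) * \<sigma>) has_integral (\<Sum>k<N. c k * J k) * \<sigma>) {0..1}"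
      by (intro has_integral_mult_left has_integral_sum has_integral_mult_right J) auto
    show "((\<lambda>q. R N * \<kappa> 1 q * \<bar>\<sigma>\<bar>) has_integral R N * J 1 * \<bar>\<sigma>\<bar>) {0..1}"
      by (intro has_integral_mult_left has_integral_mult_right J)
    fix q :: real assume q: "q \<in> {0..1}"
    define y where "y = q powr \<gamma>"
    have y: "0 \<le> y" "y \<le> 1"
      using q \<gamma> by (auto simp: y_def powr_le_one_le intro: powr_le1)
    define \<omega> where "\<omega> = \<gamma> * (1 - q) powr (- \<gamma> - 1)"
    have \<omega>: "\<omega> \<ge> 0" using \<gamma> by (simp add: \<omega>_def)
    have \<kappa>: "\<kappa> k q = \<omega> * (1 - y ^ k)" for k
      by (simp add: \<kappa>_def y_def \<omega>_def)
    have "c k * y ^ k = (- (x * y)) ^ k / Gamma (\<gamma> * real k + 1)" for k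
      by (simp add: c_def flip: power_mult_distrib)
    then have "(\<lambda>k. c k * y ^ k) sums mittag_leffler \<gamma> 1 (- (x * y))"
      using mittag_leffler_sums[OF \<gamma>, of "- (x * y)"] by (simp only:)
    from sums_diff[OF csum this]
    have s: "(\<lambda>k. c k * (1 - y ^ k)) sums (u - mittag_leffler \<gamma> 1 (- (x * y)))"
      by (simp add: right_diff_distrib)
    have "(\<Sum>k<N. c k * (1 - y ^ k)) + (\<Sum>k. c (k + N) * (1 - y ^ (k + N))) = u - mittag_leffler \<gamma> 1 (- (x * y))"
      using suminf_split_initial_segment[OF sums_summable[OF s], of N] sums_unique[OF s] by simp
    then have S: "(\<Sum>k<N. c k * (1 - y ^ k)) =
        u - mittag_leffler \<gamma> 1 (- (x * y)) - (\<Sum>k. c (k + N) * (1 - y ^ (k + N)))"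
      by linarith
    have "(\<Sum>k<N. c k * (1 - y ^ k)) * \<sigma> =
        \<sigma> * u - \<sigma> * mittag_leffler \<gamma> 1 (- (x * y)) - \<sigma> * (\<Sum>k. c (k + N) * (1 - y ^ (k + N)))"
      unfolding S by (simp only: right_diff_distrib mult.commute[of _ \<sigma>])
    \<comment> \<open>Extremality at the point x y, which lies in [0, x], discards the first two
      terms.\<close>
    also have "\<dots> \<le> - \<sigma> * (\<Sum>k. c (k + N) * (1 - y ^ (k + N)))"
      using ext[of "x * y"] x y by (simp add: u_def mult_left_le)
    also have "\<dots> \<le> \<bar>\<sigma>\<bar> * \<bar>\<Sum>k. c (k + N) * (1 - y ^ (k + N))\<bar>"
      by (simp flip: abs_mult)
    also have "\<bar>\<Sum>k. c (k + N) * (1 - y ^ (k + N))\<bar> \<le> R N * (1 - y)"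
    proof -
      have le: "\<bar>c k * (1 - y ^ k)\<bar> \<le> real k * \<bar>c k\<bar> * (1 - y)" for k
      proof -
        \<comment> \<open>Bernoulli's inequality supplies the factor 1 - y that cancels the kernel's
          singularity at q = 1.\<close>
        have "1 - y ^ k \<le> real k * (1 - y)"
          using Bernoulli_inequality[of "y - 1" k] y by (simp add: algebra_simps)
        then have "\<bar>c k\<bar> * (1 - y ^ k) \<le> \<bar>c k\<bar> * (real k * (1 - y))"
          by (rule mult_left_mono) simp
        moreover have "0 \<le> 1 - y ^ k"
          using y by (simp add: power_le_one)
        ultimately show ?thesis
          by (simp only: abs_mult abs_of_nonneg mult_ac)
      qed
      have sm: "summable (\<lambda>k. real (k + N) * \<bar>c (k + N)\<bar> * (1 - y))"
        by (intro summable_mult2 summable_ignore_initial_segment[OF absum])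
      have "norm (\<Sum>k. c (k + N) * (1 - y ^ (k + N))) \<le> (\<Sum>k. real (k + N) * \<bar>c (k + N)\<bar> * (1 - y))"
        by (rule norm_suminf_le[OF _ sm]) (simp only: real_norm_def le)
      also have "\<dots> = R N * (1 - y)"
        unfolding R_def by (rule suminf_mult2[symmetric, OF summable_ignore_initial_segment[OF absum]])
      finally show ?thesis by simp
    qed
    finally have "(\<Sum>k<N. c k * (1 - y ^ k)) * \<sigma> \<le> \<bar>\<sigma>\<bar> * (R N * (1 - y))"
      by (simp add: mult_left_mono)
    from mult_left_mono[OF this \<omega>]
    show "(\<Sum>k<N. c k * \<kappa> k q) * \<sigma> \<le> R N * \<kappa> 1 q * \<bar>\<sigma>\<bar>"
      by (simp add: \<kappa> sum_distrib_left sum_distrib_right mult_ac)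
  qed
  have "(\<lambda>N. (\<Sum>k<N. c k * J k) * \<sigma>) \<longlonglongrightarrow> (1 - (1 + Gamma (1 - \<gamma>) * x) * u) * \<sigma>"
    using DJ unfolding sums_def by (intro tendsto_mult tendsto_const)
  moreover have "R \<longlonglongrightarrow> 0"
    unfolding R_def using suminf_exist_split2[OF absum] by simp
  then have "(\<lambda>N. R N * J 1 * \<bar>\<sigma>\<bar>) \<longlonglongrightarrow> 0 * J 1 * \<bar>\<sigma>\<bar>"
    by (intro tendsto_mult tendsto_const)
  ultimately have "(1 - (1 + Gamma (1 - \<gamma>) * x) * u) * \<sigma> \<le> 0 * J 1 * \<bar>\<sigma>\<bar>"
    by (rule LIMSEQ_le) (use part in auto)
  then show ?thesis
    unfolding u_def by (simp add: algebra_simps)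
qed

text \<open>The comparison concerns an extremum at the right end of an interval, so it is applied on
  [0, m] and [0, M] with m a minimiser and M a maximiser over [0, x]. With sign 1 it bounds the
  minimum from below, and 1 / (1 + Gamma(1-gamma) y) decreases in y, so the bound at m implies the
  one at x. With sign -1 a maximum above 1 would contradict (1 + Gamma(1-gamma) M) E(-M) <=
  1.\<close>

theorem mittag_leffler_bounds:
  fixes \<gamma> x :: real
  assumes \<gamma>: "0 < \<gamma>" "\<gamma> < 1" and x: "0 \<le> x"
  shows "1 / (1 + Gamma (1 - \<gamma>) * x) \<le> mittag_leffler \<gamma> 1 (- x)" and "mittag_leffler \<gamma> 1 (- x) \<le> 1"
proof -
  have G: "Gamma (1 - \<gamma>) > 0" using \<gamma> by simp
  have cont: "continuous_on {0..x} (\<lambda>y. mittag_leffler \<gamma> 1 (- y))"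
    by (intro continuous_at_imp_continuous_on ballI isCont_o2[OF _ isCont_mittag_leffler[OF \<gamma>]]) auto
  obtain m where m: "m \<in> {0..x}" "\<And>y. y \<in> {0..x} \<Longrightarrow> mittag_leffler \<gamma> 1 (- m) \<le> mittag_leffler \<gamma> 1 (- y)"
    using continuous_attains_inf[OF compact_Icc _ cont] x by auto
  have "1 \<le> (1 + Gamma (1 - \<gamma>) * m) * mittag_leffler \<gamma> 1 (- m)"
    using mittag_leffler_extremum[OF \<gamma>, of m 1] m by simp
  moreover have "1 + Gamma (1 - \<gamma>) * m > 0"
    using G m by (simp add: add_pos_nonneg)
  ultimately have "1 / (1 + Gamma (1 - \<gamma>) * m) \<le> mittag_leffler \<gamma> 1 (- m)"
    by (simp add: pos_divide_le_eq mult.commute)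
  moreover have "1 / (1 + Gamma (1 - \<gamma>) * x) \<le> 1 / (1 + Gamma (1 - \<gamma>) * m)"
    using G m by (intro divide_left_mono) (auto intro!: mult_pos_pos add_pos_nonneg)
  ultimately show "1 / (1 + Gamma (1 - \<gamma>) * x) \<le> mittag_leffler \<gamma> 1 (- x)"
    using m(2)[of x] x by simp
  obtain M where M: "M \<in> {0..x}" "\<And>y. y \<in> {0..x} \<Longrightarrow> mittag_leffler \<gamma> 1 (- y) \<le> mittag_leffler \<gamma> 1 (- M)"
    using continuous_attains_sup[OF compact_Icc _ cont] x by auto
  have le: "(1 + Gamma (1 - \<gamma>) * M) * mittag_leffler \<gamma> 1 (- M) \<le> 1"
    using mittag_leffler_extremum[OF \<gamma>, of M "-1"] M by simp
  have "mittag_leffler \<gamma> 1 (- M) \<le> 1"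
  proof (rule ccontr)
    assume "\<not> ?thesis"
    then have "1 < mittag_leffler \<gamma> 1 (- M)" by simp
    moreover have "1 * mittag_leffler \<gamma> 1 (- M) \<le> (1 + Gamma (1 - \<gamma>) * M) * mittag_leffler \<gamma> 1 (- M)"
      using calculation G M by (intro mult_right_mono) auto
    ultimately show False using le by linarith
  qed
  then show "mittag_leffler \<gamma> 1 (- x) \<le> 1"
    using M(2)[of x] x by simp
qed

section \<open>The regularization method\<close>

text \<open>The inversion formula writes \<open>g\<close> itself as a Fourier transform, so that by the
  multiplication formula the convolution is, pointwise, a Fourier integral.\<close>

lemma has_fourier_transform_mollify:
  fixes \<phi> g :: "'a::euclidean_space \<Rightarrow> complex"
  assumes \<phi>: "has_fourier_transform \<phi> \<Phi>" and bound: "\<And>\<xi>. norm (\<Phi> \<xi>) \<le> C"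
    and \<alpha>: "0 < \<alpha>" and g: "has_fourier_transform g G"
  shows "has_fourier_transform (mollify \<phi> \<alpha> g)
    (\<lambda>\<xi>. of_real ((2 * pi) powr (real DIM('a) / 2)) * \<Phi> (\<alpha> *\<^sub>R \<xi>) * G \<xi>)"
proof -
  \<comment> \<open>The constant of the convolution theorem for this normalization of the transform;
    the factor (2 pi)^(-n/2) in the transform of the mollifier cancels it later.\<close>
  define c where "c = (2 * pi) powr (real DIM('a) / 2)"
  define p where "p \<xi> = G (- \<xi>)" for \<xi>
  define \<Psi> where "\<Psi> \<xi> = \<Phi> (- (\<alpha> *\<^sub>R \<xi>))" for \<xi>
  have p: "has_fourier_transform p g"
    using has_fourier_transform_reflect[OF has_fourier_transform_inversion[OF g]] by (simp add: p_def[abs_def])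
  have sp: "square_integrable p"
    using has_fourier_transform_square_integrable(1)[OF p] .
  have s\<Psi>: "square_integrable \<Psi>"
    using square_integrable_affine[OF has_fourier_transform_square_integrable(2)[OF \<phi>], of "- \<alpha>" 0] \<alpha>
    by (simp add: \<Psi>_def[abs_def])
  note [measurable] = square_integrable_measurable[OF sp] square_integrable_measurable[OF s\<Psi>]
  \<comment> \<open>For fixed x the kernel is an affine image of \<open>\<phi>\<close> with shift x
    / alpha and scale -1 / alpha; the Jacobian alpha^n cancels the prefactor of
    \<open>dilate\<close>.\<close>
  have kernel: "has_fourier_transform (\<lambda>y. dilate \<alpha> \<phi> (x - y)) (\<lambda>\<xi>. exp (- (\<i> * of_real (\<xi> \<bullet> x))) * \<Psi> \<xi>)" for x
  proof -
    have "has_fourier_transform (\<lambda>y. of_real (1 / \<alpha> ^ DIM('a)) * \<phi> (x /\<^sub>R \<alpha> + (- (1 / \<alpha>)) *\<^sub>R y))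
       (\<lambda>\<xi>. of_real (1 / \<alpha> ^ DIM('a)) * (of_real (1 / \<bar>- (1 / \<alpha>)\<bar> ^ DIM('a)) *
          exp (\<i> * of_real ((x /\<^sub>R \<alpha>) \<bullet> \<xi> / (- (1 / \<alpha>)))) * \<Phi> (\<xi> /\<^sub>R (- (1 / \<alpha>)))))"
      using \<alpha> by (intro has_fourier_transform_scale has_fourier_transform_affine[OF \<phi>]) simp
    moreover have "of_real (1 / \<alpha> ^ DIM('a)) * \<phi> (x /\<^sub>R \<alpha> + (- (1 / \<alpha>)) *\<^sub>R y) = dilate \<alpha> \<phi> (x - y)" for y
      by (simp add: dilate_def scaleR_diff_right divide_inverse mult.commute)
    moreover have "of_real (1 / \<alpha> ^ DIM('a)) * (of_real (1 / \<bar>- (1 / \<alpha>)\<bar> ^ DIM('a)) *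
        exp (\<i> * of_real ((x /\<^sub>R \<alpha>) \<bullet> \<xi> / (- (1 / \<alpha>)))) * \<Phi> (\<xi> /\<^sub>R (- (1 / \<alpha>)))) =
        exp (- (\<i> * of_real (\<xi> \<bullet> x))) * \<Psi> \<xi>" for \<xi>
    proof -
      have "\<xi> /\<^sub>R (- (1 / \<alpha>)) = - (\<alpha> *\<^sub>R \<xi>)" by simp
      moreover have "\<i> * of_real ((x /\<^sub>R \<alpha>) \<bullet> \<xi> / (- (1 / \<alpha>))) = - (\<i> * of_real (\<xi> \<bullet> x))"
        using \<alpha> by (simp add: inner_commute)
      moreover have "of_real (1 / \<alpha> ^ DIM('a)) * of_real (1 / \<bar>- (1 / \<alpha>)\<bar> ^ DIM('a)) = (1 :: complex)"
        using \<alpha> by (simp add: power_divide)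
      ultimately show ?thesis
        by (simp only: \<Psi>_def mult.assoc[symmetric] mult_1_left)
    qed
    ultimately show ?thesis by (simp only:)
  qed
  \<comment> \<open>A product of two L2 functions, hence in L1, and in L2 as well because
    \<open>\<Psi>\<close> is bounded. So its transform is a genuine integral at each x, and L2
    inversion applies to it too.\<close>
  define m where "m \<xi> = of_real c * (\<Psi> \<xi> * p \<xi>)" for \<xi>
  have m1: "integrable lborel m"
    unfolding m_def by (intro integrable_mult_right square_integrable_mult s\<Psi> sp)
  have m2: "square_integrable m"
    unfolding m_def
  proof (intro square_integrable_scale square_integrable_bound(1)[OF sp])
    show "norm (\<Psi> \<xi> * p \<xi>) \<le> C * norm (p \<xi>)" for \<xi>
      using bound[of "- (\<alpha> *\<^sub>R \<xi>)"] by (simp add: \<Psi>_def norm_mult mult_right_mono)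
  qed measurable
  have "mollify \<phi> \<alpha> g x = fourier_integral m x" for x
  proof -
    have "mollify \<phi> \<alpha> g x = (\<integral>y. g y * dilate \<alpha> \<phi> (x - y) \<partial>lborel)"
      by (simp add: mollify_def Defs.convolution_def mult.commute)
    also have "\<dots> = (\<integral>\<xi>. p \<xi> * (exp (- (\<i> * of_real (\<xi> \<bullet> x))) * \<Psi> \<xi>) \<partial>lborel)"
      by (rule has_fourier_transform_multiplication[OF p kernel])
    also have "\<dots> = of_real c * fourier_integral (\<lambda>\<xi>. \<Psi> \<xi> * p \<xi>) x"
    proof -
      have "of_real c * of_real ((2 * pi) powr (- real DIM('a) / 2)) = (1 :: complex)"
        unfolding of_real_mult[symmetric] c_def powr_add[symmetric] by simp
      then have "of_real c * fourier_integral (\<lambda>\<xi>. \<Psi> \<xi> * p \<xi>) x =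
          (\<integral>\<xi>. \<Psi> \<xi> * p \<xi> * exp (- (\<i> * of_real (\<xi> \<bullet> x))) \<partial>lborel)"
        unfolding fourier_integral_def mult.assoc[symmetric] by (simp only: mult_1_left)
      then show ?thesis by (simp only: mult_ac)
    qed
    also have "\<dots> = fourier_integral m x"
      unfolding m_def fourier_integral_scale ..
    finally show ?thesis .
  qed
  then have "mollify \<phi> \<alpha> g = fourier_integral m" by (rule ext)
  moreover have "m (- \<xi>) = of_real c * \<Phi> (\<alpha> *\<^sub>R \<xi>) * G \<xi>" for \<xi>
    by (simp add: m_def \<Psi>_def p_def)
  ultimately show ?thesis
    using has_fourier_transform_inversion[OF has_fourier_transform_L1_L2[OF m1 m2]]
    by (simp only: c_def)
qed

section \<open>The solution operator in frequency and its regularized inverse\<close>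

lemma borel_measurable_mittag_leffler [measurable]:
  assumes "0 < \<gamma>" "\<gamma> < 1"
  shows "mittag_leffler \<gamma> 1 \<in> borel_measurable borel"
  using isCont_mittag_leffler[OF assms]
  by (intro borel_measurable_continuous_onI continuous_at_imp_continuous_on) auto

definition heat_multiplier :: "real \<Rightarrow> real \<Rightarrow> 'a::euclidean_space \<Rightarrow> real" where
  "heat_multiplier \<gamma> t \<xi> = mittag_leffler \<gamma> 1 (- (norm \<xi>)\<^sup>2 * t powr \<gamma>)"

lemma heat_multiplier_bounds:
  assumes "0 < \<gamma>" "\<gamma> < 1"
  shows "1 / (1 + Gamma (1 - \<gamma>) * ((norm \<xi>)\<^sup>2 * t powr \<gamma>)) \<le> heat_multiplier \<gamma> t \<xi>"
    and "heat_multiplier \<gamma> t \<xi> \<le> 1" and "0 < heat_multiplier \<gamma> t \<xi>"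
proof -
  show *: "1 / (1 + Gamma (1 - \<gamma>) * ((norm \<xi>)\<^sup>2 * t powr \<gamma>)) \<le> heat_multiplier \<gamma> t \<xi>"
    and "heat_multiplier \<gamma> t \<xi> \<le> 1"
    using mittag_leffler_bounds[OF assms, of "(norm \<xi>)\<^sup>2 * t powr \<gamma>"] by (simp_all add: heat_multiplier_def)
  have "0 \<le> Gamma (1 - \<gamma>) * ((norm \<xi>)\<^sup>2 * t powr \<gamma>)"
    using assms by (intro mult_nonneg_nonneg) (auto intro: less_imp_le)
  then have "0 < 1 / (1 + Gamma (1 - \<gamma>) * ((norm \<xi>)\<^sup>2 * t powr \<gamma>))"
    by (intro divide_pos_pos) linarith+
  then show "0 < heat_multiplier \<gamma> t \<xi>"
    using * by linarith
qed

lemma borel_measurable_heat_multiplier: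
  assumes "0 < \<gamma>" "\<gamma> < 1"
  shows "heat_multiplier \<gamma> t \<in> borel_measurable borel"
proof -
  note [measurable] = borel_measurable_mittag_leffler[OF assms]
  show ?thesis unfolding heat_multiplier_def[abs_def] by measurable
qed

text \<open>Reduces the time-dependent notion of solution to one equation for transforms at time T.
  For the converse, the multiplier at every time has modulus at most 1, so each intermediate state
  has a square integrable transform and an inverse transform exists.\<close>

lemma recovers_iff:
  fixes g f :: "'a::euclidean_space \<Rightarrow> complex"
  assumes \<gamma>: "0 < \<gamma>" "\<gamma> < 1" and T: "0 < T" and g: "has_fourier_transform g G"
  shows "recovers \<gamma> T g f \<longleftrightarrow>
    (\<exists>U. has_fourier_transform f U \<and> (AE \<xi> in lborel. U \<xi> * of_real (heat_multiplier \<gamma> T \<xi>) = G \<xi>))"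
proof
  assume "recovers \<gamma> T g f"
  then obtain u U where u: "AE x in lborel. u T x = g x" "u 0 = f" "has_fourier_transform (u 0) U"
    and ut: "\<And>t. t \<in> {0..T} \<Longrightarrow> has_fourier_transform (u t) (\<lambda>\<xi>. U \<xi> * of_real (heat_multiplier \<gamma> t \<xi>))"
    unfolding recovers_def frac_heat_solution_def heat_multiplier_def by blast
  have "AE \<xi> in lborel. U \<xi> * of_real (heat_multiplier \<gamma> T \<xi>) = G \<xi>"
    using has_fourier_transform_AE_eq_iff[OF ut[of T] g] u(1) T by simp
  then show "\<exists>U. has_fourier_transform f U \<and> (AE \<xi> in lborel. U \<xi> * of_real (heat_multiplier \<gamma> T \<xi>) = G \<xi>)"
    using u(2,3) by blast
next
  assume "\<exists>U. has_fourier_transform f U \<and> (AE \<xi> in lborel. U \<xi> * of_real (heat_multiplier \<gamma> T \<xi>) = G \<xi>)"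
  then obtain U where U: "has_fourier_transform f U"
    and G: "AE \<xi> in lborel. U \<xi> * of_real (heat_multiplier \<gamma> T \<xi>) = G \<xi>"
    by blast
  have sU: "square_integrable U"
    using has_fourier_transform_square_integrable(2)[OF U] .
  note [measurable] = square_integrable_measurable[OF sU] borel_measurable_heat_multiplier[OF \<gamma>]
  have sUt: "square_integrable (\<lambda>\<xi>. U \<xi> * of_real (heat_multiplier \<gamma> t \<xi>))" for t
  proof (rule square_integrable_bound(1)[OF sU])
    show "norm (U \<xi> * of_real (heat_multiplier \<gamma> t \<xi>)) \<le> 1 * norm (U \<xi>)" for \<xi>
      using heat_multiplier_bounds(2,3)[OF \<gamma>, of t \<xi>] by (simp add: norm_mult mult_left_le)
  qed measurable
  have "\<exists>v. has_fourier_transform v (\<lambda>\<xi>. U \<xi> * of_real (heat_multiplier \<gamma> t \<xi>))" for t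
    using ex_inverse_fourier_transform[OF sUt] by blast
  then obtain v where v: "\<And>t. has_fourier_transform (v t) (\<lambda>\<xi>. U \<xi> * of_real (heat_multiplier \<gamma> t \<xi>))"
    by metis
  \<comment> \<open>An inverse transform at time 0 would agree with f only almost everywhere, while
    \<open>recovers\<close> asks for \<open>u 0 = f\<close> exactly. The transform is consistent
    there because the multiplier at t = 0 is 1.\<close>
  define u where "u t = (if t = 0 then f else v t)" for t
  have "frac_heat_solution \<gamma> T u"
    unfolding frac_heat_solution_def heat_multiplier_def[symmetric]
  proof (intro exI[of _ U] conjI ballI)
    show "has_fourier_transform (u 0) U" by (simp add: u_def U)
    show "has_fourier_transform (u t) (\<lambda>\<xi>. U \<xi> * of_real (heat_multiplier \<gamma> t \<xi>))" for t
      using U v[of t] by (cases "t = 0") (simp_all add: u_def heat_multiplier_def)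
  qed
  moreover have "AE x in lborel. u T x = g x"
    using has_fourier_transform_AE_eq_iff[OF v g] G T by (simp add: u_def)
  ultimately show "recovers \<gamma> T g f"
    unfolding recovers_def by (intro exI[of _ u]) (simp add: u_def)
qed

text \<open>For r > 1 an exponent s N > 2 dominates r^2 by a power of tau r^s, and (y/N)^N <= exp y
  dominates that power by the exponential. For r <= 1 the product is at most 1.\<close>

lemma exp_powr_decay:
  assumes "0 < \<tau>" "0 < (s::real)"
  obtains K where "0 \<le> K" "\<And>r. 0 \<le> r \<Longrightarrow> exp (- \<tau> * r powr s) * r\<^sup>2 \<le> K"
proof -
  obtain N :: nat where N: "2 / s < real N"
    using reals_Archimedean2 by blast
  then have Ns: "2 < s * real N" "N > 0"
    using assms(2) by (auto simp: pos_divide_less_eq mult.commute intro: gr0I)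
  \<comment> \<open>From r^(s N) = (y / tau)^N = (y / N)^N * (N / tau)^N with y = tau r^s.\<close>
  define K where "K = (real N / \<tau>) ^ N"
  have K: "K \<ge> 0" using assms by (simp add: K_def)
  have "exp (- \<tau> * r powr s) * r\<^sup>2 \<le> 1 + K" if r: "0 \<le> r" for r
  proof (cases "r \<le> 1")
    case True
    have "exp (- \<tau> * r powr s) * r\<^sup>2 \<le> 1 * 1"
      using assms r True by (intro mult_mono) (auto simp: power_le_one)
    then show ?thesis using K by simp
  next
    case False
    define y where "y = \<tau> * r powr s"
    have y: "y \<ge> 0" using assms by (simp add: y_def)
    have "r\<^sup>2 = r powr 2" using False by (simp add: powr_numeral)
    also have "\<dots> \<le> r powr (s * real N)"
      using False Ns by (intro powr_mono) auto
    also have "\<dots> = (y / \<tau>) ^ N"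
      using False assms by (simp add: y_def powr_powr[symmetric] powr_realpow)
    also have "\<dots> = (y / real N) ^ N * K"
      using Ns by (simp add: K_def flip: power_mult_distrib)
    also have "(y / real N) ^ N \<le> exp (y / real N) ^ N"
    proof (rule power_mono)
      show "y / real N \<le> exp (y / real N)"
        using exp_ge_add_one_self[of "y / real N"] by linarith
    qed (use y in simp)
    also have "exp (y / real N) ^ N = exp y"
      using Ns by (simp flip: exp_of_nat_mult)
    finally have "r\<^sup>2 \<le> exp y * K"
      using K by (simp add: mult_right_mono)
    then have "exp (- y) * r\<^sup>2 \<le> exp (- y) * (exp y * K)"
      by (rule mult_left_mono) simp
    also have "\<dots> = K"
      by (simp add: mult.assoc[symmetric] flip: exp_add)
    finally show ?thesis by (simp add: y_def)
  qed
  then show ?thesis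
    using that[of "1 + K"] K by simp
qed

text \<open>The reciprocal of the multiplier is at most 1 + Gamma(1-gamma) T^gamma |xi|^2. Rewriting
  |xi|^2 through |alpha xi|^2 costs alpha^(-2), so the constant obtained here grows as alpha tends
  to 0.\<close>

lemma mollified_multiplier_bounded:
  assumes \<gamma>: "0 < \<gamma>" "\<gamma> < 1" and "0 < \<tau>" "0 < s" and \<alpha>: "0 < \<alpha>"
  obtains C where "0 \<le> C"
    "\<And>\<xi> :: 'a::euclidean_space. exp (- \<tau> * norm (\<alpha> *\<^sub>R \<xi>) powr s) / heat_multiplier \<gamma> T \<xi> \<le> C"
proof -
  obtain K where K: "0 \<le> K" "\<And>r. 0 \<le> r \<Longrightarrow> exp (- \<tau> * r powr s) * r\<^sup>2 \<le> K"
    using exp_powr_decay[OF assms(3,4)] by blast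
  define B where "B = Gamma (1 - \<gamma>) * T powr \<gamma> / \<alpha>\<^sup>2"
  have B: "B \<ge> 0" using \<gamma> by (simp add: B_def less_imp_le)
  show ?thesis
  proof (rule that[of "1 + B * K"])
    show "0 \<le> 1 + B * K" using B K by simp
    fix \<xi> :: 'a
    let ?e = "exp (- \<tau> * norm (\<alpha> *\<^sub>R \<xi>) powr s)" and ?h = "heat_multiplier \<gamma> T \<xi>"
    have h: "0 < ?h" by (rule heat_multiplier_bounds(3)[OF \<gamma>])
    have D: "0 < 1 + Gamma (1 - \<gamma>) * ((norm \<xi>)\<^sup>2 * T powr \<gamma>)"
      using \<gamma> by (intro add_pos_nonneg mult_nonneg_nonneg) (auto intro: less_imp_le)
    have "1 / ?h \<le> 1 + Gamma (1 - \<gamma>) * ((norm \<xi>)\<^sup>2 * T powr \<gamma>)"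
      using heat_multiplier_bounds(1)[OF \<gamma>, of \<xi> T] h D by (simp add: divide_le_eq mult.commute)
    also have "\<dots> = 1 + B * (norm (\<alpha> *\<^sub>R \<xi>))\<^sup>2"
      using \<alpha> by (simp add: B_def power_mult_distrib)
    finally have "?e * (1 / ?h) \<le> ?e * (1 + B * (norm (\<alpha> *\<^sub>R \<xi>))\<^sup>2)"
      by (rule mult_left_mono) simp
    also have "\<dots> = ?e + B * (?e * (norm (\<alpha> *\<^sub>R \<xi>))\<^sup>2)"
      by (simp only: distrib_left mult.left_commute mult_1_right)
    also have "\<dots> \<le> 1 + B * K"
      using assms B by (intro add_mono mult_left_mono K(2)) auto
    finally show "?e / ?h \<le> 1 + B * K" by simp
  qed
qed

theorem proposition3:
  fixes \<gamma> T \<tau> s :: real and \<phi> :: "real ^ 'n \<Rightarrow> complex"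
  assumes "0 < \<gamma>" "\<gamma> < 1" and "0 < T" and "0 < \<tau>" and "0 < s"
    and "has_fourier_transform \<phi>
           (\<lambda>\<xi>. of_real ((2 * pi) powr (- real CARD('n) / 2) * exp (- \<tau> * norm \<xi> powr s)))"
  shows "regularization_method (\<lambda>\<alpha> g. recovers \<gamma> T (mollify \<phi> \<alpha> g)) (recovers \<gamma> T)"
proof -
  note \<gamma> = assms(1,2)
  define e where "e \<alpha> \<xi> = exp (- \<tau> * norm (\<alpha> *\<^sub>R \<xi>) powr s)" for \<alpha> and \<xi> :: "real ^ 'n"
  define E where "E = (heat_multiplier \<gamma> T :: real ^ 'n \<Rightarrow> real)"
  have E: "0 < E \<xi>" for \<xi>
    unfolding E_def by (rule heat_multiplier_bounds(3)[OF \<gamma>])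
  have [measurable]: "E \<in> borel_measurable borel"
    unfolding E_def by (rule borel_measurable_heat_multiplier[OF \<gamma>])
  have [measurable]: "e \<alpha> \<in> borel_measurable borel" for \<alpha>
    unfolding e_def by measurable
  have e: "0 < e \<alpha> \<xi>" "e \<alpha> \<xi> \<le> 1" for \<alpha> \<xi>
    using assms(4) by (simp_all add: e_def)
  have moll: "has_fourier_transform (mollify \<phi> \<alpha> g) (\<lambda>\<xi>. of_real (e \<alpha> \<xi>) * G \<xi>)"
    if "0 < \<alpha>" "has_fourier_transform g G" for \<alpha> g G
  proof -
    have "norm (of_real ((2 * pi) powr (- real CARD('n) / 2) * exp (- \<tau> * norm \<xi> powr s)) :: complex)
        \<le> (2 * pi) powr (- real CARD('n) / 2) * 1" for \<xi> :: "real ^ 'n"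
      unfolding norm_of_real abs_mult using assms(4) by (intro mult_mono) auto
    note has_fourier_transform_mollify[OF assms(6) this that]
    moreover have "of_real ((2 * pi) powr (real DIM(real ^ 'n) / 2)) *
        of_real ((2 * pi) powr (- real CARD('n) / 2) * exp (- \<tau> * norm (\<alpha> *\<^sub>R \<xi>) powr s)) =
        (of_real (e \<alpha> \<xi>) :: complex)" for \<xi> :: "real ^ 'n"
    proof -
      have "(2 * pi) powr (real DIM(real ^ 'n) / 2) * (2 * pi) powr (- real CARD('n) / 2) = 1"
        unfolding powr_add[symmetric] by simp
      then show ?thesis
        unfolding e_def of_real_mult[symmetric] mult.assoc[symmetric] by (simp only: mult_1_left)
    qed
    ultimately show ?thesis by (simp only:)
  qed
  \<comment> \<open>Positivity of E allows division, so the regularized solution is given in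
    frequency by an explicit multiplier. Both halves of the claim are argued from this form.\<close>
  have rec: "recovers \<gamma> T (mollify \<phi> \<alpha> g) f \<longleftrightarrow>
      (\<exists>U. has_fourier_transform f U \<and> (AE \<xi> in lborel. U \<xi> = of_real (e \<alpha> \<xi> / E \<xi>) * G \<xi>))"
    if "0 < \<alpha>" "has_fourier_transform g G" for \<alpha> g f G
  proof -
    have "U \<xi> * of_real (E \<xi>) = of_real (e \<alpha> \<xi>) * G \<xi> \<longleftrightarrow> U \<xi> = of_real (e \<alpha> \<xi> / E \<xi>) * G \<xi>" for U \<xi>
      using E[of \<xi>] by (auto simp: field_simps)
    then show ?thesis
      using recovers_iff[OF \<gamma> assms(3) moll[OF that], of f] by (simp only: E_def)
  qed
  have bounded: "bounded_linear_on_L2 (\<lambda>g. recovers \<gamma> T (mollify \<phi> \<alpha> g))" if \<alpha>: "0 < \<alpha>" for \<alpha>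
  proof -
    obtain C where C: "0 \<le> C" "\<And>\<xi> :: real ^ 'n. e \<alpha> \<xi> / E \<xi> \<le> C"
      unfolding e_def E_def using mollified_multiplier_bounded[OF \<gamma> assms(4,5) \<alpha>] by blast
    have nC: "norm (of_real (e \<alpha> \<xi> / E \<xi>) * z) \<le> C * norm z" for \<xi> and z :: complex
      unfolding norm_mult norm_of_real
      using C(2)[of \<xi>] e[of \<alpha> \<xi>] E[of \<xi>] by (intro mult_right_mono) auto
    have sq: "square_integrable (\<lambda>\<xi>. of_real (e \<alpha> \<xi> / E \<xi>) * G \<xi>)"
      and nrm: "L2_norm (\<lambda>\<xi>. of_real (e \<alpha> \<xi> / E \<xi>) * G \<xi>) \<le> C * L2_norm G"
      if G: "square_integrable G" for G
    proof -
      note [measurable] = square_integrable_measurable[OF G]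
      have m: "(\<lambda>\<xi>. of_real (e \<alpha> \<xi> / E \<xi>) * G \<xi>) \<in> borel_measurable borel" by measurable
      show "square_integrable (\<lambda>\<xi>. of_real (e \<alpha> \<xi> / E \<xi>) * G \<xi>)"
        and "L2_norm (\<lambda>\<xi>. of_real (e \<alpha> \<xi> / E \<xi>) * G \<xi>) \<le> C * L2_norm G"
        by (rule square_integrable_bound(1)[OF G m nC], rule square_integrable_bound(2)[OF G m nC C(1)])
    qed
    show ?thesis
      unfolding bounded_linear_on_L2_def
    proof (intro conjI allI impI; (elim conjE)?)
      fix g :: "real ^ 'n \<Rightarrow> complex" assume g: "square_integrable g"
      obtain G where G: "has_fourier_transform g G"
        using ex_fourier_transform[OF g] .
      obtain f where "has_fourier_transform f (\<lambda>\<xi>. of_real (e \<alpha> \<xi> / E \<xi>) * G \<xi>)"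
        using ex_inverse_fourier_transform[OF sq[OF has_fourier_transform_square_integrable(2)[OF G]]] .
      then show "\<exists>f. recovers \<gamma> T (mollify \<phi> \<alpha> g) f"
        unfolding rec[OF \<alpha> G] by auto
    next
      fix g f :: "real ^ 'n \<Rightarrow> complex"
      assume g: "square_integrable g" and f: "recovers \<gamma> T (mollify \<phi> \<alpha> g) f"
      obtain G where G: "has_fourier_transform g G"
        using ex_fourier_transform[OF g] .
      show "square_integrable f"
        using f unfolding rec[OF \<alpha> G] by (auto dest: has_fourier_transform_square_integrable)
    next
      fix g g' f f' :: "real ^ 'n \<Rightarrow> complex"
      assume g: "square_integrable g" and g': "square_integrable g'" and eq: "AE x in lborel. g x = g' x"
        and f: "recovers \<gamma> T (mollify \<phi> \<alpha> g) f" and f': "recovers \<gamma> T (mollify \<phi> \<alpha> g') f'"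
      obtain G where G: "has_fourier_transform g G"
        using ex_fourier_transform[OF g] .
      \<comment> \<open>A transform of g also serves g', since the relation respects equality almost
        everywhere; both images then have the same prescribed transform.\<close>
      have G': "has_fourier_transform g' G"
        using has_fourier_transform_square_integrable(2)[OF G]
        by (intro has_fourier_transform_cong_AE[OF G square_integrable_measurable[OF g'] eq]
            square_integrable_measurable) auto
      obtain U where U: "has_fourier_transform f U" "AE \<xi> in lborel. U \<xi> = of_real (e \<alpha> \<xi> / E \<xi>) * G \<xi>"
        using f unfolding rec[OF \<alpha> G] by blast
      obtain U' where U': "has_fourier_transform f' U'" "AE \<xi> in lborel. U' \<xi> = of_real (e \<alpha> \<xi> / E \<xi>) * G \<xi>"
        using f' unfolding rec[OF \<alpha> G'] by blast
      have "AE \<xi> in lborel. U \<xi> = U' \<xi>"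
        using U(2) U'(2) by eventually_elim simp
      then show "AE x in lborel. f x = f' x"
        unfolding has_fourier_transform_AE_eq_iff[OF U(1) U'(1)] .
    next
      fix g g' f f' h :: "real ^ 'n \<Rightarrow> complex" and a b :: complex
      assume g: "square_integrable g" and g': "square_integrable g'"
        and f: "recovers \<gamma> T (mollify \<phi> \<alpha> g) f" and f': "recovers \<gamma> T (mollify \<phi> \<alpha> g') f'"
        and h: "recovers \<gamma> T (mollify \<phi> \<alpha> (\<lambda>x. a * g x + b * g' x)) h"
      obtain G where G: "has_fourier_transform g G"
        using ex_fourier_transform[OF g] .
      obtain G' where G': "has_fourier_transform g' G'"
        using ex_fourier_transform[OF g'] .
      have H: "has_fourier_transform (\<lambda>x. a * g x + b * g' x) (\<lambda>\<xi>. a * G \<xi> + b * G' \<xi>)"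
        by (intro has_fourier_transform_add has_fourier_transform_scale G G')
      obtain U where U: "has_fourier_transform f U" "AE \<xi> in lborel. U \<xi> = of_real (e \<alpha> \<xi> / E \<xi>) * G \<xi>"
        using f unfolding rec[OF \<alpha> G] by blast
      obtain U' where U': "has_fourier_transform f' U'" "AE \<xi> in lborel. U' \<xi> = of_real (e \<alpha> \<xi> / E \<xi>) * G' \<xi>"
        using f' unfolding rec[OF \<alpha> G'] by blast
      obtain V where V: "has_fourier_transform h V"
        "AE \<xi> in lborel. V \<xi> = of_real (e \<alpha> \<xi> / E \<xi>) * (a * G \<xi> + b * G' \<xi>)"
        using h unfolding rec[OF \<alpha> H] by blast
      have W: "has_fourier_transform (\<lambda>x. a * f x + b * f' x) (\<lambda>\<xi>. a * U \<xi> + b * U' \<xi>)"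
        by (intro has_fourier_transform_add has_fourier_transform_scale U U')
      have "AE \<xi> in lborel. V \<xi> = a * U \<xi> + b * U' \<xi>"
        using U(2) U'(2) V(2) by eventually_elim (simp only: distrib_left mult.left_commute)
      then show "AE x in lborel. h x = a * f x + b * f' x"
        unfolding has_fourier_transform_AE_eq_iff[OF V(1) W] .
    next
      have "L2_norm f \<le> C * L2_norm g"
        if g: "square_integrable g" and f: "recovers \<gamma> T (mollify \<phi> \<alpha> g) f" for g f
      proof -
        obtain G where G: "has_fourier_transform g G"
          using ex_fourier_transform[OF g] .
        obtain U where U: "has_fourier_transform f U" "AE \<xi> in lborel. U \<xi> = of_real (e \<alpha> \<xi> / E \<xi>) * G \<xi>"
          using f unfolding rec[OF \<alpha> G] by blast
        have "L2_norm U = L2_norm (\<lambda>\<xi>. of_real (e \<alpha> \<xi> / E \<xi>) * G \<xi>)"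
          using U(2) has_fourier_transform_square_integrable(2)[OF U(1)]
            sq[OF has_fourier_transform_square_integrable(2)[OF G]]
          by (intro L2_norm_cong_AE square_integrable_measurable)
        then show ?thesis
          using nrm[OF has_fourier_transform_square_integrable(2)[OF G]]
            has_fourier_transform_norm[OF U(1)] has_fourier_transform_norm[OF G] by simp
      qed
      then show "\<exists>C. \<forall>g f. square_integrable g \<and> recovers \<gamma> T (mollify \<phi> \<alpha> g) f \<longrightarrow> L2_norm f \<le> C * L2_norm g"
        by blast
    qed
  qed
  have conv: "L2_tendsto w f (at_right 0)"
    if g: "square_integrable g" and P: "recovers \<gamma> T g f"
      and w: "\<And>\<alpha>. 0 < \<alpha> \<Longrightarrow> recovers \<gamma> T (mollify \<phi> \<alpha> g) (w \<alpha>)" for g f w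
  proof -
    obtain G where G: "has_fourier_transform g G"
      using ex_fourier_transform[OF g] .
    obtain U where U: "has_fourier_transform f U" "AE \<xi> in lborel. U \<xi> * of_real (E \<xi>) = G \<xi>"
      using P unfolding recovers_iff[OF \<gamma> assms(3) G] E_def by blast
    have sU: "square_integrable U"
      using has_fourier_transform_square_integrable(2)[OF U(1)] .
    note [measurable] = square_integrable_measurable[OF sU]
    have norm_w: "L2_norm (\<lambda>x. w \<alpha> x - f x) = L2_norm (\<lambda>\<xi>. of_real (e \<alpha> \<xi> - 1) * U \<xi>)"
      and sw: "square_integrable (w \<alpha>)" if \<alpha>: "0 < \<alpha>" for \<alpha>
    proof -
      obtain W where W: "has_fourier_transform (w \<alpha>) W"
        "AE \<xi> in lborel. W \<xi> = of_real (e \<alpha> \<xi> / E \<xi>) * G \<xi>"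
        using w[OF \<alpha>] unfolding rec[OF \<alpha> G] by blast
      show "square_integrable (w \<alpha>)"
        using has_fourier_transform_square_integrable(1)[OF W(1)] .
      have "AE \<xi> in lborel. W \<xi> - U \<xi> = of_real (e \<alpha> \<xi> - 1) * U \<xi>"
        using W(2) U(2)
      proof eventually_elim
        case (elim \<xi>)
        \<comment> \<open>For an exact datum G = U E, so the unbounded factor 1/E cancels and only
          (e - 1) U remains, whose modulus is at most that of U.\<close>
        show ?case
          unfolding elim(1) elim(2)[symmetric] using E[of \<xi>] by (simp add: left_diff_distrib)
      qed
      moreover have "L2_norm (\<lambda>x. w \<alpha> x - f x) = L2_norm (\<lambda>\<xi>. W \<xi> - U \<xi>)"
        by (rule has_fourier_transform_norm[OF has_fourier_transform_diff[OF W(1) U(1)], symmetric])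
      ultimately show "L2_norm (\<lambda>x. w \<alpha> x - f x) = L2_norm (\<lambda>\<xi>. of_real (e \<alpha> \<xi> - 1) * U \<xi>)"
        using square_integrable_measurable[OF has_fourier_transform_square_integrable(2)[OF W(1)]]
        by (simp add: L2_norm_cong_AE)
    qed
    \<comment> \<open>Dominated convergence is applied along t = 1 / alpha tending to infinity. The
      majorant holds for every real t, because e depends only on a norm and lies in (0, 1].\<close>
    have "((\<lambda>t. \<integral>\<xi>. (norm (of_real (e (inverse t) \<xi> - 1) * U \<xi>))\<^sup>2 \<partial>lborel) \<longlongrightarrow>
        (\<integral>\<xi>. 0 \<partial>(lborel :: (real ^ 'n) measure))) at_top"
    proof (rule integral_dominated_convergence_at_top)
      show "integrable lborel (\<lambda>\<xi>. (norm (U \<xi>))\<^sup>2)"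
        by (rule square_integrable_norm2[OF sU])
      show "\<forall>\<^sub>F t in at_top. AE \<xi> in lborel. norm ((norm (of_real (e (inverse t) \<xi> - 1) * U \<xi>))\<^sup>2) \<le> (norm (U \<xi>))\<^sup>2"
      proof (intro always_eventually allI AE_I2)
        fix t and \<xi> :: "real ^ 'n"
        have "norm (of_real (e (inverse t) \<xi> - 1) * U \<xi>) \<le> 1 * norm (U \<xi>)"
          unfolding norm_mult norm_of_real
          using e[of "inverse t" \<xi>] by (intro mult_right_mono) auto
        then show "norm ((norm (of_real (e (inverse t) \<xi> - 1) * U \<xi>))\<^sup>2) \<le> (norm (U \<xi>))\<^sup>2"
          by (simp add: power_mono)
      qed
      show "AE \<xi> in lborel. ((\<lambda>t. (norm (of_real (e (inverse t) \<xi> - 1) * U \<xi>))\<^sup>2) \<longlongrightarrow> 0) at_top"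
      proof (rule AE_I2)
        fix \<xi> :: "real ^ 'n"
        have "((\<lambda>t. norm (inverse t *\<^sub>R \<xi>)) \<longlongrightarrow> norm (0 *\<^sub>R \<xi>)) at_top"
          by (intro tendsto_norm tendsto_scaleR tendsto_const tendsto_inverse_0_at_top filterlim_ident)
        then have "((\<lambda>t. norm (inverse t *\<^sub>R \<xi>) powr s) \<longlongrightarrow> norm (0 *\<^sub>R \<xi>) powr s) at_top"
          using assms(5) by (intro tendsto_powr2 tendsto_const) auto
        then have "((\<lambda>t. e (inverse t) \<xi>) \<longlongrightarrow> exp (- \<tau> * norm (0 *\<^sub>R \<xi>) powr s)) at_top"
          unfolding e_def by (intro tendsto_exp tendsto_mult tendsto_const)
        then have "((\<lambda>t. e (inverse t) \<xi>) \<longlongrightarrow> 1) at_top"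
          by simp
        then have "((\<lambda>t. (norm (of_real (e (inverse t) \<xi> - 1) * U \<xi>))\<^sup>2) \<longlongrightarrow> (norm (of_real (1 - 1) * U \<xi>))\<^sup>2) at_top"
          by (intro tendsto_power tendsto_norm tendsto_mult tendsto_of_real tendsto_diff tendsto_const)
        then show "((\<lambda>t. (norm (of_real (e (inverse t) \<xi> - 1) * U \<xi>))\<^sup>2) \<longlongrightarrow> 0) at_top"
          by simp
      qed
    qed measurable
    from tendsto_real_sqrt[OF this]
    have "((\<lambda>t. L2_norm (\<lambda>\<xi>. of_real (e (inverse t) \<xi> - 1) * U \<xi>)) \<longlongrightarrow> 0) at_top"
      unfolding L2_norm_def by simp
    then have "((\<lambda>\<alpha>. L2_norm (\<lambda>\<xi>. of_real (e \<alpha> \<xi> - 1) * U \<xi>)) \<longlongrightarrow> 0) (at_right 0)"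
      unfolding filterlim_at_right_to_top .
    then have "((\<lambda>\<alpha>. L2_norm (\<lambda>x. w \<alpha> x - f x)) \<longlongrightarrow> 0) (at_right 0)"
      \<comment> \<open>The formula for the error norm is available for positive alpha only, which
        is enough for the filter of right neighbourhoods of 0.\<close>
      by (rule iffD1[OF tendsto_cong, rotated])
        (use norm_w in \<open>auto simp: eventually_at_filter\<close>)
    moreover have "\<forall>\<^sub>F \<alpha> in at_right 0. square_integrable (w \<alpha>)"
      using sw by (auto simp: eventually_at_filter)
    ultimately show ?thesis
      using has_fourier_transform_square_integrable(1)[OF U(1)] by (simp add: L2_tendsto_def)
  qed
  show ?thesis
    unfolding regularization_method_def using bounded conv by blast
qed

end
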